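(* Assume the multi-scale setup below and in addition $\rho_{\min}^\alpha\ge K_\alpha$. Then there exists a constant $C$ depending only on $d,\alpha,K_\alpha,K_0$ such that for all $n\ge 1$, $$I_d\, e^{-n\epsilon}\prod_{k=0}^{n}\lambda_{\min}\big(D(U_k)\big)\;\le\; D(V_0^n)\;\le\; I_d\, e^{n\epsilon}\prod_{k=0}^{n}\lambda_{\max}\big(D(U_k)\big),\qquad \epsilon=C\rho_{\min}^{-\alpha/2}.$$ In particular $\epsilon\to0$ as $\rho_{\min}\to\infty$.
   Context: For $R>0$ let $\mathbb{T}^d_R=\mathbb{R}^d/(R\mathbb{Z})^d$, $\mathbb{T}^d=\mathbb{T}^d_1$; functions on $\mathbb{T}^d_R$ are identified with $R\mathbb{Z}^d$-periodic functions on $\mathbb{R}^d$. For $U\in L^\infty(\mathbb{T}^d_R)$ let $m_U(dx)=e^{-2U(x)}dx/\int_{\mathbb{T}^d_R}e^{-2U(z)}dz$ on $\mathbb{T}^d_R$, and let the effective diffusivity $D(U)$ be the symmetric positive definite $d\times d$ matrix defined by ${}^tl D(U) l=\inf_{f\in C^\infty(\mathbb{T}^d_R)}\int_{\mathbb{T}^d_R}|l-\nabla f(x)|^2 m_U(dx)$ for $l\in\mathbb{R}^d$. $\operatorname{Osc}(U)=\sup U-\inf U$. $\lambda_{\min}(A),\lambda_{\max}(A)$ denote smallest/largest eigenvalues of a symmetric matrix $A$; matrix inequalities are in the sense of quadratic forms; $I_d$ is the identity. For $0<\alpha\le1$, $C^\alpha(\mathbb{T}^d)$ is the space of $\alpha$-Hölder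 continuous $\mathbb{Z}^d$-periodic functions and $\|T\|_\alpha=\sup_{x\neq y}|T(x)-T(y)|/|x-y|^\alpha$. Multi-scale setup: $U_k\in C^\alpha(\mathbb{T}^d)$ ($k\in\mathbb{N}$) with $U_k(0)=0$, $K_\alpha:=\sup_k\|U_k\|_\alpha<\infty$, $K_0:=\sup_k\operatorname{Osc}(U_k)$. $R_0=1$, $R_k=r_1r_2\cdots r_k$ with integers $r_k\ge2$; $\rho_{\min}=\inf_{k\ge1}r_k$, $\rho_{\max}=\sup_{k\ge1}r_k$. For $0\le p\le n$, $V_p^n(x)=\sum_{k=p}^nU_k(x/R_k)$; $V_0^n$ is $R_n\mathbb{Z}^d$-periodic and $D(V_0^n)$ is its effective diffusivity on $\mathbb{T}^d_{R_n}$. *)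

theory Defs
  imports "HOL-Analysis.Analysis"
begin

text \<open>C-infinity: all partial derivatives of all orders exist and are continuous.\<close>
definition smooth_fun :: "(real^'n \<Rightarrow> real) \<Rightarrow> bool" where
  "smooth_fun f \<longleftrightarrow> (\<exists>S. f \<in> S \<and> (\<forall>g\<in>S. continuous_on UNIV g \<and>
      (\<forall>i. \<exists>h\<in>S. \<forall>x. ((\<lambda>t. g (x + t *\<^sub>R axis i 1)) has_real_derivative h x) (at 0))))"

definition grad :: "(real^'n \<Rightarrow> real) \<Rightarrow> real^'n \<Rightarrow> real^'n" where
  "grad f x = (\<chi> i. deriv (\<lambda>t. f (x + t *\<^sub>R axis i 1)) 0)"

text \<open>R Z^d-periodicity (functions on the torus T^d_R).\<close>
definition periodic_R :: "real \<Rightarrow> (real^'n \<Rightarrow> 'b) \<Rightarrow> bool" where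
  "periodic_R R f \<longleftrightarrow> (\<forall>x i. f (x + R *\<^sub>R axis i 1) = f x)"

definition cell :: "real \<Rightarrow> (real^'n) set" where
  "cell R = cbox 0 (R *\<^sub>R One)"

definition eff_quad :: "real \<Rightarrow> (real^'n \<Rightarrow> real) \<Rightarrow> real^'n \<Rightarrow> real" where
  "eff_quad R U l = Inf {integral (cell R) (\<lambda>x. (norm (l - grad f x))\<^sup>2 * exp (-2 * U x))
                          / integral (cell R) (\<lambda>z. exp (-2 * U z))
                       | f. smooth_fun f \<and> periodic_R R f}"

text \<open>The symmetric matrix D(U) determined (by polarization) by its quadratic form.\<close>
definition eff_diff :: "real \<Rightarrow> (real^'n \<Rightarrow> real) \<Rightarrow> real^'n^'n" where
  "eff_diff R U = (\<chi> i j. (eff_quad R U (axis i 1 + axis j 1) - eff_quad R U (axis i 1)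
                            - eff_quad R U (axis j 1)) / 2)"

definition eigenvalues :: "real^'n^'n \<Rightarrow> real set" where
  "eigenvalues A = {c. \<exists>v. v \<noteq> 0 \<and> A *v v = c *\<^sub>R v}"

definition lam_min :: "real^'n^'n \<Rightarrow> real" where
  "lam_min A = Inf (eigenvalues A)"

definition lam_max :: "real^'n^'n \<Rightarrow> real" where
  "lam_max A = Sup (eigenvalues A)"

definition loewner_le :: "real^'n^'n \<Rightarrow> real^'n^'n \<Rightarrow> bool" where
  "loewner_le A B \<longleftrightarrow> (\<forall>x. x \<bullet> (A *v x) \<le> x \<bullet> (B *v x))"

definition holder_seminorm :: "real \<Rightarrow> (real^'n \<Rightarrow> real) \<Rightarrow> real" where
  "holder_seminorm \<alpha> T = Sup {\<bar>T x - T y\<bar> / norm (x - y) powr \<alpha> | x y. x \<noteq> y}"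

definition holder_torus :: "real \<Rightarrow> (real^'n \<Rightarrow> real) \<Rightarrow> bool" where
  "holder_torus \<alpha> T \<longleftrightarrow> periodic_R 1 T \<and>
     bdd_above {\<bar>T x - T y\<bar> / norm (x - y) powr \<alpha> | x y. x \<noteq> y}"

definition osc :: "(real^'n \<Rightarrow> real) \<Rightarrow> real" where
  "osc U = Sup (range U) - Inf (range U)"

definition scaleR_k :: "(nat \<Rightarrow> nat) \<Rightarrow> nat \<Rightarrow> real" where
  "scaleR_k r k = (\<Prod>j=1..k. real (r j))"

definition Vsum :: "(nat \<Rightarrow> real^'n \<Rightarrow> real) \<Rightarrow> (nat \<Rightarrow> nat) \<Rightarrow> nat \<Rightarrow> nat \<Rightarrow> real^'n \<Rightarrow> real" where
  "Vsum U r p n x = (\<Sum>k=p..n. U k ((1 / scaleR_k r k) *\<^sub>R x))"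

end

theory Submission
  imports Defs "HOL-Computational_Algebra.Polynomial"
begin

text \<open>
  The fastest scale is peeled off first. Write \<open>V = U + T\<close> with \<open>U = U\<^sub>0\<close> of period 1 and
  \<open>T = V\<^sub>1\<^sup>n\<close>, which varies by at most \<open>\<delta> = O(\<rho>\<^sup>-\<^sup>\<alpha>\<^sup>/\<^sup>2)\<close> over boxes of side
  \<open>N\<close> of order \<open>\<rho>\<^sup>\<alpha>\<^sup>/\<^sup>2\<close>. It suffices to show that
  \<open>D(V)\<close> lies between \<open>\<lambda>\<^sub>m\<^sub>i\<^sub>n(D(U)) D(T)\<close> and \<open>\<lambda>\<^sub>m\<^sub>a\<^sub>x(D(U)) D(T)\<close> up to a factor \<open>exp(C(\<delta> + 1/N))\<close>; the
  remaining scales are again a multi-scale potential after rescaling by \<open>r\<^sub>1\<close>.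

  Given a test function \<open>f\<close>, let \<open>F\<close> be its average over the lattice cube of side \<open>N\<close> and \<open>g\<close> the
  average of \<open>F\<close> over unit cubes. The Hessian of \<open>g\<close> and the unit lattice differences of
  \<open>\<nabla>F\<close> are \<open>O(1/N)\<close> relative to \<open>l - \<nabla>f\<close>, because these differences telescope.

  Upper bound: test with \<open>g(x) + \<Sum>\<^sub>i \<chi>\<^sub>i(x + y) (l - \<nabla>g(x))\<^sub>i\<close>, where \<open>\<chi>\<^sub>i\<close> are almost optimal for
  \<open>D(U)\<close>, and average over the relative translation \<open>y\<close> of the two scales.

  Lower bound: by convexity \<open>f\<close> may be replaced by \<open>F\<close>. Around each \<open>x\<close>, the function
  \<open>F(x + z) - z \<bullet> \<nabla>g(x)\<close> is almost periodic in \<open>z\<close>, so gluing its lattice translates with a partition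
  of unity changes its gradient only by \<open>O(1/N)\<close> and gives a test function for \<open>D(U)\<close> in the
  direction \<open>l - \<nabla>g(x)\<close>, while \<open>g\<close> is a test function for \<open>D(T)\<close>.
\<close>

text \<open>The obstacle is that U is only Hoelder continuous: correctors and minimisers come
  without usable bounds on second derivatives, and the infimum over smooth functions need not be
  attained. So everything is an L2 estimate against the energy of an arbitrary smooth test function,
  and only near-minimisers occur. The relative translation y makes this possible: integrating over y
  at frozen x splits a product of a corrector at x + y and a Hessian at x into two L2 factors, at
  the price of moving the slow weight from x + y to x. The inner average runs over lattice points
  because such translations fix the fast weight, so it can be taken under the full weight. The outer
  average over unit cubes turns derivatives into lattice differences. The squared errors are of size
  1 / N^2; Young's inequality with parameter 1 / N turns them into a relative loss 1 / N. The
  constants of one step depend only on the dimension and on pointwise bounds of the fast weight,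
  which follow from U 0 = 0 and the Hoelder constant. Hence one constant serves all steps.\<close>

section \<open>Smooth functions, partial derivatives and segment averages\<close>

definition pd :: "'n::finite \<Rightarrow> (real^'n \<Rightarrow> real) \<Rightarrow> real^'n \<Rightarrow> real" where
  "pd i f x = deriv (\<lambda>t. f (x + t *\<^sub>R axis i 1)) 0"

lemma grad_nth [simp]: "grad f x $ i = pd i f x"
  by (simp add: grad_def pd_def)

lemma smooth_fun_continuous: "smooth_fun f \<Longrightarrow> continuous_on UNIV f"
  unfolding smooth_fun_def by blast

lemma smooth_fun_continuous_on: "smooth_fun f \<Longrightarrow> continuous_on A f"
  using smooth_fun_continuous continuous_on_subset by blast

lemma smooth_fun_pd: assumes "smooth_fun f"
  shows "smooth_fun (pd i f)"
    and "((\<lambda>t. f (x + t *\<^sub>R axis i 1)) has_real_derivative pd i f x) (at 0)"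
proof -
  from assms obtain S where S: "f \<in> S" "\<forall>g\<in>S. continuous_on UNIV g \<and>
      (\<forall>i. \<exists>h\<in>S. \<forall>x. ((\<lambda>t. g (x + t *\<^sub>R axis i 1)) has_real_derivative h x) (at 0))"
    unfolding smooth_fun_def by blast
  then obtain h where h: "h \<in> S" "\<forall>x. ((\<lambda>t. f (x + t *\<^sub>R axis i 1)) has_real_derivative h x) (at 0)"
    by blast
  then have e: "pd i f x = h x" for x
    unfolding pd_def by (simp add: DERIV_imp_deriv)
  then have "pd i f = h" by blast
  then show "smooth_fun (pd i f)" using h S unfolding smooth_fun_def by blast
  show "((\<lambda>t. f (x + t *\<^sub>R axis i 1)) has_real_derivative pd i f x) (at 0)"
    using h e by simp
qed

lemma has_pd_unique:
  "((\<lambda>t. f (x + t *\<^sub>R axis i 1)) has_real_derivative D) (at 0) \<Longrightarrow> pd i f x = D"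
  unfolding pd_def by (simp add: DERIV_imp_deriv)

text \<open>Smoothness is shown like a bisimulation: exhibit a family of continuous functions that
  is closed under partial derivatives. No order of differentiation is counted; the work in each
  application is to find a closed family.\<close>

lemma smooth_fun_coinduct [case_names in_set continuous partial]:
  assumes "f \<in> S" "\<And>g. g \<in> S \<Longrightarrow> continuous_on UNIV g"
    "\<And>g i. g \<in> S \<Longrightarrow> \<exists>h\<in>S. \<forall>x. ((\<lambda>t. g (x + t *\<^sub>R axis i 1)) has_real_derivative h x) (at 0)"
  shows "smooth_fun f"
  using assms unfolding smooth_fun_def by blast

lemma smooth_fun_line:
  assumes "smooth_fun f"
  shows "((\<lambda>t. f (x + t *\<^sub>R axis i 1)) has_real_derivative pd i f (x + s *\<^sub>R axis i 1)) (at s)"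
proof -
  have "((\<lambda>t. f (x + s *\<^sub>R axis i 1 + t *\<^sub>R axis i 1)) has_real_derivative pd i f (x + s *\<^sub>R axis i 1)) (at 0)"
    by (rule smooth_fun_pd(2)[OF assms])
  then have "((\<lambda>t. f (x + (t + s) *\<^sub>R axis i 1)) has_real_derivative pd i f (x + s *\<^sub>R axis i 1)) (at 0)"
    by (simp add: algebra_simps)
  then show ?thesis using DERIV_shift[of "\<lambda>t. f (x + t *\<^sub>R axis i 1)" "pd i f (x + s *\<^sub>R axis i 1)" 0 s]
    by simp
qed

lemma smooth_fun_line_scaled:
  assumes "smooth_fun f"
  shows "((\<lambda>t. f (x + (s * t) *\<^sub>R axis i 1)) has_real_derivative s * pd i f (x + (s * t) *\<^sub>R axis i 1)) (at t)"
proof -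
  have "((\<lambda>t. s * t) has_real_derivative s) (at t)"
    by (auto intro!: derivative_eq_intros)
  from DERIV_chain2[OF smooth_fun_line[OF assms] this] show ?thesis by (simp add: mult.commute)
qed

lemma smooth_fun_const [simp]: "smooth_fun (\<lambda>x. c)"
proof (rule smooth_fun_coinduct[where S="range (\<lambda>c x. c)"])
  fix g :: "real^'n \<Rightarrow> real" and i assume "g \<in> range (\<lambda>c x. c)"
  then show "\<exists>h\<in>range (\<lambda>c x. c). \<forall>x. ((\<lambda>t. g (x + t *\<^sub>R axis i 1)) has_real_derivative h x) (at 0)"
    by (auto intro!: exI[where x=0])
qed auto

lemma pd_const [simp]: "pd i (\<lambda>x. c) = (\<lambda>x. 0)"
  by (rule ext, rule has_pd_unique) simp

lemma smooth_fun_nth [simp]: "smooth_fun (\<lambda>x::real^'n. x $ j)"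
proof (rule smooth_fun_coinduct[where S="insert (\<lambda>x::real^'n. x $ j) (range (\<lambda>c x. c))"])
  fix g :: "real^'n \<Rightarrow> real" and i assume "g \<in> insert (\<lambda>x. x $ j) (range (\<lambda>c x. c))"
  then consider "g = (\<lambda>x. x $ j)" | "g \<in> range (\<lambda>c x. c)" by auto
  then show "\<exists>h\<in>insert (\<lambda>x. x $ j) (range (\<lambda>c x. c)). \<forall>x. ((\<lambda>t. g (x + t *\<^sub>R axis i 1)) has_real_derivative h x) (at 0)"
  proof cases
    case 1
    have "((\<lambda>t. x $ j + t * (if i = j then 1 else 0)) has_real_derivative (if i = j then 1 else 0)) (at 0)" for x :: "real^'n"
      by (auto intro!: derivative_eq_intros)
    then show ?thesis unfolding 1
      by (intro bexI[where x="\<lambda>_. if i = j then 1 else 0"]) (auto simp: axis_def)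
  next
    case 2
    then show ?thesis by (auto intro!: bexI[where x="\<lambda>_. 0"] derivative_eq_intros)
  qed
qed (auto intro!: continuous_intros)

lemma pd_nth: "pd i (\<lambda>x::real^'n. x $ j) = (\<lambda>x. if i = j then 1 else 0)"
proof (rule ext, rule has_pd_unique)
  fix x :: "real^'n"
  have "((\<lambda>t. x $ j + t * (if i = j then 1 else 0)) has_real_derivative (if i = j then 1 else 0)) (at 0)"
      by (auto intro!: derivative_eq_intros)
  then show "((\<lambda>t. (x + t *\<^sub>R axis i 1) $ j) has_real_derivative (if i = j then 1 else 0)) (at 0)"
    by (auto simp: axis_def)
qed

text \<open>Witness family for products. Products alone are not closed under differentiation because
  the Leibniz rule yields a sum; closing under addition repairs this, and the sum rule then follows
  from the same family with factors 1.\<close>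

inductive_set prod_sums :: "(real^'n \<Rightarrow> real) set" where
  prod: "smooth_fun f \<Longrightarrow> smooth_fun g \<Longrightarrow> (\<lambda>x. f x * g x) \<in> prod_sums"
| add: "f \<in> prod_sums \<Longrightarrow> g \<in> prod_sums \<Longrightarrow> (\<lambda>x. f x + g x) \<in> prod_sums"

lemma prod_sums_continuous: "f \<in> prod_sums \<Longrightarrow> continuous_on UNIV f"
  by (induction rule: prod_sums.induct) (auto intro!: continuous_on_mult continuous_on_add dest: smooth_fun_continuous)

lemma has_pd_mult:
  assumes "smooth_fun f" "smooth_fun g"
  shows "((\<lambda>t. f (x + t *\<^sub>R axis i 1) * g (x + t *\<^sub>R axis i 1)) has_real_derivative
      (pd i f x * g x + f x * pd i g x)) (at 0)"
  using smooth_fun_pd(2)[OF assms(1), of x i] smooth_fun_pd(2)[OF assms(2), of x i]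
  by (auto intro!: derivative_eq_intros)

lemma prod_sums_smooth: assumes "f \<in> prod_sums" shows "smooth_fun f"
proof (rule smooth_fun_coinduct[where S=prod_sums])
  fix g :: "real^'n \<Rightarrow> real" and i assume "g \<in> prod_sums"
  then show "\<exists>h\<in>prod_sums. \<forall>x. ((\<lambda>t. g (x + t *\<^sub>R axis i 1)) has_real_derivative h x) (at 0)"
  proof (induction rule: prod_sums.induct)
    case (prod f g)
    show ?case
      by (rule bexI[where x="\<lambda>x. pd i f x * g x + f x * pd i g x"])
        (auto intro!: prod_sums.intros smooth_fun_pd prod has_pd_mult)
  next
    case (add f g)
    then obtain h k where "h\<in>prod_sums" "k \<in> prod_sums"
     "\<forall>x. ((\<lambda>t. f (x + t *\<^sub>R axis i 1)) has_real_derivative h x) (at 0)"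
     "\<forall>x. ((\<lambda>t. g (x + t *\<^sub>R axis i 1)) has_real_derivative k x) (at 0)" by blast
    then show ?case
      by (intro bexI[where x="\<lambda>x. h x + k x"]) (auto intro!: derivative_eq_intros prod_sums.add)
  qed
qed (auto simp: assms prod_sums_continuous)

lemma smooth_fun_mult: "smooth_fun f \<Longrightarrow> smooth_fun g \<Longrightarrow> smooth_fun (\<lambda>x. f x * g x)"
  by (rule prod_sums_smooth) (rule prod_sums.prod)

lemma smooth_fun_cmult: "smooth_fun f \<Longrightarrow> smooth_fun (\<lambda>x. c * f x)"
  by (rule smooth_fun_mult) auto

lemma smooth_fun_add: assumes "smooth_fun f" "smooth_fun g" shows "smooth_fun (\<lambda>x. f x + g x)"
  using prod_sums_smooth[OF prod_sums.add[OF prod_sums.prod[OF assms(1) smooth_fun_const[of 1]]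
        prod_sums.prod[OF assms(2) smooth_fun_const[of 1]]]] by simp

lemma smooth_fun_diff: assumes "smooth_fun f" "smooth_fun g" shows "smooth_fun (\<lambda>x. f x - g x)"
  using smooth_fun_add[OF assms(1) smooth_fun_cmult[OF assms(2), of "-1"]] by simp

lemma smooth_fun_sum: "(\<And>a. a \<in> A \<Longrightarrow> smooth_fun (f a)) \<Longrightarrow> smooth_fun (\<lambda>x. \<Sum>a\<in>A. f a x)"
  by (induction A rule: infinite_finite_induct) (auto intro: smooth_fun_add)

lemma smooth_fun_prod: "(\<And>a. a \<in> A \<Longrightarrow> smooth_fun (f a)) \<Longrightarrow> smooth_fun (\<lambda>x. \<Prod>a\<in>A. f a x)"
  by (induction A rule: infinite_finite_induct) (auto intro: smooth_fun_mult)

lemma pd_mult: "smooth_fun f \<Longrightarrow> smooth_fun g \<Longrightarrow> pd i (\<lambda>x. f x * g x) = (\<lambda>x. pd i f x * g x + f x * pd i g x)"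
  by (rule ext, rule has_pd_unique, rule has_pd_mult)

lemma pd_cmult: "smooth_fun f \<Longrightarrow> pd i (\<lambda>x. c * f x) = (\<lambda>x. c * pd i f x)"
  by (subst pd_mult) auto

lemma pd_add: "smooth_fun f \<Longrightarrow> smooth_fun g \<Longrightarrow> pd i (\<lambda>x. f x + g x) = (\<lambda>x. pd i f x + pd i g x)"
  by (rule ext, rule has_pd_unique) (auto intro!: derivative_eq_intros smooth_fun_pd(2))

lemma pd_diff: "smooth_fun f \<Longrightarrow> smooth_fun g \<Longrightarrow> pd i (\<lambda>x. f x - g x) = (\<lambda>x. pd i f x - pd i g x)"
  by (rule ext, rule has_pd_unique) (auto intro!: derivative_eq_intros smooth_fun_pd(2))

lemma pd_sum: "finite A \<Longrightarrow> (\<And>a. a \<in> A \<Longrightarrow> smooth_fun (f a)) \<Longrightarrow>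
   pd i (\<lambda>x. \<Sum>a\<in>A. f a x) = (\<lambda>x. \<Sum>a\<in>A. pd i (f a) x)"
  by (induction A rule: finite_induct) (auto simp: pd_add smooth_fun_sum)

lemma smooth_fun_affine:
  fixes f :: "real^'n \<Rightarrow> real"
  assumes "smooth_fun f" shows "smooth_fun (\<lambda>x. f (c *\<^sub>R x + z))"
    and "pd i (\<lambda>x. f (c *\<^sub>R x + z)) = (\<lambda>x. c * pd i f (c *\<^sub>R x + z))"
proof -
  have d: "((\<lambda>t. a * h (c *\<^sub>R (x + t *\<^sub>R axis i 1) + z)) has_real_derivative a * c * pd i h (c *\<^sub>R x + z)) (at 0)"
    if "smooth_fun h" for h :: "real^'n \<Rightarrow> real" and x i a
  proof -
    have "((\<lambda>t. h ((c *\<^sub>R x + z) + (c * t) *\<^sub>R axis i 1) ) has_real_derivative c * pd i h (c *\<^sub>R x + z)) (at 0)"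
      using smooth_fun_line_scaled[OF that, of "c *\<^sub>R x + z" c i 0] by simp
    from DERIV_cmult[OF this, of a] show ?thesis by (simp add: algebra_simps)
  qed
  show "smooth_fun (\<lambda>x. f (c *\<^sub>R x + z))"
  \<comment> \<open>The scalar a absorbs the factor c that every differentiation brings out.\<close>
  proof (rule smooth_fun_coinduct[where S="{\<lambda>x. a * h (c *\<^sub>R x + z) | h a. smooth_fun h}"])
    show "(\<lambda>x. f (c *\<^sub>R x + z)) \<in> {\<lambda>x. a * h (c *\<^sub>R x + z) | h a. smooth_fun h}"
      using assms by (auto intro!: exI[of _ f] exI[of _ 1])
  next
    fix g :: "real^'n \<Rightarrow> real" and i assume "g \<in> {\<lambda>x. a * h (c *\<^sub>R x + z) | h a. smooth_fun h}"
    then obtain h a where h: "g = (\<lambda>x. a * h (c *\<^sub>R x + z))" "smooth_fun h" by auto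
    show "\<exists>h\<in>{\<lambda>x. a * h (c *\<^sub>R x + z) | h a. smooth_fun h}. \<forall>x. ((\<lambda>t. g (x + t *\<^sub>R axis i 1)) has_real_derivative h x) (at 0)"
      unfolding h(1) using h(2)
      by (intro bexI[where x="\<lambda>x. (a * c) * pd i h (c *\<^sub>R x + z)"])
        (auto intro!: d simp: mult.assoc[symmetric] smooth_fun_pd(1) exI[where x="pd i h"] exI[where x="a*c"])
  qed (auto intro!: continuous_intros continuous_on_compose2[OF smooth_fun_continuous])
  show "pd i (\<lambda>x. f (c *\<^sub>R x + z)) = (\<lambda>x. c * pd i f (c *\<^sub>R x + z))"
    using d[OF assms, of 1] by (intro ext has_pd_unique) auto
qed

lemma smooth_fun_shift: "smooth_fun f \<Longrightarrow> smooth_fun (\<lambda>x. f (x + z))"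
  using smooth_fun_affine(1)[of f 1 z] by simp

lemma pd_shift: "smooth_fun f \<Longrightarrow> pd i (\<lambda>x. f (x + z)) = (\<lambda>x. pd i f (x + z))"
  using smooth_fun_affine(2)[of f i 1 z] by simp

lemma smooth_fun_shift': "smooth_fun f \<Longrightarrow> smooth_fun (\<lambda>x. f (z + x))"
  using smooth_fun_shift[of f z] by (simp add: add.commute)

lemma pd_shift': "smooth_fun f \<Longrightarrow> pd i (\<lambda>x. f (z + x)) = (\<lambda>x. pd i f (z + x))"
  using pd_shift[of f i z] by (simp add: add.commute)

text \<open>Here z is a full displacement, not a direction: with unit axis vectors the iterated
  means are unit-cube averages, and with multiples of them the fundamental theorem of calculus
  yields increments of any length.\<close>

definition Av :: "real^'n \<Rightarrow> (real^'n \<Rightarrow> real) \<Rightarrow> real^'n \<Rightarrow> real" where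
  "Av z h x = integral {0..1} (\<lambda>t. h (x + t *\<^sub>R z))"

lemma Av_continuous: "continuous_on UNIV h \<Longrightarrow> continuous_on UNIV (Av z h)"
  unfolding Av_def box_real[symmetric]
  by (rule integral_continuous_on_param)
     (auto intro!: continuous_intros continuous_on_compose2[of UNIV h] simp: split_beta)

lemma has_pd_Av: assumes "smooth_fun h"
  shows "((\<lambda>s. Av z h (x + s *\<^sub>R axis i 1)) has_real_derivative Av z (pd i h) x) (at 0)"
proof -
  have d: "((\<lambda>s. h (x + s *\<^sub>R axis i 1 + t *\<^sub>R z)) has_real_derivative pd i h (x + s *\<^sub>R axis i 1 + t *\<^sub>R z)) (at s)" for s t
    using smooth_fun_line[OF assms, of "x + t *\<^sub>R z" i s] by (simp add: algebra_simps)
  have "((\<lambda>s. integral (cbox 0 1) (\<lambda>t. h (x + s *\<^sub>R axis i 1 + t *\<^sub>R z))) has_real_derivative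
      integral (cbox 0 1) (\<lambda>t. pd i h (x + 0 *\<^sub>R axis i 1 + t *\<^sub>R z))) (at 0 within UNIV)"
    by (rule leibniz_rule_field_derivative)
      (auto intro!: d[THEN DERIV_subset] integrable_continuous_real continuous_intros
        continuous_on_compose2[OF smooth_fun_continuous[OF assms]]
        continuous_on_compose2[OF smooth_fun_continuous[OF smooth_fun_pd(1)[OF assms]]] simp: split_beta)
  then show ?thesis by (simp add: Av_def)
qed

lemma smooth_fun_Av: assumes "smooth_fun h" shows "smooth_fun (Av z h)"
proof (rule smooth_fun_coinduct[where S="{Av z h |h. smooth_fun h}"])
  show "Av z h \<in> {Av z h |h. smooth_fun h}" using assms by blast
qed (auto intro!: Av_continuous intro: smooth_fun_continuous has_pd_Av smooth_fun_pd(1))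

lemma pd_Av: "smooth_fun h \<Longrightarrow> pd i (Av z h) = Av z (pd i h)"
  by (rule ext, rule has_pd_unique, rule has_pd_Av)

text \<open>Fundamental theorem of calculus along a segment. Keeping s as a factor instead of
  dividing by it covers s = 0 and negative s.\<close>

lemma Av_pd: assumes "smooth_fun h"
  shows "s * Av (s *\<^sub>R axis i 1) (pd i h) x = h (x + s *\<^sub>R axis i 1) - h x"
proof -
  have "((\<lambda>t. s * pd i h (x + t *\<^sub>R (s *\<^sub>R axis i 1))) has_integral (h (x + (s * 1) *\<^sub>R axis i 1) - h (x + (s * 0) *\<^sub>R axis i 1))) {0..1}"
  proof (rule fundamental_theorem_of_calculus)
    fix t :: real
    have "((\<lambda>t. h (x + (s * t) *\<^sub>R axis i 1)) has_real_derivative s * pd i h (x + (s*t) *\<^sub>R axis i 1)) (at t)"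
      by (rule smooth_fun_line_scaled[OF assms])
    then show "((\<lambda>t. h (x + (s * t) *\<^sub>R axis i 1)) has_vector_derivative s * pd i h (x + t *\<^sub>R s *\<^sub>R axis i 1)) (at t within {0..1})"
      by (simp add: has_real_derivative_iff_has_vector_derivative mult.commute has_vector_derivative_at_within)
  qed simp
  then show ?thesis unfolding Av_def
    by (simp add: integral_mult_right[symmetric] integral_unique del: integral_mult_right)
qed

section \<open>Periodic integrals and averages\<close>

definition cper :: "real \<Rightarrow> (real^'n \<Rightarrow> real) \<Rightarrow> bool" where
  "cper R h \<longleftrightarrow> continuous_on UNIV h \<and> periodic_R R h"

lemma cperI: "continuous_on UNIV h \<Longrightarrow> periodic_R R h \<Longrightarrow> cper R h"
  by (simp add: cper_def)

lemma cper_cont: "cper R h \<Longrightarrow> continuous_on A h"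
  unfolding cper_def using continuous_on_subset by blast

lemma cper_cont_shift: "cper R h \<Longrightarrow> continuous_on A (\<lambda>x. h (x + z))"
  by (rule continuous_on_compose2[OF cper_cont[of R h UNIV]]) (auto intro!: continuous_intros)

lemma periodic_R_nat:
  assumes "periodic_R R f" shows "f (x + (real k * R) *\<^sub>R axis i 1) = f x"
proof (induction k)
  case (Suc k)
  have "f (x + (real (Suc k) * R) *\<^sub>R axis i 1) = f ((x + (real k * R) *\<^sub>R axis i 1) + R *\<^sub>R axis i 1)"
    by (simp add: algebra_simps)
  with assms Suc show ?case unfolding periodic_R_def by simp
qed simp

lemma periodic_R_int:
  assumes "periodic_R R f" shows "f (x + (of_int k * R) *\<^sub>R axis i 1) = f x"
proof (cases "k \<ge> 0")
  case True
  then show ?thesis using periodic_R_nat[OF assms, of x "nat k" i] by simp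
next
  case False
  then show ?thesis using periodic_R_nat[OF assms, of "x + (of_int k * R) *\<^sub>R axis i 1" "nat (-k)" i]
    by (simp add: scaleR_left_distrib[symmetric])
qed

lemma periodic_R_mult_nat: "periodic_R 1 f \<Longrightarrow> periodic_R (real m) f"
  unfolding periodic_R_def using periodic_R_nat[of 1 f] by (auto simp: periodic_R_def)

lemma sum_Basis_nth [simp]: "(\<Sum>b\<in>Basis. b $ i) = (1::real)" for i :: "'n::finite"
  using inner_sum_left_Basis[of "axis i 1 :: real^'n"]
  by (simp add: cart_eq_inner_axis inner_sum_left[symmetric])

lemma mem_cell: "x \<in> cell R \<longleftrightarrow> (\<forall>i. 0 \<le> x $ i \<and> x $ i \<le> R)"
  by (auto simp: cell_def mem_box_cart)

lemma integrable_cell: "continuous_on (cell R) h \<Longrightarrow> h integrable_on cell R"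
  for h :: "real^'n \<Rightarrow> 'b::banach"
  unfolding cell_def by (rule integrable_continuous)

lemma mem_cbox_axis:
  "x \<in> cbox (a *\<^sub>R axis i 1) (R *\<^sub>R One - b *\<^sub>R axis i 1) \<longleftrightarrow>
    a \<le> x $ i \<and> x $ i \<le> R - b \<and> (\<forall>j. j \<noteq> i \<longrightarrow> 0 \<le> x $ j \<and> x $ j \<le> R)" for x :: "real^'n"
proof -
  have "x \<in> cbox (a *\<^sub>R axis i 1) (R *\<^sub>R One - b *\<^sub>R axis i 1) \<longleftrightarrow>
    (\<forall>j. (if j = i then a \<le> x $ i \<and> x $ i \<le> R - b else 0 \<le> x $ j \<and> x $ j \<le> R))"
    unfolding mem_box_cart by (intro all_cong1) (simp add: axis_def)
  then show ?thesis by metis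
qed

text \<open>The hyperplane where coordinate i equals R - t cuts the cell. The lower part is moved by
  t onto the points with coordinate at least t; the upper part is first brought back by one period
  and lands on those with coordinate at most t.\<close>

lemma integral_cell_shift_axis_aux:
  fixes h :: "real^'n \<Rightarrow> real"
  assumes h: "cper R h" and t: "0 \<le> t" "t \<le> R"
  shows "integral (cell R) (\<lambda>x. h (x + t *\<^sub>R axis i 1)) = integral (cell R) h"
proof -
  let ?e = "axis i 1 :: real^'n"
  let ?B = "\<lambda>a b. cbox (a *\<^sub>R ?e) (R *\<^sub>R One - b *\<^sub>R ?e)"
  have e: "?e \<in> Basis" by simp
  have cell: "cell R = ?B 0 0" by (simp add: cell_def)
  have i1: "h integrable_on ?B 0 0" "(\<lambda>x. h (x + t *\<^sub>R ?e)) integrable_on ?B 0 0"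
    by (auto intro!: integrable_continuous cper_cont[OF h] cper_cont_shift[OF h])
  have per: "h (x + R *\<^sub>R ?e) = h x" for x
    using h by (auto simp: cper_def periodic_R_def)
  have per': "(\<lambda>x. h (x + t *\<^sub>R ?e)) = (\<lambda>x. h (x + (t - R) *\<^sub>R ?e))"
  proof
    fix x
    have "x + (t - R) *\<^sub>R ?e + R *\<^sub>R ?e = x + t *\<^sub>R ?e" by (simp add: scaleR_left_diff_distrib)
    then show "h (x + t *\<^sub>R ?e) = h (x + (t - R) *\<^sub>R ?e)" using per[of "x + (t - R) *\<^sub>R ?e"] by metis
  qed
  have split: "?B 0 0 \<inter> {x. x \<bullet> ?e \<le> s} = ?B 0 (R - s)" "?B 0 0 \<inter> {x. x \<bullet> ?e \<ge> s} = ?B s 0"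
    if "0 \<le> s" "s \<le> R" for s
    unfolding set_eq_iff Int_iff mem_cbox_axis mem_Collect_eq cart_eq_inner_axis[symmetric] using that by auto
  have sh: "integral (?B a b) (\<lambda>x. h (x + c *\<^sub>R ?e)) = integral (?B (a + c) (b - c)) h" for a b c
  proof -
    have "?B a b = cbox ((a + c) *\<^sub>R ?e - c *\<^sub>R ?e) ((R *\<^sub>R One - (b - c) *\<^sub>R ?e) - c *\<^sub>R ?e)"
      by (rule arg_cong2[where f=cbox]) (simp_all add: scaleR_left_distrib scaleR_left_diff_distrib)
    then show ?thesis by (simp only: integral_shift_cbox)
  qed
  have "integral (cell R) (\<lambda>x. h (x + t *\<^sub>R ?e)) =
     integral (?B 0 t) (\<lambda>x. h (x + t *\<^sub>R ?e)) + integral (?B (R - t) 0) (\<lambda>x. h (x + t *\<^sub>R ?e))"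
    using integral_split[OF i1(2) e, of "R - t"] split[of "R - t"] t unfolding cell by simp
  also have "integral (?B (R - t) 0) (\<lambda>x. h (x + t *\<^sub>R ?e)) = integral (?B (R - t) 0) (\<lambda>x. h (x + (t - R) *\<^sub>R ?e))"
    by (simp only: per')
  also have "integral (?B 0 t) (\<lambda>x. h (x + t *\<^sub>R ?e)) + \<dots> = integral (?B t 0) h + integral (?B 0 (R - t)) h"
    unfolding sh by simp
  also have "\<dots> = integral (cell R) h"
    using integral_split[OF i1(1) e, of t] split[of t] t unfolding cell by simp
  finally show ?thesis .
qed

lemma cper_shift: assumes "cper R h" shows "cper R (\<lambda>x. h (x + z))"
proof -
  have "h (x + R *\<^sub>R axis i 1 + z) = h ((x + z) + R *\<^sub>R axis i 1)" for x i
    by (simp add: algebra_simps)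
  with assms show ?thesis by (auto simp: cper_cont_shift intro!: cperI) (simp add: cper_def periodic_R_def)
qed

lemma integral_cell_shift_axis:
  fixes h :: "real^'n \<Rightarrow> real"
  assumes h: "cper R h" and R: "R > 0"
  shows "integral (cell R) (\<lambda>x. h (x + t *\<^sub>R axis i 1)) = integral (cell R) h"
proof -
  \<comment> \<open>Whole periods are removed, which leaves a shift in [0, R].\<close>
  define k where "k = \<lfloor>t / R\<rfloor>"
  have k: "of_int k * R \<le> t" "t \<le> of_int k * R + R"
  proof -
    have "of_int k \<le> t / R" "t / R \<le> of_int k + 1"
      unfolding k_def by linarith+
    then show "of_int k * R \<le> t" "t \<le> of_int k * R + R"
      using R by (auto simp: pos_le_divide_eq pos_divide_le_eq algebra_simps)
  qed
  have "h (x + t *\<^sub>R axis i 1) = h (x + (t - of_int k * R) *\<^sub>R axis i 1)" for x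
    using periodic_R_int[of R h "x + (t - of_int k * R) *\<^sub>R axis i 1" k i] h
    by (simp add: cper_def scaleR_left_distrib[symmetric] add.assoc)
  then show ?thesis using integral_cell_shift_axis_aux[OF h, of "t - of_int k * R" i] k by simp
qed

lemma vec_axis_sum: "z = (\<Sum>i\<in>UNIV. (z $ i) *\<^sub>R axis i 1)" for z :: "real^'n"
  using basis_expansion[of z] by (simp add: scalar_mult_eq_scaleR)

lemma integral_cell_shift:
  fixes h :: "real^'n \<Rightarrow> real"
  assumes h: "cper R h" and R: "R > 0"
  shows "integral (cell R) (\<lambda>x. h (x + z)) = integral (cell R) h"
proof -
  have "integral (cell R) (\<lambda>x. h (x + (\<Sum>i\<in>S. (z $ i) *\<^sub>R axis i 1))) = integral (cell R) h" for S
  proof (induction S rule: infinite_finite_induct)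
    case (insert i S)
    then show ?case
      using integral_cell_shift_axis[OF cper_shift[OF h, of "\<Sum>i\<in>S. (z $ i) *\<^sub>R axis i 1"] R, of "z $ i" i]
      by (simp add: algebra_simps)
  qed auto
  from this[of UNIV] show ?thesis by (simp add: vec_axis_sum[symmetric])
qed

lemma cper_const [simp]: "cper R (\<lambda>x. c)" by (simp add: cper_def periodic_R_def)
lemma cper_add: "cper R f \<Longrightarrow> cper R g \<Longrightarrow> cper R (\<lambda>x. f x + g x)"
  by (auto simp: cper_def periodic_R_def intro!: continuous_on_add)
lemma cper_diff: "cper R f \<Longrightarrow> cper R g \<Longrightarrow> cper R (\<lambda>x. f x - g x)"
  by (auto simp: cper_def periodic_R_def intro!: continuous_on_diff)
lemma cper_mult: "cper R f \<Longrightarrow> cper R g \<Longrightarrow> cper R (\<lambda>x. f x * g x)"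
  by (auto simp: cper_def periodic_R_def intro!: continuous_on_mult)
lemma cper_cmult: "cper R f \<Longrightarrow> cper R (\<lambda>x. c * f x)" by (auto intro: cper_mult)
lemma cper_power: "cper R f \<Longrightarrow> cper R (\<lambda>x. f x ^ n)"
  by (auto simp: cper_def periodic_R_def intro!: continuous_on_power)
lemma cper_divide: "cper R f \<Longrightarrow> cper R (\<lambda>x. f x / c)"
  using cper_cmult[of R f "inverse c"] by (simp add: field_simps)
lemma cper_exp: "cper R f \<Longrightarrow> cper R (\<lambda>x. exp (f x))"
  by (auto simp: cper_def periodic_R_def intro!: continuous_on_exp)
lemma cper_sum: "(\<And>a. a \<in> A \<Longrightarrow> cper R (f a)) \<Longrightarrow> cper R (\<lambda>x. \<Sum>a\<in>A. f a x)"
  by (induction A rule: infinite_finite_induct) (auto intro: cper_add)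
lemma periodic_shift: "periodic_R R h \<Longrightarrow> periodic_R R (\<lambda>x. h (x + z))"
  unfolding periodic_R_def by (metis add.commute add.left_commute)

lemma cper_Av: assumes "cper R h" shows "cper R (Av z h)"
proof -
  have "h (x + R *\<^sub>R axis i 1 + t *\<^sub>R z) = h (x + t *\<^sub>R z)" for x i t
    using periodic_shift[of R h "t *\<^sub>R z"] assms by (auto simp: cper_def periodic_R_def)
  with assms show ?thesis by (auto intro!: cperI Av_continuous simp: cper_cont) (simp add: periodic_R_def Av_def)
qed

section \<open>Lattice averages, lattice differences and unit-cube averages\<close>

text \<open>A discrete average, because lattice translations leave every 1-periodic weight
  unchanged. A continuous average of side N would move the fast weight as well.\<close>

definition Lt :: "nat \<Rightarrow> 'n \<Rightarrow> (real^'n \<Rightarrow> real) \<Rightarrow> real^'n \<Rightarrow> real" where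
  "Lt N i h x = (\<Sum>p<N. h (x + real p *\<^sub>R axis i 1)) / real N"

lemma cper_Lt: "cper R h \<Longrightarrow> cper R (Lt N i h)"
  unfolding Lt_def by (intro cper_divide cper_sum cper_shift)

lemma periodic_pd: assumes "periodic_R R f" shows "periodic_R R (pd i f)"
proof -
  have "(\<lambda>t. f (x + R *\<^sub>R axis j 1 + t *\<^sub>R axis i 1)) = (\<lambda>t. f (x + t *\<^sub>R axis i 1))" for x j
    using assms unfolding periodic_R_def by (metis add.commute add.left_commute)
  then show ?thesis unfolding periodic_R_def pd_def by simp
qed

definition sper :: "real \<Rightarrow> (real^'n \<Rightarrow> real) \<Rightarrow> bool" where
  "sper R h \<longleftrightarrow> smooth_fun h \<and> periodic_R R h"

lemma sper_smooth: "sper R h \<Longrightarrow> smooth_fun h" by (simp add: sper_def)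
lemma sper_cper: "sper R h \<Longrightarrow> cper R h" by (simp add: sper_def cper_def smooth_fun_continuous)
lemma sperI: "smooth_fun h \<Longrightarrow> cper R h \<Longrightarrow> sper R h" by (simp add: sper_def cper_def)
lemma sper_pd: "sper R h \<Longrightarrow> sper R (pd i h)" by (simp add: sper_def smooth_fun_pd periodic_pd)
lemma sper_const [simp]: "sper R (\<lambda>x. c)" by (simp add: sperI)
lemma sper_add: "sper R f \<Longrightarrow> sper R g \<Longrightarrow> sper R (\<lambda>x. f x + g x)"
  by (intro sperI smooth_fun_add cper_add) (auto intro: sper_smooth sper_cper)
lemma sper_diff: "sper R f \<Longrightarrow> sper R g \<Longrightarrow> sper R (\<lambda>x. f x - g x)"
  by (intro sperI smooth_fun_diff cper_diff) (auto intro: sper_smooth sper_cper)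
lemma sper_mult: "sper R f \<Longrightarrow> sper R g \<Longrightarrow> sper R (\<lambda>x. f x * g x)"
  by (intro sperI smooth_fun_mult cper_mult) (auto intro: sper_smooth sper_cper)
lemma sper_cmult: "sper R f \<Longrightarrow> sper R (\<lambda>x. c * f x)"
  by (intro sper_mult) auto
lemma sper_sum: "(\<And>a. a \<in> A \<Longrightarrow> sper R (f a)) \<Longrightarrow> sper R (\<lambda>x. \<Sum>a\<in>A. f a x)"
  by (intro sperI smooth_fun_sum cper_sum) (auto intro: sper_smooth sper_cper)
lemma sper_shift: "sper R h \<Longrightarrow> sper R (\<lambda>x. h (x + z))"
  by (intro sperI smooth_fun_shift cper_shift) (auto intro: sper_smooth sper_cper)
lemma sper_Av: "sper R h \<Longrightarrow> sper R (Av z h)"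
  by (intro sperI smooth_fun_Av cper_Av) (auto intro: sper_smooth sper_cper)
lemma sper_Lt: assumes "sper R h" shows "sper R (Lt N i h)"
  using sper_cmult[OF sper_sum[of "{..<N}" R "\<lambda>p x. h (x + real p *\<^sub>R axis i 1)"], of "inverse (real N)"]
  using assms unfolding Lt_def by (auto simp: sper_shift field_simps)

lemma pd_Lt: assumes "smooth_fun h" shows "pd j (Lt N i h) = Lt N i (pd j h)"
proof -
  have "Lt N i h = (\<lambda>x. inverse (real N) * (\<Sum>p<N. h (x + real p *\<^sub>R axis i 1)))"
    by (simp add: Lt_def fun_eq_iff field_simps)
  then have "pd j (Lt N i h) = pd j (\<lambda>x. inverse (real N) * (\<Sum>p<N. h (x + real p *\<^sub>R axis i 1)))" by simp
  also have "\<dots> = (\<lambda>x. inverse (real N) * (\<Sum>p<N. pd j h (x + real p *\<^sub>R axis i 1)))" using assms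
    by (simp add: pd_cmult pd_sum smooth_fun_shift smooth_fun_sum pd_shift)
  finally show ?thesis by (simp add: fun_eq_iff Lt_def divide_inverse)
qed

definition Dl :: "'n \<Rightarrow> (real^'n \<Rightarrow> real) \<Rightarrow> real^'n \<Rightarrow> real" where
  "Dl i h x = h (x + axis i 1) - h x"

lemma cper_Dl: "cper R h \<Longrightarrow> cper R (Dl i h)"
  unfolding Dl_def by (intro cper_diff cper_shift)
lemma sper_Dl: "sper R h \<Longrightarrow> sper R (Dl i h)"
  unfolding Dl_def by (intro sper_diff sper_shift)
lemma pd_Dl: "smooth_fun h \<Longrightarrow> pd j (Dl i h) = Dl i (pd j h)"
  unfolding Dl_def by (simp add: pd_diff smooth_fun_shift pd_shift)

text \<open>The coordinates form a list so that estimates go by induction, one direction at a time,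
  and so that \<open>remove1\<close> can record which average a derivative has used up.\<close>

abbreviation Avs :: "'n list \<Rightarrow> (real^'n \<Rightarrow> real) \<Rightarrow> real^'n \<Rightarrow> real" where
  "Avs \<equiv> foldr (\<lambda>i. Av (axis i 1))"
abbreviation Lts :: "nat \<Rightarrow> 'n list \<Rightarrow> (real^'n \<Rightarrow> real) \<Rightarrow> real^'n \<Rightarrow> real" where
  "Lts N \<equiv> foldr (Lt N)"

lemma cper_Avs: "cper R h \<Longrightarrow> cper R (Avs is h)" by (induction "is") (auto intro: cper_Av)
lemma sper_Avs: "sper R h \<Longrightarrow> sper R (Avs is h)" by (induction "is") (auto intro: sper_Av)
lemma cper_Lts: "cper R h \<Longrightarrow> cper R (Lts N is h)" by (induction "is") (auto intro: cper_Lt)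
lemma sper_Lts: "sper R h \<Longrightarrow> sper R (Lts N is h)" by (induction "is") (auto intro: sper_Lt)
lemma smooth_fun_Avs: "smooth_fun h \<Longrightarrow> smooth_fun (Avs is h)" by (induction "is") (auto intro: smooth_fun_Av)

lemma pd_Avs: "smooth_fun h \<Longrightarrow> pd j (Avs is h) = Avs is (pd j h)"
  by (induction "is") (auto simp: pd_Av smooth_fun_Avs)
lemma pd_Lts: "sper R h \<Longrightarrow> pd j (Lts N is h) = Lts N is (pd j h)"
  by (induction "is") (auto simp: pd_Lt sper_Lts[THEN sper_smooth])

lemma integrable_segment: "cper R h \<Longrightarrow> (\<lambda>t. h (x + t *\<^sub>R z)) integrable_on {0..1::real}"
  by (intro integrable_continuous_real continuous_on_compose2[OF cper_cont[of R h UNIV]])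
    (auto intro!: continuous_intros)

lemma Av_diff: assumes "cper R f" "cper R g"
  shows "Av z (\<lambda>x. f x - g x) = (\<lambda>x. Av z f x - Av z g x)"
  using assms[THEN integrable_segment] by (simp add: Av_def[abs_def] integral_diff)

lemma Av_const [simp]: "Av z (\<lambda>x. c) = (\<lambda>x. c)" by (simp add: Av_def[abs_def])

lemma Avs_diff: assumes "cper R f" "cper R g"
  shows "Avs is (\<lambda>x. f x - g x) = (\<lambda>x. Avs is f x - Avs is g x)"
  by (induction "is") (auto simp: Av_diff[OF cper_Avs[OF assms(1)] cper_Avs[OF assms(2)]])
lemma Avs_const [simp]: "Avs is (\<lambda>x. c) = (\<lambda>x. c)" by (induction "is") auto

lemma Lt_diff: "Lt N i (\<lambda>x. f x - g x) = (\<lambda>x. Lt N i f x - Lt N i g x)"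
  by (simp add: Lt_def[abs_def] sum_subtractf diff_divide_distrib)
lemma Lts_diff: "Lts N is (\<lambda>x. f x - g x) = (\<lambda>x. Lts N is f x - Lts N is g x)"
  by (induction "is") (auto simp: Lt_diff)
lemma Lts_const: "N > 0 \<Longrightarrow> Lts N is (\<lambda>x. c) = (\<lambda>x. c)"
  by (induction "is") (auto simp: Lt_def)

lemma Av_Dl: assumes "cper R h" shows "Av z (Dl i h) = Dl i (Av z h)"
proof -
  have "h (x + t *\<^sub>R z + axis i 1) = h ((x + axis i 1) + t *\<^sub>R z)" for x t by (simp add: algebra_simps)
  then show ?thesis using Av_diff[OF cper_shift[OF assms] assms, of z "axis i 1"]
    by (simp add: Dl_def[abs_def]) (simp add: Av_def)
qed

lemma Avs_Dl: "cper R h \<Longrightarrow> Avs is (Dl i h) = Dl i (Avs is h)"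
  by (induction "is") (auto simp: Av_Dl[OF cper_Avs])

lemma Lt_Dl: "Lt N j (Dl i h) = Dl i (Lt N j h)"
  by (simp add: Lt_def Dl_def fun_eq_iff sum_subtractf diff_divide_distrib algebra_simps)

text \<open>Telescoping: a unit difference of an N-fold lattice average sees only its two ends. This
  is why lattice differences are of order 1 / N.\<close>

lemma Dl_Lt: "Dl i (Lt N i h) = (\<lambda>x. (h (x + real N *\<^sub>R axis i 1) - h x) / real N)"
proof
  fix x
  have "Dl i (Lt N i h) x = (\<Sum>p<N. h (x + real (Suc p) *\<^sub>R axis i 1) - h (x + real p *\<^sub>R axis i 1)) / real N"
    by (simp add: Lt_def Dl_def sum_subtractf diff_divide_distrib algebra_simps)
  also have "(\<Sum>p<N. h (x + real (Suc p) *\<^sub>R axis i 1) - h (x + real p *\<^sub>R axis i 1)) = h (x + real N *\<^sub>R axis i 1) - h x"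
    by (subst sum_lessThan_telescope) simp
  finally show "Dl i (Lt N i h) x = (h (x + real N *\<^sub>R axis i 1) - h x) / real N" .
qed

lemma Av_pd_axis: "smooth_fun h \<Longrightarrow> Av (axis i 1) (pd i h) = Dl i h"
  using Av_pd[of h 1 i] by (auto simp: Dl_def)

text \<open>A derivative in an averaged direction undoes that one average and leaves a unit
  difference under the remaining ones. Second derivatives of a cube average are therefore averages
  of differences of first derivatives.\<close>

lemma pd_Avs_mem:
  assumes "i \<in> set is" "sper R h"
  shows "pd i (Avs is h) = Avs (remove1 i is) (Dl i h)"
  using assms(1)
proof (induction "is")
  case (Cons k "is")
  have s: "smooth_fun (Avs is h)" using assms by (intro smooth_fun_Avs sper_smooth)
  show ?case
  proof (cases "k = i")
    case True
    have "pd i (Avs (k # is) h) = Av (axis i 1) (pd i (Avs is h))" using s True by (simp add: pd_Av)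
    also have "\<dots> = Dl i (Avs is h)" using s by (rule Av_pd_axis)
    finally show ?thesis using True by (simp add: Avs_Dl[OF sper_cper[OF assms(2)]])
  next
    case False
    then show ?thesis using Cons s by (simp add: pd_Av)
  qed
qed simp

section \<open>Weighted square integrals\<close>

definition wsq :: "real \<Rightarrow> (real^'n \<Rightarrow> real) \<Rightarrow> (real^'n \<Rightarrow> real) \<Rightarrow> real" where
  "wsq R \<omega> h = integral (cell R) (\<lambda>x. (h x)\<^sup>2 * \<omega> x)"

lemma integral_cell_mono:
  fixes f g :: "real^'n \<Rightarrow> real"
  assumes "continuous_on (cell R) f" "continuous_on (cell R) g" "\<And>x. x \<in> cell R \<Longrightarrow> f x \<le> g x"
  shows "integral (cell R) f \<le> integral (cell R) g"
  using assms by (intro integral_le integrable_cell) auto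

lemma integral_cell_cmult: "integral (cell R) (\<lambda>x. c * f x) = c * integral (cell R) f" for f :: "real^'n \<Rightarrow> real"
  by simp

lemma integral_cell_add: "continuous_on (cell R) f \<Longrightarrow> continuous_on (cell R) g \<Longrightarrow>
  integral (cell R) (\<lambda>x. f x + g x) = integral (cell R) f + integral (cell R) g" for f g :: "real^'n \<Rightarrow> real"
  by (intro integral_add integrable_cell)

lemma integral_cell_diff: "continuous_on (cell R) f \<Longrightarrow> continuous_on (cell R) g \<Longrightarrow>
  integral (cell R) (\<lambda>x. f x - g x) = integral (cell R) f - integral (cell R) g" for f g :: "real^'n \<Rightarrow> real"
  by (intro integral_diff integrable_cell)

lemma integral_cell_sum: "finite A \<Longrightarrow> (\<And>a. a \<in> A \<Longrightarrow> continuous_on (cell R) (f a)) \<Longrightarrow>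
  integral (cell R) (\<lambda>x. \<Sum>a\<in>A. f a x) = (\<Sum>a\<in>A. integral (cell R) (f a))" for f :: "'a \<Rightarrow> real^'n \<Rightarrow> real"
  by (intro integral_sum integrable_cell)

text \<open>Integrate the square of g - m over the interval, where m is the mean of g.\<close>

lemma jensen_01:
  fixes g :: "real \<Rightarrow> real"
  assumes "continuous_on {0..1} g"
  shows "(integral {0..1} g)\<^sup>2 \<le> integral {0..1} (\<lambda>t. (g t)\<^sup>2)"
proof -
  define m where "m = integral {0..1} g"
  have i: "g integrable_on {0..1}" "(\<lambda>t. (g t)\<^sup>2) integrable_on {0..1}" "(\<lambda>t. 2 * m * g t) integrable_on {0..1}"
    using assms by (auto intro!: integrable_continuous_real continuous_intros)
  have "((\<lambda>t. ((g t)\<^sup>2 - 2 * m * g t) + m\<^sup>2) has_integral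
      (integral {0..1} (\<lambda>t. (g t)\<^sup>2) - 2 * m * m + (1 - 0) *\<^sub>R m\<^sup>2)) {0..1::real}"
    unfolding m_def
    by (intro has_integral_add has_integral_diff has_integral_mult_right integrable_integral i)
       (use has_integral_const_real[of "(integral {0..1} g)\<^sup>2" 0 1] in simp)
  moreover have "0 \<le> ((g t)\<^sup>2 - 2 * m * g t) + m\<^sup>2" for t
    using zero_le_power2[of "g t - m"] by (simp add: power2_eq_square algebra_simps)
  ultimately have "0 \<le> integral {0..1} (\<lambda>t. (g t)\<^sup>2) - 2 * m * m + (1 - 0) *\<^sub>R m\<^sup>2"
    by (rule has_integral_nonneg)
  then show ?thesis unfolding m_def by (simp add: power2_eq_square)
qed

locale weight =
  fixes R :: real and \<omega> :: "real^'n \<Rightarrow> real"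
  assumes R_pos: "R > 0" and w_cper: "cper R \<omega>" and w_pos: "\<omega> x > 0"
begin

lemma w_cont: "continuous_on A \<omega>" by (rule cper_cont[OF w_cper])

lemma wsq_integrand: "cper R h \<Longrightarrow> continuous_on A (\<lambda>x. (h x)\<^sup>2 * \<omega> x)"
  by (rule cper_cont, rule cper_mult[OF cper_power w_cper])

lemma wsq_nonneg: "cper R h \<Longrightarrow> 0 \<le> wsq R \<omega> h"
  unfolding wsq_def by (intro integral_nonneg integrable_cell wsq_integrand) (auto simp: w_pos less_imp_le)

lemma wsq_cmult: "wsq R \<omega> (\<lambda>x. a * h x) = a\<^sup>2 * wsq R \<omega> h"
  unfolding wsq_def by (simp add: power_mult_distrib mult.assoc)

lemma wsq_minus: "wsq R \<omega> (\<lambda>x. - h x) = wsq R \<omega> h"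
  unfolding wsq_def by simp

lemma wsq_add_le:
  assumes "cper R h" "cper R k"
  shows "wsq R \<omega> (\<lambda>x. h x + k x) \<le> 2 * wsq R \<omega> h + 2 * wsq R \<omega> k"
proof -
  have "wsq R \<omega> (\<lambda>x. h x + k x) \<le> integral (cell R) (\<lambda>x. 2 * ((h x)\<^sup>2 * \<omega> x) + 2 * ((k x)\<^sup>2 * \<omega> x))"
    unfolding wsq_def
  proof (rule integral_cell_mono)
    fix x
    have "(h x + k x)\<^sup>2 \<le> 2 * (h x)\<^sup>2 + 2 * (k x)\<^sup>2"
      using sum_squares_bound[of "h x" "k x"] by (simp add: power2_sum)
    from mult_right_mono[OF this, of "\<omega> x"] show "(h x + k x)\<^sup>2 * \<omega> x \<le> 2 * ((h x)\<^sup>2 * \<omega> x) + 2 * ((k x)\<^sup>2 * \<omega> x)"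
      using w_pos[of x] by (simp add: algebra_simps)
  qed (use assms in \<open>auto intro!: wsq_integrand cper_add continuous_on_add continuous_on_mult_left\<close>)
  also have "\<dots> = 2 * wsq R \<omega> h + 2 * wsq R \<omega> k"
    unfolding wsq_def using assms
    by (subst integral_cell_add) (auto intro!: wsq_integrand continuous_on_mult_left)
  finally show ?thesis .
qed

lemma wsq_diff_le:
  assumes "cper R h" "cper R k"
  shows "wsq R \<omega> (\<lambda>x. h x - k x) \<le> 2 * wsq R \<omega> h + 2 * wsq R \<omega> k"
  using wsq_add_le[OF assms(1), of "\<lambda>x. - k x"] cper_cmult[OF assms(2), of "-1"] by (simp add: wsq_minus)

text \<open>By periodicity the integral is translation invariant, so the only loss is the comparison
  of the weight with its own translate.\<close>

lemma wsq_shift: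
  assumes "cper R h" and w: "\<And>x. \<omega> x \<le> c * \<omega> (x + z)"
  shows "wsq R \<omega> (\<lambda>x. h (x + z)) \<le> c * wsq R \<omega> h"
proof -
  have "wsq R \<omega> (\<lambda>x. h (x + z)) \<le> integral (cell R) (\<lambda>x. c * ((h (x + z))\<^sup>2 * \<omega> (x + z)))"
    unfolding wsq_def
  proof (rule integral_cell_mono)
    show "continuous_on (cell R) (\<lambda>x. c * ((h (x + z))\<^sup>2 * \<omega> (x + z)))"
      by (intro continuous_on_mult_left cper_cont[of R] cper_shift[OF cper_mult[OF cper_power[OF assms(1)] w_cper]])
  next
    fix x show "(h (x + z))\<^sup>2 * \<omega> x \<le> c * ((h (x + z))\<^sup>2 * \<omega> (x + z))"
      using mult_left_mono[OF w[of x], of "(h (x + z))\<^sup>2"] by (simp add: algebra_simps)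
  qed (auto intro!: wsq_integrand cper_shift assms)
  also have "\<dots> = c * wsq R \<omega> h"
    unfolding wsq_def integral_cell_cmult
    using integral_cell_shift[OF cper_mult[OF cper_power[OF assms(1), of 2] w_cper] R_pos, of z] by simp
  finally show ?thesis .
qed

text \<open>Jensen in t, then an exchange of the two integrals. The integrand is a general function
  of x and t so that the lemma serves both for averages and for the deviation of an average from the
  function.\<close>

lemma wsq_segment_le:
  fixes G :: "real^'n \<Rightarrow> real \<Rightarrow> real"
  assumes G: "continuous_on UNIV (\<lambda>(x, t). G x t)" and per: "\<And>t. periodic_R R (\<lambda>x. G x t)"
    and B: "\<And>t. 0 \<le> t \<Longrightarrow> t \<le> 1 \<Longrightarrow> wsq R \<omega> (\<lambda>x. G x t) \<le> B"
  shows "wsq R \<omega> (\<lambda>x. integral {0..1} (G x)) \<le> B"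
proof -
  have Gc: "continuous_on A (\<lambda>p. G (f p) (g p))" if "continuous_on A f" "continuous_on A g" for A f and g :: "'b::topological_space \<Rightarrow> real"
    using continuous_on_compose2[OF G, of A "\<lambda>p. (f p, g p)"] that by (auto intro!: continuous_intros)
  have Gi: "continuous_on A (\<lambda>x. integral {0..1} (G x))" for A
    unfolding box_real[symmetric]
    by (rule integral_continuous_on_param) (auto intro!: Gc continuous_intros simp: split_beta)
  have Gi2: "continuous_on A (\<lambda>x. integral {0..1} (\<lambda>t. (G x t)\<^sup>2 * \<omega> x))" for A
    unfolding box_real[symmetric]
    by (rule integral_continuous_on_param)
      (auto intro!: Gc continuous_intros continuous_on_compose2[OF w_cont[of UNIV]] simp: split_beta)
  have "wsq R \<omega> (\<lambda>x. integral {0..1} (G x)) \<le> integral (cell R) (\<lambda>x. integral {0..1} (\<lambda>t. (G x t)\<^sup>2 * \<omega> x))"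
    unfolding wsq_def
  proof (rule integral_cell_mono)
    fix x
    show "(integral {0..1} (G x))\<^sup>2 * \<omega> x \<le> integral {0..1} (\<lambda>t. (G x t)\<^sup>2 * \<omega> x)"
      using mult_right_mono[OF jensen_01[of "G x"], of "\<omega> x"] w_pos[of x] Gc[of "{0..1}" "\<lambda>_. x" "\<lambda>t. t"]
      by auto
  qed (intro Gi Gi2 continuous_intros w_cont)+
  also have "\<dots> = integral {0..1} (\<lambda>t. wsq R \<omega> (\<lambda>x. G x t))"
    unfolding wsq_def cell_def box_real[symmetric]
    by (rule integral_swap_continuous)
     (auto intro!: Gc continuous_intros continuous_on_compose2[OF w_cont[of UNIV]] simp: split_beta)
  also have "\<dots> \<le> integral {0..1::real} (\<lambda>t. B)"
  proof (rule integral_le)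
    show "(\<lambda>t. wsq R \<omega> (\<lambda>x. G x t)) integrable_on {0..1}"
      unfolding wsq_def cell_def
      by (intro integrable_continuous_real integral_continuous_on_param)
       (auto intro!: Gc continuous_intros continuous_on_compose2[OF w_cont[of UNIV]] simp: split_beta)
  qed (use B in auto)
  finally show ?thesis by simp
qed

lemma wsq_Av:
  assumes h: "cper R h" and w: "\<And>x t. 0 \<le> t \<Longrightarrow> t \<le> 1 \<Longrightarrow> \<omega> x \<le> c * \<omega> (x + t *\<^sub>R z)"
  shows "wsq R \<omega> (Av z h) \<le> c * wsq R \<omega> h"
  unfolding Av_def
proof (rule wsq_segment_le)
  show "continuous_on UNIV (\<lambda>(x, t). h (x + t *\<^sub>R z))"
    by (auto intro!: continuous_on_compose2[OF cper_cont[OF h, of UNIV]] continuous_intros simp: split_beta)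
  show "periodic_R R (\<lambda>x. h (x + t *\<^sub>R z))" for t
    using cper_shift[OF h] by (simp add: cper_def)
qed (rule wsq_shift[OF h w])

lemma wsq_Av_diff:
  assumes h: "cper R h" and B: "\<And>t. 0 \<le> t \<Longrightarrow> t \<le> 1 \<Longrightarrow> wsq R \<omega> (\<lambda>x. h (x + t *\<^sub>R z) - h x) \<le> B"
  shows "wsq R \<omega> (\<lambda>x. Av z h x - h x) \<le> B"
proof -
  have "Av z h x - h x = integral {0..1} (\<lambda>t. h (x + t *\<^sub>R z) - h x)" for x
    using integrable_segment[OF h, of x z] by (subst integral_diff) (auto simp: Av_def)
  then have "wsq R \<omega> (\<lambda>x. Av z h x - h x) = wsq R \<omega> (\<lambda>x. integral {0..1} (\<lambda>t. h (x + t *\<^sub>R z) - h x))"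
    by simp
  also have "\<dots> \<le> B"
  proof (rule wsq_segment_le)
    show "continuous_on UNIV (\<lambda>(x, t). h (x + t *\<^sub>R z) - h x)"
      by (auto intro!: continuous_on_compose2[OF cper_cont[OF h, of UNIV]] continuous_intros simp: split_beta)
    show "periodic_R R (\<lambda>x. h (x + t *\<^sub>R z) - h x)" for t
      using cper_diff[OF cper_shift[OF h] h] by (simp add: cper_def)
  qed (use B in auto)
  finally show ?thesis .
qed

lemma wsq_shift_axis_diff:
  assumes h: "sper R h" and w: "\<And>x t. 0 \<le> t \<Longrightarrow> t \<le> 1 \<Longrightarrow> \<omega> x \<le> c * \<omega> (x + t *\<^sub>R (s *\<^sub>R axis i 1))"
  shows "wsq R \<omega> (\<lambda>x. h (x + s *\<^sub>R axis i 1) - h x) \<le> s\<^sup>2 * (c * wsq R \<omega> (pd i h))"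
proof -
  have "wsq R \<omega> (\<lambda>x. h (x + s *\<^sub>R axis i 1) - h x) = s\<^sup>2 * wsq R \<omega> (Av (s *\<^sub>R axis i 1) (pd i h))"
    using h by (subst Av_pd[symmetric]) (auto simp: sper_smooth wsq_cmult)
  also have "\<dots> \<le> s\<^sup>2 * (c * wsq R \<omega> (pd i h))"
    by (intro mult_left_mono wsq_Av sper_cper sper_pd h w) auto
  finally show ?thesis .
qed

text \<open>Cauchy-Schwarz on the N summands leaves the mean of their squares, and each translate
  costs a factor c.\<close>

lemma wsq_Lt:
  assumes h: "cper R h" and N: "N > 0" and w: "\<And>x p. p < N \<Longrightarrow> \<omega> x \<le> c * \<omega> (x + real p *\<^sub>R axis i 1)"
  shows "wsq R \<omega> (Lt N i h) \<le> c * wsq R \<omega> h"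
proof -
  have "wsq R \<omega> (Lt N i h) \<le> integral (cell R) (\<lambda>x. \<Sum>p<N. (1 / real N) * ((h (x + real p *\<^sub>R axis i 1))\<^sup>2 * \<omega> x))"
    unfolding wsq_def
  proof (rule integral_cell_mono)
    fix x
    have "(Lt N i h x)\<^sup>2 \<le> (\<Sum>p<N. (h (x + real p *\<^sub>R axis i 1))\<^sup>2) * real N / (real N)\<^sup>2"
      unfolding Lt_def power_divide
      using sum_squared_le_sum_of_squares[of "\<lambda>p. h (x + real p *\<^sub>R axis i 1)" "{..<N}"]
      by (intro divide_right_mono) auto
    also have "\<dots> = (\<Sum>p<N. (1 / real N) * (h (x + real p *\<^sub>R axis i 1))\<^sup>2)"
      using N by (simp add: power2_eq_square sum_divide_distrib)
    finally show "(Lt N i h x)\<^sup>2 * \<omega> x \<le> (\<Sum>p<N. (1 / real N) * ((h (x + real p *\<^sub>R axis i 1))\<^sup>2 * \<omega> x))"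
      using mult_right_mono[of _ _ "\<omega> x"] w_pos[of x] by (fastforce simp: sum_distrib_right)
  qed (intro wsq_integrand cper_Lt h continuous_on_sum continuous_on_mult_left cper_shift)+
  also have "\<dots> = (\<Sum>p<N. (1 / real N) * wsq R \<omega> (\<lambda>x. h (x + real p *\<^sub>R axis i 1)))"
    unfolding wsq_def integral_cell_cmult[symmetric]
    by (intro integral_cell_sum wsq_integrand h continuous_on_mult_left cper_shift) auto
  also have "\<dots> \<le> (\<Sum>p<N. (1 / real N) * (c * wsq R \<omega> h))"
    by (intro sum_mono mult_left_mono wsq_shift h w) auto
  finally show ?thesis using N by simp
qed

lemma wsq_Lts:
  assumes h: "cper R h" and N: "N > 0" and c: "c \<ge> 0"
    and w: "\<And>x p i. p < N \<Longrightarrow> \<omega> x \<le> c * \<omega> (x + real p *\<^sub>R axis i 1)"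
  shows "wsq R \<omega> (Lts N is h) \<le> c ^ length is * wsq R \<omega> h"
proof (induction "is")
  case (Cons i "is")
  have "wsq R \<omega> (Lts N (i # is) h) \<le> c * wsq R \<omega> (Lts N is h)"
    by (simp add: wsq_Lt[OF cper_Lts[OF h] N w])
  also have "\<dots> \<le> c * (c ^ length is * wsq R \<omega> h)" using Cons c by (rule mult_left_mono)
  finally show ?case by simp
qed simp

end

section \<open>Slowly varying weights and substitutes for the Poincare inequality\<close>

text \<open>The comparison is required for all displacements in the box, of either sign. It thus
  covers lattice shifts below N and unit shifts alike, and replacing z by -z gives the reverse
  comparison.\<close>

locale slow_weight = weight R \<omega> for R :: real and \<omega> :: "real^'n \<Rightarrow> real" +
  fixes c :: real and N :: nat
  assumes N_pos: "N > 0" and slow: "(\<And>i. \<bar>z $ i\<bar> \<le> real N) \<Longrightarrow> \<omega> x \<le> c * \<omega> (x + z)"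
begin

lemma c_ge1: "c \<ge> 1"
proof -
  have "\<omega> 0 \<le> c * \<omega> 0" using slow[of 0 0] by simp
  then show ?thesis using w_pos[of 0] by simp
qed

lemma slow_axis: "\<bar>t\<bar> \<le> real N \<Longrightarrow> \<omega> x \<le> c * \<omega> (x + t *\<^sub>R axis i 1)"
  by (rule slow) (auto simp: axis_def)

lemma wsq_shift': "cper R h \<Longrightarrow> (\<And>i. \<bar>z $ i\<bar> \<le> real N) \<Longrightarrow> wsq R \<omega> (\<lambda>x. h (x + z)) \<le> c * wsq R \<omega> h"
  by (rule wsq_shift) (auto intro: slow)

lemma wsq_Lts': "cper R h \<Longrightarrow> wsq R \<omega> (Lts N is h) \<le> c ^ length is * wsq R \<omega> h"
  using N_pos c_ge1 by (intro wsq_Lts slow_axis) auto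

lemma wsq_Avs: assumes h: "cper R h" shows "wsq R \<omega> (Avs is h) \<le> c ^ length is * wsq R \<omega> h"
proof (induction "is")
  case (Cons i "is")
  have "wsq R \<omega> (Avs (i # is) h) \<le> c * wsq R \<omega> (Avs is h)"
    using N_pos by (auto intro!: wsq_Av cper_Avs h slow_axis)
  also have "\<dots> \<le> c * (c ^ length is * wsq R \<omega> h)" using Cons c_ge1 by (intro mult_left_mono) auto
  finally show ?case by simp
qed simp

text \<open>The average in direction i telescopes to two end values divided by N, hence the 4 / N^2
  after squaring. The other averages commute with the difference, and every average costs one factor
  c.\<close>

lemma wsq_Dl_Lts:
  assumes h: "cper R h" and "i \<in> set is"
  shows "wsq R \<omega> (Dl i (Lts N is h)) \<le> 4 * c ^ length is / (real N)\<^sup>2 * wsq R \<omega> h"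
  using assms(2)
proof (induction "is")
  case (Cons k "is")
  show ?case
  proof (cases "k = i")
    case True
    let ?g = "Lts N is h"
    have g: "cper R ?g" by (rule cper_Lts[OF h])
    have "wsq R \<omega> (Dl i (Lts N (k # is) h)) = wsq R \<omega> (\<lambda>x. inverse (real N) * (?g (x + real N *\<^sub>R axis i 1) - ?g x))"
      using True by (simp add: Dl_Lt field_simps)
    also have "\<dots> = (inverse (real N))\<^sup>2 * wsq R \<omega> (\<lambda>x. ?g (x + real N *\<^sub>R axis i 1) - ?g x)"
      by (rule wsq_cmult)
    also have "\<dots> \<le> (inverse (real N))\<^sup>2 * (2 * (c * wsq R \<omega> ?g) + 2 * (c * wsq R \<omega> ?g))"
    proof (intro mult_left_mono order.trans[OF wsq_diff_le] add_mono)
      show "wsq R \<omega> (\<lambda>x. ?g (x + real N *\<^sub>R axis i 1)) \<le> c * wsq R \<omega> ?g"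
        using g by (intro wsq_shift slow_axis) auto
      show "wsq R \<omega> ?g \<le> c * wsq R \<omega> ?g"
        using mult_right_mono[OF c_ge1 wsq_nonneg[OF g]] by simp
    qed (auto intro: g cper_shift)
    also have "\<dots> = 4 * c / (real N)\<^sup>2 * wsq R \<omega> ?g" by (simp add: field_simps)
    also have "\<dots> \<le> 4 * c / (real N)\<^sup>2 * (c ^ length is * wsq R \<omega> h)"
      using c_ge1 by (intro mult_left_mono wsq_Lts' h) auto
    finally show ?thesis by simp
  next
    case False
    then have IH: "wsq R \<omega> (Dl i (Lts N is h)) \<le> 4 * c ^ length is / (real N)\<^sup>2 * wsq R \<omega> h" using Cons by auto
    have "wsq R \<omega> (Dl i (Lts N (k # is) h)) \<le> c * wsq R \<omega> (Dl i (Lts N is h))"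
      using N_pos by (auto simp: Lt_Dl[symmetric] intro!: wsq_Lt cper_Dl cper_Lts h slow_axis)
    also have "\<dots> \<le> c * (4 * c ^ length is / (real N)\<^sup>2 * wsq R \<omega> h)"
      using IH c_ge1 by (intro mult_left_mono) auto
    finally show ?thesis by (simp add: mult_ac)
  qed
qed simp

text \<open>The weighted Dirichlet energy of h, in terms of which the Poincare-type bounds are
  stated.\<close>

definition grad_wsq :: "(real^'n \<Rightarrow> real) \<Rightarrow> real" where "grad_wsq h = (\<Sum>i\<in>UNIV. wsq R \<omega> (pd i h))"

lemma wsq_pd_le_P: "sper R h \<Longrightarrow> wsq R \<omega> (pd i h) \<le> grad_wsq h"
  unfolding grad_wsq_def by (rule member_le_sum) (auto intro: wsq_nonneg sper_cper sper_pd)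

lemma grad_wsq_nonneg: "sper R h \<Longrightarrow> 0 \<le> grad_wsq h"
  unfolding grad_wsq_def by (auto intro!: sum_nonneg wsq_nonneg sper_cper sper_pd)

lemma wsq_unit_shift_axis:
  assumes h: "sper R h" and "\<bar>s\<bar> \<le> 1"
  shows "wsq R \<omega> (\<lambda>x. h (x + s *\<^sub>R axis i 1) - h x) \<le> c * grad_wsq h"
proof -
  have "wsq R \<omega> (\<lambda>x. h (x + s *\<^sub>R axis i 1) - h x) \<le> s\<^sup>2 * (c * wsq R \<omega> (pd i h))"
  proof (rule wsq_shift_axis_diff[OF h])
    fix x and t :: real assume "0 \<le> t" "t \<le> 1"
    then have "\<bar>t * s\<bar> \<le> 1 * 1" using assms(2) unfolding abs_mult by (intro mult_mono) auto
    then show "\<omega> x \<le> c * \<omega> (x + t *\<^sub>R s *\<^sub>R axis i 1)" using N_pos slow_axis[of "t * s" x i] by simp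
  qed
  also have "\<dots> \<le> 1 * (c * grad_wsq h)"
    using assms c_ge1 wsq_pd_le_P[OF h, of i]
    by (intro mult_mono) (auto simp: abs_square_le_1 wsq_nonneg sper_cper sper_pd)
  finally show ?thesis by simp
qed

text \<open>Plays the role of a Poincare inequality on unit cubes. One more average splits the
  deviation into the average of the previous deviation and a one-dimensional deviation;
  \<open>2 * c + 2 * c\<close> explains the factor \<open>4 * c\<close> per coordinate.\<close>

lemma wsq_Avs_diff:
  assumes h: "sper R h"
  shows "wsq R \<omega> (\<lambda>x. Avs is h x - h x) \<le> (4 * c) ^ length is * grad_wsq h"
proof (induction "is")
  case Nil
  then show ?case using grad_wsq_nonneg[OF h] by (simp add: wsq_def)
next
  case (Cons i "is")
  let ?g = "Avs is h"
  have g: "cper R ?g" by (intro cper_Avs sper_cper h)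
  have c: "0 \<le> c" "1 \<le> 4 * c" using c_ge1 by auto
  have "wsq R \<omega> (\<lambda>x. Avs (i # is) h x - h x) =
     wsq R \<omega> (\<lambda>x. Av (axis i 1) (\<lambda>x. ?g x - h x) x + (Av (axis i 1) h x - h x))"
    by (simp add: Av_diff[OF g sper_cper[OF h]])
  also have "\<dots> \<le> 2 * (c * wsq R \<omega> (\<lambda>x. ?g x - h x)) + 2 * (c * grad_wsq h)"
  proof (intro order.trans[OF wsq_add_le] add_mono mult_left_mono)
    show "wsq R \<omega> (Av (axis i 1) (\<lambda>x. ?g x - h x)) \<le> c * wsq R \<omega> (\<lambda>x. ?g x - h x)"
      using N_pos by (auto intro!: wsq_Av cper_diff g sper_cper[OF h] slow_axis)
    show "wsq R \<omega> (\<lambda>x. Av (axis i 1) h x - h x) \<le> c * grad_wsq h"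
      by (intro wsq_Av_diff sper_cper[OF h] wsq_unit_shift_axis[OF h]) auto
  qed (auto intro!: cper_Av cper_diff g sper_cper[OF h])
  also have "\<dots> \<le> 2 * (c * ((4 * c) ^ length is * grad_wsq h)) + 2 * (c * ((4 * c) ^ length is * grad_wsq h))"
  proof -
    have "1 * grad_wsq h \<le> (4 * c) ^ length is * grad_wsq h" using grad_wsq_nonneg[OF h] by (intro mult_right_mono one_le_power c)
    then show ?thesis using c Cons by (intro add_mono mult_left_mono) auto
  qed
  finally show ?case by (simp add: algebra_simps)
qed

lemma wsq_unit_shift_diff:
  assumes h: "sper R h" and z: "\<And>i. \<bar>z $ i\<bar> \<le> 1"
  shows "wsq R \<omega> (\<lambda>x. h (x + z) - h x) \<le> (4 * c) ^ CARD('n) * grad_wsq h"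
proof -
  have c: "0 \<le> c" "1 \<le> 4 * c" using c_ge1 by auto
  \<comment> \<open>The displacement z is built up one coordinate at a time, each coordinate costing
    \<open>4 * c\<close> as for the averages.\<close>
  let ?s = "\<lambda>S. \<Sum>i\<in>S. (z $ i) *\<^sub>R (axis i 1 :: real^'n)"
  have "wsq R \<omega> (\<lambda>x. h (x + ?s S) - h x) \<le> (4 * c) ^ card S * grad_wsq h" if "finite S" for S
    using that
  proof (induction S rule: finite_induct)
    case empty
    then show ?case using grad_wsq_nonneg[OF h] by (simp add: wsq_def)
  next
    case (insert i S)
    have "h (x + ?s (insert i S)) - h x =
        (h (x + (z $ i) *\<^sub>R axis i 1 + ?s S) - h (x + (z $ i) *\<^sub>R axis i 1)) + (h (x + (z $ i) *\<^sub>R axis i 1) - h x)" for x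
      using insert by (simp add: algebra_simps)
    then have "wsq R \<omega> (\<lambda>x. h (x + ?s (insert i S)) - h x) =
      wsq R \<omega> (\<lambda>x. (h (x + (z $ i) *\<^sub>R axis i 1 + ?s S) - h (x + (z $ i) *\<^sub>R axis i 1)) + (h (x + (z $ i) *\<^sub>R axis i 1) - h x))"
      by presburger
    also have "\<dots> \<le> 2 * (c * wsq R \<omega> (\<lambda>x. h (x + ?s S) - h x)) + 2 * (c * grad_wsq h)"
    proof (intro order.trans[OF wsq_add_le] add_mono mult_left_mono)
      show "wsq R \<omega> (\<lambda>x. h (x + (z $ i) *\<^sub>R axis i 1 + ?s S) - h (x + (z $ i) *\<^sub>R axis i 1)) \<le> c * wsq R \<omega> (\<lambda>x. h (x + ?s S) - h x)"
        using N_pos z[of i] by (intro wsq_shift[of "\<lambda>x. h (x + ?s S) - h x"] slow_axis cper_diff cper_shift sper_cper[OF h]) auto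
      show "wsq R \<omega> (\<lambda>x. h (x + (z $ i) *\<^sub>R axis i 1) - h x) \<le> c * grad_wsq h"
        by (intro wsq_unit_shift_axis[OF h z])
    qed (auto intro!: cper_diff sper_cper[OF h] cper_shift cper_shift[OF cper_shift])
    also have "\<dots> \<le> 2 * (c * ((4 * c) ^ card S * grad_wsq h)) + 2 * (c * ((4 * c) ^ card S * grad_wsq h))"
    proof -
      have "1 * grad_wsq h \<le> (4 * c) ^ card S * grad_wsq h" using grad_wsq_nonneg[OF h] by (intro mult_right_mono one_le_power c)
      then show ?thesis using c insert by (intro add_mono mult_left_mono) auto
    qed
    finally show ?case using insert by (simp add: algebra_simps)
  qed
  from this[of UNIV] show ?thesis by (simp add: vec_axis_sum[symmetric])
qed

end

section \<open>Effective diffusivity as a quadratic form\<close>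

lemma quadratic_nonneg_discriminant:
  fixes k b c :: real
  assumes q: "\<And>t. 0 \<le> k + 2 * t * b + t\<^sup>2 * c" and "c \<ge> 0"
  shows "b\<^sup>2 \<le> k * c"
proof (cases "c = 0")
  case True
  have "b = 0"
  proof (rule ccontr)
    assume "b \<noteq> 0"
    \<comment> \<open>This value of t makes the remaining linear expression equal to -1.\<close>
    then show False using q[of "- (k + 1) / (2 * b)"] True by (simp add: field_simps)
  qed
  then show ?thesis using True by simp
next
  case False
  then have c: "c > 0" using assms by simp
  have "0 \<le> k + 2 * (- b / c) * b + (- b / c)\<^sup>2 * c" by (rule q)
  also have "\<dots> = k - b\<^sup>2 / c" using c by (simp add: power2_eq_square field_simps)
  finally show ?thesis using c by (simp add: field_simps)
qed

text \<open>The form vanishes at v and is nonnegative on the line v + t B v. The discriminant bound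
  with constant term 0 then kills the linear coefficient, which is the squared norm of B v.\<close>

lemma psd_null_vector:
  fixes B :: "real^'n^'n"
  assumes sym: "transpose B = B" and psd: "\<And>x. 0 \<le> x \<bullet> (B *v x)" and z: "v \<bullet> (B *v v) = 0"
  shows "B *v v = 0"
proof -
  let ?w = "B *v v"
  have vBw: "v \<bullet> (B *v ?w) = ?w \<bullet> ?w"
    by (metis dot_lmul_matrix sym transpose_matrix_vector)
  have "0 \<le> 0 + 2 * t * (?w \<bullet> ?w) + t\<^sup>2 * (?w \<bullet> (B *v ?w))" for t
    using psd[of "v + t *\<^sub>R ?w"] z vBw
    by (simp add: matrix_vector_right_distrib inner_add_left inner_add_right matrix_vector_mult_scaleR
      power2_eq_square algebra_simps)
  from quadratic_nonneg_discriminant[OF this psd] show ?thesis by simp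
qed

lemma matrix_vector_uminus: "(- A) *v x = - (A *v x)" for A :: "real^'n^'m"
  by (simp add: matrix_vector_mult_def vec_eq_iff sum_negf)

text \<open>\<open>lam_min\<close> is an infimum over eigenvalues, so an eigenvector realising the
  minimum of the Rayleigh quotient must be produced. It is a minimiser on the unit sphere:
  subtracting m times the identity leaves a nonnegative form that vanishes there.\<close>

lemma min_eigenvalue:
  fixes A :: "real^'n^'n"
  assumes sym: "transpose A = A"
  obtains m v where "v \<noteq> 0" "A *v v = m *\<^sub>R v" "\<And>x. m * (x \<bullet> x) \<le> x \<bullet> (A *v x)"
proof -
  have "continuous_on (sphere 0 1) (\<lambda>x :: real^'n. x \<bullet> (A *v x))"
    by (intro continuous_intros linear_continuous_on matrix_vector_mul_linear matrix_vector_mul_bounded_linear)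
  moreover have "sphere (0::real^'n) 1 \<noteq> {}" by simp
  ultimately obtain v where v: "norm v = 1" "\<And>x. norm x = 1 \<Longrightarrow> v \<bullet> (A *v v) \<le> x \<bullet> (A *v x)"
    using continuous_attains_inf[OF compact_sphere, of 0 1 "\<lambda>x :: real^'n. x \<bullet> (A *v x)"] by auto
  define m where "m = v \<bullet> (A *v v)"
  have low: "m * (x \<bullet> x) \<le> x \<bullet> (A *v x)" for x
  proof (cases "x = 0")
    case False
    define u where "u = (1 / norm x) *\<^sub>R x"
    have "norm u = 1" using False by (simp add: u_def)
    then have "m \<le> u \<bullet> (A *v u)" using v(2) by (simp add: m_def)
    also have "\<dots> = (x \<bullet> (A *v x)) / (x \<bullet> x)"
      by (simp add: u_def matrix_vector_mult_scaleR power2_norm_eq_inner[symmetric] power2_eq_square)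
    finally show ?thesis using False by (simp add: field_simps)
  qed simp
  define B where "B = A - m *\<^sub>R mat 1"
  have Bx: "B *v x = A *v x - m *\<^sub>R x" for x
    by (simp add: B_def matrix_vector_mult_diff_rdistrib scaleR_matrix_vector_assoc[symmetric])
  have "transpose B = B" using sym
    by (simp add: B_def transpose_def mat_def vec_eq_iff)
  moreover have "v \<bullet> v = 1" using v(1) by (simp add: power2_norm_eq_inner[symmetric])
  ultimately have "B *v v = 0"
    by (intro psd_null_vector) (auto simp: Bx inner_diff_right low m_def[symmetric])
  moreover have "v \<noteq> 0" using v(1) by auto
  ultimately show ?thesis using that[of v m] low by (simp add: Bx)
qed

lemma eigenvalue_rayleigh:
  assumes "c \<in> eigenvalues A" obtains v where "v \<bullet> v > 0" "v \<bullet> (A *v v) = c * (v \<bullet> v)"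
  using assms unfolding eigenvalues_def by (auto simp: inner_commute)

lemma lam_min_rayleigh:
  fixes A :: "real^'n^'n"
  assumes sym: "transpose A = A"
  shows "lam_min A * (x \<bullet> x) \<le> x \<bullet> (A *v x)"
proof -
  obtain m v where v: "v \<noteq> 0" "A *v v = m *\<^sub>R v" and m: "\<And>x. m * (x \<bullet> x) \<le> x \<bullet> (A *v x)"
    using min_eigenvalue[OF sym] by blast
  have "lam_min A = m" unfolding lam_min_def
  proof (rule cInf_eq_minimum)
    show "m \<in> eigenvalues A" using v by (auto simp: eigenvalues_def)
    fix c assume "c \<in> eigenvalues A"
    then obtain u where "u \<bullet> u > 0" "u \<bullet> (A *v u) = c * (u \<bullet> u)" by (rule eigenvalue_rayleigh)
    with m[of u] show "m \<le> c" by simp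
  qed
  with m show ?thesis by simp
qed

lemma lam_min_nonneg:
  fixes A :: "real^'n^'n"
  assumes sym: "transpose A = A" and psd: "\<And>x. 0 \<le> x \<bullet> (A *v x)"
  shows "0 \<le> lam_min A"
  unfolding lam_min_def
proof (rule cInf_greatest)
  obtain m v where v: "v \<noteq> 0" "A *v v = m *\<^sub>R v" using min_eigenvalue[OF sym] by blast
  then show "eigenvalues A \<noteq> {}" by (auto simp: eigenvalues_def)
  fix c assume "c \<in> eigenvalues A"
  then obtain u where "u \<bullet> u > 0" "u \<bullet> (A *v u) = c * (u \<bullet> u)" by (rule eigenvalue_rayleigh)
  with psd[of u] show "0 \<le> c" by (simp add: zero_le_mult_iff)
qed

lemma lam_max_rayleigh:
  fixes A :: "real^'n^'n"
  assumes sym: "transpose A = A"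
  shows "x \<bullet> (A *v x) \<le> lam_max A * (x \<bullet> x)"
proof -
  have "transpose (- A) = - A" using sym by (simp add: transpose_def vec_eq_iff)
  then obtain m v where v: "v \<noteq> 0" "(- A) *v v = m *\<^sub>R v" and m: "\<And>x. m * (x \<bullet> x) \<le> x \<bullet> ((- A) *v x)"
    using min_eigenvalue by blast
  have v': "A *v v = (- m) *\<^sub>R v" using v(2) unfolding matrix_vector_uminus
    by (metis add.inverse_inverse scaleR_minus_left)
  have m': "x \<bullet> (A *v x) \<le> (- m) * (x \<bullet> x)" for x using m[of x] by (simp add: matrix_vector_uminus)
  have "lam_max A = - m" unfolding lam_max_def
  proof (rule cSup_eq_maximum)
    show "- m \<in> eigenvalues A" using v v' unfolding eigenvalues_def by blast
    fix c assume "c \<in> eigenvalues A"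
    then obtain u where "u \<bullet> u > 0" "u \<bullet> (A *v u) = c * (u \<bullet> u)" by (rule eigenvalue_rayleigh)
    with m'[of u] show "c \<le> - m" by (metis mult_le_cancel_right_pos)
  qed
  with m'[of x] show ?thesis by simp
qed

text \<open>The numerator of the variational quotient, without the normalising mass, so that
  energies under different weights can be compared directly.\<close>

definition energy :: "real \<Rightarrow> (real^'n \<Rightarrow> real) \<Rightarrow> real^'n \<Rightarrow> (real^'n \<Rightarrow> real) \<Rightarrow> real" where
  "energy R \<omega> l f = integral (cell R) (\<lambda>x. (norm (l - grad f x))\<^sup>2 * \<omega> x)"

lemma norm_sq_sum: "(norm x)\<^sup>2 = (\<Sum>i\<in>UNIV. (x $ i)\<^sup>2)" for x :: "real^'n"
  unfolding power2_norm_eq_inner inner_vec_def by (simp add: power2_eq_square)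

lemma continuous_on_grad: "smooth_fun f \<Longrightarrow> continuous_on A (grad f)"
  unfolding grad_def pd_def[symmetric]
  by (intro continuous_on_vec_lambda smooth_fun_continuous_on smooth_fun_pd)

lemma (in weight) energy_sum:
  assumes "sper R f"
  shows "energy R \<omega> l f = (\<Sum>i\<in>UNIV. wsq R \<omega> (\<lambda>x. l $ i - pd i f x))"
proof -
  have "energy R \<omega> l f = integral (cell R) (\<lambda>x. \<Sum>i\<in>UNIV. (l $ i - pd i f x)\<^sup>2 * \<omega> x)"
    by (simp add: energy_def norm_sq_sum sum_distrib_right)
  also have "\<dots> = (\<Sum>i\<in>UNIV. wsq R \<omega> (\<lambda>x. l $ i - pd i f x))" unfolding wsq_def
    by (rule integral_cell_sum) (auto intro!: wsq_integrand sper_cper sper_diff sper_const sper_pd assms)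
  finally show ?thesis .
qed

lemma (in weight) energy_nonneg: "sper R f \<Longrightarrow> 0 \<le> energy R \<omega> l f"
  unfolding energy_sum by (intro sum_nonneg wsq_nonneg sper_cper sper_diff sper_const sper_pd)

lemma integral_cell_const: "integral (cell R) (\<lambda>x::real^'n. a::real) = R ^ CARD('n) * a" if "R > 0"
proof -
  have "measure lborel (cbox (0::real^'n) (R *\<^sub>R One)) = R ^ CARD('n)"
    using that by (subst content_cbox) (auto simp: inner_sum_left_Basis)
  then show ?thesis unfolding cell_def by simp
qed

lemma (in weight) integral_w_pos: "0 < integral (cell R) \<omega>"
proof -
  have "compact (cell R :: (real^'n) set)" "(cell R :: (real^'n) set) \<noteq> {}"
    using R_pos by (auto simp: cell_def box_ne_empty inner_sum_left_Basis)
  then obtain x0 where "\<And>x. x \<in> cell R \<Longrightarrow> \<omega> x0 \<le> \<omega> x"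
    using continuous_attains_inf[OF _ _ w_cont] by blast
  then have "integral (cell R) (\<lambda>x::real^'n. \<omega> x0) \<le> integral (cell R) \<omega>"
    by (intro integral_cell_mono w_cont continuous_on_const)
  moreover have "0 < R ^ CARD('n) * \<omega> x0" using R_pos w_pos[of x0] by simp
  moreover have "integral (cell R) (\<lambda>x::real^'n. \<omega> x0) = R ^ CARD('n) * \<omega> x0"
    by (rule integral_cell_const[OF R_pos])
  ultimately show ?thesis by linarith
qed

definition ew :: "(real^'n \<Rightarrow> real) \<Rightarrow> real^'n \<Rightarrow> real" where
  "ew U x = exp (-2 * U x)"

locale potential = 
  fixes R :: real and U :: "real^'n \<Rightarrow> real"
  assumes R_pos': "R > 0" and U_cper: "cper R U"

sublocale potential \<subseteq> weight R "ew U"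
proof
  show "cper R (ew U)" unfolding ew_def by (intro cper_exp cper_cmult U_cper)
qed (auto simp: ew_def R_pos')

context potential
begin

abbreviation "w \<equiv> ew U"
abbreviation "Z \<equiv> integral (cell R) w"
abbreviation "q \<equiv> eff_quad R U"

lemma Z_pos: "Z > 0" by (rule integral_w_pos)

lemma q_alt: "q l = Inf ((\<lambda>f. energy R w l f / Z) ` {f. sper R f})"
  unfolding eff_quad_def energy_def sper_def ew_def[symmetric] by (rule arg_cong[where f=Inf]) auto

lemma q_bdd: "bdd_below ((\<lambda>f. energy R w l f / Z) ` {f. sper R f})"
  using Z_pos by (auto intro!: bdd_belowI[of _ 0] divide_nonneg_pos energy_nonneg)

lemma q_le: "sper R f \<Longrightarrow> q l * Z \<le> energy R w l f"
  using cInf_lower[OF _ q_bdd, of "energy R w l f / Z" l] Z_pos unfolding q_alt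
  by (auto simp: pos_le_divide_eq)

lemma le_q: assumes "\<And>f. sper R f \<Longrightarrow> a \<le> energy R w l f" shows "a \<le> q l * Z"
proof -
  have "a / Z \<le> q l" unfolding q_alt using assms Z_pos
    by (intro cInf_greatest) (auto intro!: divide_right_mono exI[of _ "\<lambda>x. 0"])
  then show ?thesis using Z_pos by (simp add: pos_divide_le_eq)
qed

lemma q_approx: assumes "\<kappa> > 0" obtains f where "sper R f" "energy R w l f \<le> Z * (q l + \<kappa>)"
proof -
  have "\<exists>f. sper R f \<and> energy R w l f < Z * (q l + \<kappa>)"
  proof (rule ccontr)
    assume "\<not> ?thesis"
    then have "Z * (q l + \<kappa>) \<le> q l * Z" by (intro le_q) auto
    then show False using mult_pos_pos[OF assms Z_pos] by (simp add: algebra_simps)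
  qed
  then show ?thesis using that by (auto intro: less_imp_le)
qed

lemma q_nonneg: "0 \<le> q l"
  using le_q[of 0 l] energy_nonneg Z_pos by (auto simp: zero_le_mult_iff)

lemma q_le_norm: "q l \<le> (norm l)\<^sup>2"
proof -
  have "grad (\<lambda>x. 0) = (\<lambda>x::real^'n. 0)" by (simp add: fun_eq_iff vec_eq_iff)
  then have "energy R w l (\<lambda>x. 0) = (norm l)\<^sup>2 * Z" by (simp add: energy_def)
  then show ?thesis using q_le[of "\<lambda>x. 0" l] Z_pos by simp
qed

end

section \<open>Near-minimisers that are linear in the direction, and polarization\<close>

context weight
begin

text \<open>The weighted L2 inner product of vector fields, whose diagonal is the energy.\<close>

definition B :: "(real^'n \<Rightarrow> real^'n) \<Rightarrow> (real^'n \<Rightarrow> real^'n) \<Rightarrow> real" where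
  "B F G = integral (cell R) (\<lambda>x. (F x \<bullet> G x) * \<omega> x)"

lemma B_integrand: "continuous_on UNIV F \<Longrightarrow> continuous_on UNIV G \<Longrightarrow> continuous_on A (\<lambda>x. (F x \<bullet> G x) * \<omega> x)"
  using continuous_on_subset by (intro continuous_on_mult continuous_on_inner w_cont) blast+

lemma B_sym: "B F G = B G F" by (simp add: B_def inner_commute)

lemma B_nonneg: "continuous_on UNIV F \<Longrightarrow> 0 \<le> B F F"
  unfolding B_def by (intro integral_nonneg integrable_cell B_integrand) (auto simp: w_pos less_imp_le)

lemma energy_eq_B: "energy R \<omega> l f = B (\<lambda>x. l - grad f x) (\<lambda>x. l - grad f x)"
  by (simp add: energy_def B_def power2_norm_eq_inner)

lemma B_lin_comb:
  assumes "continuous_on UNIV F" "continuous_on UNIV G" "continuous_on UNIV H"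
  shows "B (\<lambda>x. F x + t *\<^sub>R G x) H = B F H + t * B G H"
proof -
  have "B (\<lambda>x. F x + t *\<^sub>R G x) H = integral (cell R) (\<lambda>x. (F x \<bullet> H x) * \<omega> x + t * ((G x \<bullet> H x) * \<omega> x))"
    unfolding B_def by (simp add: inner_add_left algebra_simps)
  then show ?thesis
    unfolding B_def by (simp add: integral_cell_add[OF B_integrand continuous_on_mult_left[OF B_integrand]] assms)
qed

lemma B_sum:
  assumes "finite S" "\<And>i. i \<in> S \<Longrightarrow> continuous_on UNIV (F i)" "continuous_on UNIV H"
  shows "B (\<lambda>x. \<Sum>i\<in>S. a i *\<^sub>R F i x) H = (\<Sum>i\<in>S. a i * B (F i) H)"
  using assms(1,2)
proof (induction S rule: finite_induct)
  case (insert i S)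
  have "B (\<lambda>x. (\<Sum>i\<in>S. a i *\<^sub>R F i x) + a i *\<^sub>R F i x) H = B (\<lambda>x. \<Sum>i\<in>S. a i *\<^sub>R F i x) H + a i * B (F i) H"
    using insert assms(3) by (intro B_lin_comb continuous_on_sum continuous_on_scaleR continuous_on_const) auto
  then show ?case using insert by (simp add: add.commute)
qed (simp add: B_def)

lemma B_diff_sq:
  assumes "continuous_on UNIV F" "continuous_on UNIV G"
  shows "B (\<lambda>x. F x - t *\<^sub>R G x) (\<lambda>x. F x - t *\<^sub>R G x) = B F F + 2 * (-t) * B F G + (-t)\<^sup>2 * B G G"
proof -
  let ?K = "\<lambda>x. F x + (-t) *\<^sub>R G x"
  have K: "continuous_on UNIV ?K" by (intro continuous_on_add continuous_on_scaleR continuous_on_const assms)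
  have "B ?K ?K = B F ?K + (-t) * B G ?K" by (rule B_lin_comb[OF assms K])
  also have "B F ?K = B F F + (-t) * B G F" using B_lin_comb[OF assms assms(1), of "-t"] by (simp only: B_sym[of F ?K])
  also have "B G ?K = B F G + (-t) * B G G" using B_lin_comb[OF assms assms(2), of "-t"] by (simp only: B_sym[of G ?K])
  finally show ?thesis using B_sym[of G F] by (simp add: algebra_simps power2_eq_square)
qed

end

lemma sum_abs_sq_le: "(\<Sum>i\<in>UNIV. \<bar>x $ i\<bar>)\<^sup>2 \<le> real CARD('n) * (norm x)\<^sup>2" for x :: "real^'n"
  using sum_squared_le_sum_of_squares[of "\<lambda>i. \<bar>x $ i\<bar>" UNIV] by (simp add: norm_sq_sum mult.commute)

lemma double_sum_bound:
  fixes E :: "'n::finite \<Rightarrow> 'n \<Rightarrow> real" and x :: "real^'n"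
  assumes "\<And>i j. \<bar>E i j\<bar> \<le> e"
  shows "\<bar>\<Sum>i\<in>UNIV. \<Sum>j\<in>UNIV. x $ i * x $ j * E i j\<bar> \<le> e * (real CARD('n) * (norm x)\<^sup>2)"
proof -
  have e: "e \<ge> 0" using assms[of undefined undefined] by linarith
  have "\<bar>\<Sum>i\<in>UNIV. \<Sum>j\<in>UNIV. x $ i * x $ j * E i j\<bar> \<le> (\<Sum>i\<in>UNIV. \<Sum>j\<in>UNIV. \<bar>x $ i * x $ j * E i j\<bar>)"
    by (intro order.trans[OF sum_abs] sum_mono sum_abs)
  also have "\<dots> \<le> (\<Sum>i\<in>UNIV. \<Sum>j\<in>UNIV. \<bar>x $ i\<bar> * \<bar>x $ j\<bar> * e)"
    unfolding abs_mult by (intro sum_mono mult_left_mono assms) auto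
  also have "\<dots> = e * (\<Sum>i\<in>UNIV. \<bar>x $ i\<bar>)\<^sup>2"
    by (simp add: power2_eq_square sum_product sum_distrib_left mult_ac)
  also have "\<dots> \<le> e * (real CARD('n) * (norm x)\<^sup>2)"
    by (intro mult_left_mono e sum_abs_sq_le)
  finally show ?thesis .
qed

lemma sum_axis_mult: "(\<Sum>i\<in>UNIV. axis k 1 $ i * f i) = f k" for f :: "'n::finite \<Rightarrow> real"
proof -
  have "(\<Sum>i\<in>UNIV. axis k 1 $ i * f i) = (\<Sum>i\<in>UNIV. if i = k then f i else 0)"
    by (intro sum.cong) (auto simp: axis_def)
  then show ?thesis by simp
qed

definition qf :: "('n \<Rightarrow> 'n \<Rightarrow> real) \<Rightarrow> real^'n \<Rightarrow> real" where
  "qf M x = (\<Sum>i\<in>UNIV. \<Sum>j\<in>UNIV. x $ i * x $ j * M i j)"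

lemma grad_sum: "finite S \<Longrightarrow> (\<And>i. i \<in> S \<Longrightarrow> smooth_fun (f i)) \<Longrightarrow>
  grad (\<lambda>x. \<Sum>i\<in>S. a i * f i x) = (\<lambda>x. \<Sum>i\<in>S. a i *\<^sub>R grad (f i) x)"
  by (simp add: fun_eq_iff vec_eq_iff pd_sum pd_cmult smooth_fun_cmult)

lemma grad_diff: "smooth_fun f \<Longrightarrow> smooth_fun g \<Longrightarrow> grad (\<lambda>x. f x - g x) = (\<lambda>x. grad f x - grad g x)"
  by (simp add: fun_eq_iff vec_eq_iff pd_diff)

lemma grad_cmult: "smooth_fun f \<Longrightarrow> grad (\<lambda>x. t * f x) = (\<lambda>x. t *\<^sub>R grad f x)"
  by (simp add: fun_eq_iff vec_eq_iff pd_cmult)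

lemma grad_add: "smooth_fun f \<Longrightarrow> smooth_fun g \<Longrightarrow> grad (\<lambda>x. f x + g x) = (\<lambda>x. grad f x + grad g x)"
  by (simp add: fun_eq_iff vec_eq_iff pd_add)

context potential
begin

text \<open>An approximate Euler-Lagrange equation. Perturbing h by a multiple of \<phi> cannot
  bring the energy below \<open>q l * Z\<close>, so the excess \<open>Z * \<kappa>\<close> bounds
  the linear coefficient through the discriminant.\<close>

lemma near_orthogonal:
  assumes h: "sper R h" "energy R w l h \<le> Z * (q l + \<kappa>)" and \<phi>: "sper R \<phi>"
  shows "(B (\<lambda>x. l - grad h x) (grad \<phi>))\<^sup>2 \<le> (Z * \<kappa>) * B (grad \<phi>) (grad \<phi>)"
proof -
  note cont = continuous_on_grad[OF sper_smooth[OF h(1)], of UNIV] continuous_on_grad[OF sper_smooth[OF \<phi>], of UNIV]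
  let ?A = "\<lambda>x. l - grad h x"
  have A: "continuous_on UNIV ?A" by (intro continuous_on_diff continuous_on_const cont)
  have "0 \<le> Z * \<kappa> + 2 * t * B ?A (grad \<phi>) + t\<^sup>2 * B (grad \<phi>) (grad \<phi>)" for t
  proof -
    have "q l * Z \<le> energy R w l (\<lambda>x. h x + (-t) * \<phi> x)"
      by (intro q_le sper_add sper_cmult h \<phi>)
    also have "\<dots> = B (\<lambda>x. ?A x - (-t) *\<^sub>R grad \<phi> x) (\<lambda>x. ?A x - (-t) *\<^sub>R grad \<phi> x)"
      unfolding energy_eq_B grad_add[OF sper_smooth[OF h(1)] smooth_fun_cmult[OF sper_smooth[OF \<phi>]]] grad_cmult[OF sper_smooth[OF \<phi>]]
      by (simp only: diff_diff_eq)
    also have "\<dots> = energy R w l h + 2 * t * B ?A (grad \<phi>) + t\<^sup>2 * B (grad \<phi>) (grad \<phi>)"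
      unfolding B_diff_sq[OF A cont(2)] by (simp add: energy_eq_B)
    finally show ?thesis using h(2) by (simp add: algebra_simps)
  qed
  then show ?thesis by (intro quadratic_nonneg_discriminant B_nonneg cont)
qed

text \<open>Near-minimisers are chosen for the axis vectors only and extended linearly, which makes
  their energy a quadratic form in \<xi>; near-orthogonality passes to linear combinations and gives
  near-minimality in every direction at once. Linearity in \<xi> is essential, both for identifying
  \<open>q\<close> as a quadratic form and for inserting a direction that varies with x.\<close>

lemma near_minimizers:
  assumes \<kappa>: "\<kappa> > 0"
  shows "\<exists>(h :: 'n \<Rightarrow> real^'n \<Rightarrow> real) M. (\<forall>i. sper R (h i)) \<and> (\<forall>i j. M i j = M j i) \<and>
    (\<forall>\<xi>. energy R w \<xi> (\<lambda>x. \<Sum>i\<in>UNIV. \<xi> $ i * h i x) = Z * qf M \<xi>) \<and>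
    (\<forall>\<xi>. qf M \<xi> - \<kappa> * (real CARD('n) * (norm \<xi>)\<^sup>2) \<le> q \<xi>) \<and>
    (\<forall>\<xi>. q \<xi> \<le> qf M \<xi>)"
proof -
  have "\<exists>h :: 'n \<Rightarrow> real^'n \<Rightarrow> real. \<forall>i. sper R (h i) \<and> energy R w (axis i 1) (h i) \<le> Z * (q (axis i 1) + \<kappa>)"
    by (intro choice allI) (metis q_approx[OF \<kappa>])
  then obtain h :: "'n \<Rightarrow> real^'n \<Rightarrow> real" where h: "\<And>i. sper R (h i)" "\<And>i. energy R w (axis i 1) (h i) \<le> Z * (q (axis i 1) + \<kappa>)" by blast
  define A where "A = (\<lambda>i x. axis i 1 - grad (h i) x)"
  define M where "M = (\<lambda>i j. B (A i) (A j) / Z)"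
  define hs where "hs = (\<lambda>(\<xi>::real^'n) x. \<Sum>i\<in>UNIV. \<xi> $ i * h i x)"
  have Ac: "continuous_on UNIV (A i)" for i unfolding A_def
    by (intro continuous_on_diff continuous_on_const continuous_on_grad sper_smooth[OF h(1)])
  have s: "sper R (hs \<xi>)" for \<xi> unfolding hs_def by (intro sper_sum sper_cmult h)
  have A\<xi>: "\<xi> - grad (hs \<xi>) x = (\<Sum>i\<in>UNIV. \<xi> $ i *\<^sub>R A i x)" for \<xi> x
    unfolding hs_def A_def using vec_axis_sum[of \<xi>]
    by (simp add: grad_sum sper_smooth[OF h(1)] scaleR_right_diff_distrib sum_subtractf)
  have Jq: "energy R w \<xi> (hs \<xi>) = Z * qf M \<xi>" for \<xi>
  proof -
    have c: "continuous_on UNIV (\<lambda>x. \<Sum>i\<in>UNIV. \<xi> $ i *\<^sub>R A i x)"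
      by (intro continuous_on_sum continuous_on_scaleR continuous_on_const Ac)
    have "energy R w \<xi> (hs \<xi>) = (\<Sum>i\<in>UNIV. \<xi> $ i * B (A i) (\<lambda>x. \<Sum>i\<in>UNIV. \<xi> $ i *\<^sub>R A i x))"
      unfolding energy_eq_B A\<xi> by (rule B_sum) (auto intro: Ac c)
    also have "\<dots> = (\<Sum>i\<in>UNIV. \<xi> $ i * (\<Sum>j\<in>UNIV. \<xi> $ j * B (A j) (A i)))"
    proof (intro sum.cong refl arg_cong2[where f="(*)"])
      fix i
      show "B (A i) (\<lambda>x. \<Sum>i\<in>UNIV. \<xi> $ i *\<^sub>R A i x) = (\<Sum>j\<in>UNIV. \<xi> $ j * B (A j) (A i))"
        unfolding B_sym[of "A i" "\<lambda>x. \<Sum>i\<in>UNIV. \<xi> $ i *\<^sub>R A i x"] by (rule B_sum) (auto intro: Ac)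
    qed
    also have "\<dots> = (\<Sum>i\<in>UNIV. \<xi> $ i * (\<Sum>j\<in>UNIV. \<xi> $ j * B (A i) (A j)))"
      by (simp only: B_sym[of "A j" "A i" for i j])
    finally have "energy R w \<xi> (hs \<xi>) = \<dots>" .
    then show ?thesis using Z_pos by (simp add: M_def qf_def sum_distrib_left mult_ac)
  qed
  show ?thesis
  proof (intro exI[of _ h] exI[of _ M] conjI allI)
    fix \<xi>
    show "energy R w \<xi> (\<lambda>x. \<Sum>i\<in>UNIV. \<xi> $ i * h i x) = Z * qf M \<xi>"
      using Jq by (simp add: hs_def)
    show "q \<xi> \<le> qf M \<xi>"
      using q_le[OF s, of \<xi> \<xi>] Jq[of \<xi>] Z_pos by (simp add: mult.commute)
    have "Z * (qf M \<xi> - \<kappa> * (real CARD('n) * (norm \<xi>)\<^sup>2)) \<le> q \<xi> * Z"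
    proof (rule le_q)
      fix \<phi> :: "real^'n \<Rightarrow> real" assume \<phi>: "sper R \<phi>"
      define \<psi> where "\<psi> = (\<lambda>x. \<phi> x - hs \<xi> x)"
      have \<psi>: "sper R \<psi>" unfolding \<psi>_def by (intro sper_diff \<phi> s)
      let ?F = "\<lambda>x. \<xi> - grad (hs \<xi>) x" and ?G = "grad \<psi>"
      have Gc: "continuous_on UNIV ?G" by (intro continuous_on_grad sper_smooth[OF \<psi>])
      have Fc: "continuous_on UNIV ?F" by (intro continuous_on_diff continuous_on_const continuous_on_grad sper_smooth[OF s])
      define g where "g = B ?G ?G"
      have g0: "g \<ge> 0" unfolding g_def by (rule B_nonneg[OF Gc])
      define S where "S = (\<Sum>i\<in>UNIV. \<bar>\<xi> $ i\<bar>)"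
      have S0: "S \<ge> 0" unfolding S_def by (simp add: sum_nonneg)
      have eq: "(\<lambda>x. \<xi> - grad \<phi> x) = (\<lambda>x. ?F x - 1 *\<^sub>R ?G x)"
        unfolding \<psi>_def grad_diff[OF sper_smooth[OF \<phi>] sper_smooth[OF s]] by simp
      have "energy R w \<xi> \<phi> = energy R w \<xi> (hs \<xi>) - 2 * B ?F ?G + g"
        unfolding energy_eq_B g_def eq B_diff_sq[OF Fc Gc] by simp
      moreover have "\<bar>B ?F ?G\<bar> \<le> S * sqrt (Z * \<kappa> * g)"
      proof -
        have "B ?F ?G = (\<Sum>i\<in>UNIV. \<xi> $ i * B (A i) ?G)"
          unfolding A\<xi> by (rule B_sum) (auto intro: Ac Gc)
        also have "\<bar>\<dots>\<bar> \<le> (\<Sum>i\<in>UNIV. \<bar>\<xi> $ i\<bar> * sqrt (Z * \<kappa> * g))"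
        proof (intro order.trans[OF sum_abs] sum_mono)
          fix i
          have "(B (A i) ?G)\<^sup>2 \<le> Z * \<kappa> * g"
            using near_orthogonal[OF h(1) h(2) \<psi>, of i] by (simp add: A_def g_def)
          then have "\<bar>B (A i) ?G\<bar> \<le> sqrt (Z * \<kappa> * g)" by (metis real_sqrt_abs real_sqrt_le_iff)
          then show "\<bar>\<xi> $ i * B (A i) ?G\<bar> \<le> \<bar>\<xi> $ i\<bar> * sqrt (Z * \<kappa> * g)"
            unfolding abs_mult by (intro mult_left_mono) auto
        qed
        finally show ?thesis by (simp add: S_def sum_distrib_right)
      qed
      \<comment> \<open>Completing the square: the term g is exactly what the expansion of the
        energy offers, so only the multiple of \<kappa> survives.\<close>
      moreover have "2 * (S * sqrt (Z * \<kappa> * g)) \<le> S\<^sup>2 * (Z * \<kappa>) + g"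
      proof -
        have "0 \<le> (S * sqrt (Z * \<kappa>) - sqrt g)\<^sup>2" by simp
        also have "\<dots> = S\<^sup>2 * (Z * \<kappa>) + g - 2 * (S * sqrt (Z * \<kappa> * g))"
          using g0 Z_pos \<kappa> by (simp add: power2_diff power_mult_distrib real_sqrt_mult algebra_simps)
        finally show ?thesis by simp
      qed
      moreover have "S\<^sup>2 * (Z * \<kappa>) \<le> (real CARD('n) * (norm \<xi>)\<^sup>2) * (Z * \<kappa>)"
        unfolding S_def using Z_pos \<kappa> by (intro mult_right_mono sum_abs_sq_le) auto
      ultimately show "Z * (qf M \<xi> - \<kappa> * (real CARD('n) * (norm \<xi>)\<^sup>2)) \<le> energy R w \<xi> \<phi>"
        using Jq[of \<xi>] by (simp add: algebra_simps)
    qed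
    then show "qf M \<xi> - \<kappa> * (real CARD('n) * (norm \<xi>)\<^sup>2) \<le> q \<xi>"
      using Z_pos by (simp add: mult.commute)
  qed (auto simp: h M_def B_sym)
qed

lemma simultaneous_near_minimizers:
  assumes \<kappa>: "\<kappa> > 0"
  obtains h :: "'n \<Rightarrow> real^'n \<Rightarrow> real" where "\<And>i. sper R (h i)"
    "\<And>\<xi>. energy R w \<xi> (\<lambda>x. \<Sum>i\<in>UNIV. \<xi> $ i * h i x) \<le> Z * (q \<xi> + \<kappa> * (norm \<xi>)\<^sup>2)"
proof -
  have "\<kappa> / real CARD('n) > 0" using \<kappa> by simp
  from near_minimizers[OF this] obtain h :: "'n \<Rightarrow> real^'n \<Rightarrow> real" and M where "\<forall>i. sper R (h i)"
    and "\<forall>i j. M i j = M j i"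
    and "\<forall>\<xi>. energy R w \<xi> (\<lambda>x. \<Sum>i\<in>UNIV. \<xi> $ i * h i x) = Z * qf M \<xi>"
    and "\<forall>\<xi>. qf M \<xi> - \<kappa> / real CARD('n) * (real CARD('n) * (norm \<xi>)\<^sup>2) \<le> q \<xi>"
    and "\<forall>\<xi>. q \<xi> \<le> qf M \<xi>"
    by (elim exE conjE) (rule that)
  note h = this(1)[rule_format] and h2 = this(3)[rule_format] and h3 = this(4)[rule_format]
  have "energy R w \<xi> (\<lambda>x. \<Sum>i\<in>UNIV. \<xi> $ i * h i x) \<le> Z * (q \<xi> + \<kappa> * (norm \<xi>)\<^sup>2)" for \<xi>
    unfolding h2 using h3[of \<xi>] Z_pos by (intro mult_left_mono) auto
  with h show ?thesis by (rule that)
qed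

lemma eff_diff_sym: "transpose (eff_diff R U) = eff_diff R U"
  by (simp add: eff_diff_def transpose_def vec_eq_iff add.commute)

text \<open>The matrix is defined by polarizing \<open>q\<close>, which is an infimum and not
  evidently quadratic. It lies within order \<kappa> of the quadratic form of the near-minimisers;
  polarization carries this closeness to the entries, and \<kappa> is arbitrary.\<close>

lemma quad_form_eff_diff: "\<xi> \<bullet> (eff_diff R U *v \<xi>) = q \<xi>"
proof -
  let ?D = "eff_diff R U"
  let ?d = "real CARD('n)"
  have D: "\<xi> \<bullet> (?D *v \<xi>) = (\<Sum>i\<in>UNIV. \<Sum>j\<in>UNIV. \<xi> $ i * \<xi> $ j * ?D $ i $ j)"
    by (simp add: inner_vec_def matrix_vector_mult_def sum_distrib_left mult_ac)
  have "\<bar>\<xi> \<bullet> (?D *v \<xi>) - q \<xi>\<bar> \<le> e" if e: "e > 0" for e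
  proof -
    \<comment> \<open>Collects the entrywise error, summed over both indices, and the distance
      between \<open>qf M\<close> and \<open>q\<close>; the 1 keeps C positive when \<xi> =
      0.\<close>
    define C where "C = (3 * ?d * ?d + ?d) * (norm \<xi>)\<^sup>2 + 1"
    have C: "C > 0" unfolding C_def by (intro add_nonneg_pos mult_nonneg_nonneg) auto
    define \<kappa> where "\<kappa> = e / C"
    have \<kappa>: "\<kappa> > 0" using e C by (simp add: \<kappa>_def)
    from near_minimizers[OF \<kappa>] obtain h :: "'n \<Rightarrow> real^'n \<Rightarrow> real" and M where "\<forall>i. sper R (h i)"
      and "\<forall>i j. M i j = M j i"
      and "\<forall>\<xi>. energy R w \<xi> (\<lambda>x. \<Sum>i\<in>UNIV. \<xi> $ i * h i x) = Z * qf M \<xi>"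
      and "\<forall>\<xi>. qf M \<xi> - \<kappa> * (?d * (norm \<xi>)\<^sup>2) \<le> q \<xi>"
      and "\<forall>\<xi>. q \<xi> \<le> qf M \<xi>"
      by (elim exE conjE) (rule that)
    note M = this(2)[rule_format] and M2 = this(4,5)[rule_format]
    have dd: "qf M x = (\<Sum>i\<in>UNIV. x $ i * (\<Sum>j\<in>UNIV. x $ j * M i j))" for x :: "real^'n"
      by (simp only: qf_def sum_distrib_left mult.assoc)
    have ax: "qf M (axis k 1) = M k k" for k
      unfolding dd sum_axis_mult ..
    have ax2: "qf M (axis k 1 + axis l 1)
       = M k k + M l l + 2 * M k l" for k l
      unfolding dd vector_add_component distrib_right sum.distrib sum_axis_mult by (simp add: M[of l k])
    have n2: "(norm (axis k 1 + axis l 1 :: real^'n))\<^sup>2 \<le> 4" for k l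
    proof -
      have "norm (axis k 1 + axis l 1 :: real^'n) \<le> 2"
        using norm_triangle_ineq[of "axis k 1 :: real^'n" "axis l 1"] by simp
      then have "(norm (axis k 1 + axis l 1 :: real^'n))\<^sup>2 \<le> 2\<^sup>2" by (rule power_mono) simp
      then show ?thesis by simp
    qed
    \<comment> \<open>The sum of two axis vectors has squared norm at most 4 and contributes at most
      4 d \<kappa>, each axis vector at most d \<kappa>; polarization halves the total.\<close>
    have E: "\<bar>?D $ i $ j - M i j\<bar> \<le> 3 * ?d * \<kappa>" for i j
    proof -
      have a: "M i i - \<kappa> * ?d \<le> q (axis i 1)" "q (axis i 1) \<le> M i i" for i
        using M2[of "axis i 1"] unfolding ax by auto
      have "\<kappa> * (?d * (norm (axis i 1 + axis j 1 :: real^'n))\<^sup>2) \<le> \<kappa> * (?d * 4)"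
        using \<kappa> by (intro mult_left_mono n2) auto
      then have b: "M i i + M j j + 2 * M i j - 4 * (\<kappa> * ?d) \<le> q (axis i 1 + axis j 1)"
          "q (axis i 1 + axis j 1) \<le> M i i + M j j + 2 * M i j"
        using M2[of "axis i 1 + axis j 1"] unfolding ax2 by auto
      have "0 \<le> \<kappa> * ?d" using \<kappa> by simp
      then show ?thesis using a[of i] a[of j] b by (simp add: eff_diff_def abs_le_iff field_simps)
    qed
    have "\<bar>\<xi> \<bullet> (?D *v \<xi>) - qf M \<xi>\<bar> \<le> 3 * ?d * \<kappa> * (?d * (norm \<xi>)\<^sup>2)"
      unfolding D qf_def using double_sum_bound[of "\<lambda>i j. ?D $ i $ j - M i j", OF E, of \<xi>]
      by (simp add: sum_subtractf[symmetric] right_diff_distrib)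
    then have "\<bar>\<xi> \<bullet> (?D *v \<xi>) - q \<xi>\<bar> \<le> 3 * ?d * \<kappa> * (?d * (norm \<xi>)\<^sup>2) + \<kappa> * (?d * (norm \<xi>)\<^sup>2)"
      using M2[of \<xi>] by linarith
    also have "\<dots> = \<kappa> * (C - 1)" by (simp add: C_def algebra_simps)
    also have "\<dots> \<le> \<kappa> * C" using \<kappa> by simp
    also have "\<dots> = e" using C by (simp add: \<kappa>_def)
    finally show ?thesis .
  qed
  then have "\<bar>\<xi> \<bullet> (?D *v \<xi>) - q \<xi>\<bar> \<le> 0" by (rule field_le_epsilon) simp
  then show ?thesis by simp
qed

lemma lam_min_le_q: "lam_min (eff_diff R U) * (norm \<xi>)\<^sup>2 \<le> q \<xi>"
  using lam_min_rayleigh[OF eff_diff_sym, of \<xi>] by (simp add: quad_form_eff_diff power2_norm_eq_inner)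

lemma q_le_lam_max: "q \<xi> \<le> lam_max (eff_diff R U) * (norm \<xi>)\<^sup>2"
  using lam_max_rayleigh[OF eff_diff_sym, of \<xi>] by (simp add: quad_form_eff_diff power2_norm_eq_inner)

lemma lam_min_eff_diff_nonneg: "0 \<le> lam_min (eff_diff R U)"
  by (intro lam_min_nonneg eff_diff_sym) (simp add: quad_form_eff_diff q_nonneg)

text \<open>The integral over the cell of a translate of f does not depend on the translation;
  differentiate in the translation parameter.\<close>

lemma integral_pd: fixes f :: "real^'n \<Rightarrow> real" assumes "sper R f" shows "integral (cell R) (pd i f) = 0"
proof -
  have s: "smooth_fun f" using assms by (rule sper_smooth)
  have "((\<lambda>t. integral (cbox 0 (R *\<^sub>R One)) (\<lambda>x. f (x + t *\<^sub>R axis i 1))) has_real_derivative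
      integral (cbox 0 (R *\<^sub>R One)) (\<lambda>x. pd i f (x + 0 *\<^sub>R axis i 1))) (at 0 within UNIV)"
    by (rule leibniz_rule_field_derivative)
      (auto intro!: smooth_fun_line[OF s, THEN DERIV_subset] integrable_continuous continuous_intros
        continuous_on_compose2[OF smooth_fun_continuous[OF s]]
        continuous_on_compose2[OF smooth_fun_continuous[OF smooth_fun_pd(1)[OF s]]] simp: split_beta)
  moreover have "integral (cbox 0 (R *\<^sub>R One)) (\<lambda>x. f (x + t *\<^sub>R axis i 1)) = integral (cell R) f" for t
    unfolding cell_def[symmetric] by (rule integral_cell_shift[OF sper_cper[OF assms] R_pos])
  ultimately have "((\<lambda>t. integral (cell R) f) has_real_derivative integral (cell R) (pd i f)) (at 0)"
    by (simp add: cell_def)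
  then show ?thesis using DERIV_const DERIV_unique by blast
qed

text \<open>Gradients of periodic functions have mean zero, so under a weight bounded below the
  energy cannot fall below that of the constant field. This keeps the largest eigenvalue away from
  0.\<close>

lemma q_lower:
  assumes "a > 0" and w: "\<And>x. a \<le> w x" "\<And>x. w x \<le> b"
  shows "a / b * (norm \<xi>)\<^sup>2 \<le> q \<xi>"
proof -
  let ?V = "R ^ CARD('n)"
  have V: "?V > 0" using R_pos by simp
  have b: "b > 0" using assms(1) w[of 0] by linarith
  have Z: "Z \<le> ?V * b"
    using integral_cell_mono[of R w "\<lambda>x. b"] w_cont w by (simp add: integral_cell_const[OF R_pos])
  have "a * (norm \<xi>)\<^sup>2 * ?V \<le> q \<xi> * Z"
  proof (rule le_q)
    fix f :: "real^'n \<Rightarrow> real" assume f: "sper R f"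
    have c: "continuous_on A (grad f)" for A by (intro continuous_on_grad sper_smooth[OF f])
    \<comment> \<open>The square of the gradient is dropped from the expanded norm; what remains is
      affine in the gradient and has a known integral.\<close>
    have "integral (cell R) (\<lambda>x. a * (norm \<xi>)\<^sup>2 - (\<Sum>i\<in>UNIV. 2 * a * \<xi> $ i * pd i f x)) \<le> energy R w \<xi> f"
      unfolding energy_def
    proof (rule integral_cell_mono)
      fix x
      have "a * (norm \<xi>)\<^sup>2 - (\<Sum>i\<in>UNIV. 2 * a * \<xi> $ i * pd i f x) = a * ((norm \<xi>)\<^sup>2 - 2 * (\<xi> \<bullet> grad f x))"
        by (simp add: inner_vec_def sum_distrib_left algebra_simps)
      also have "\<dots> \<le> a * (norm (\<xi> - grad f x))\<^sup>2"
        using assms(1) by (intro mult_left_mono) (auto simp: power2_norm_eq_inner inner_diff_left inner_diff_right inner_commute)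
      also have "\<dots> \<le> (norm (\<xi> - grad f x))\<^sup>2 * w x"
        using w(1)[of x] by (simp add: mult.commute mult_right_mono)
      finally show "a * (norm \<xi>)\<^sup>2 - (\<Sum>i\<in>UNIV. 2 * a * \<xi> $ i * pd i f x) \<le> (norm (\<xi> - grad f x))\<^sup>2 * w x" .
    qed (intro continuous_on_diff continuous_on_sum continuous_on_mult continuous_on_const continuous_on_power
       continuous_on_norm c w_cont smooth_fun_continuous_on[OF smooth_fun_pd(1)] sper_smooth[OF f])+
    also have "integral (cell R) (\<lambda>x. a * (norm \<xi>)\<^sup>2 - (\<Sum>i\<in>UNIV. 2 * a * \<xi> $ i * pd i f x))
      = ?V * (a * (norm \<xi>)\<^sup>2) - (\<Sum>i\<in>UNIV. 2 * a * \<xi> $ i * integral (cell R) (pd i f))"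
      by (subst integral_cell_diff integral_cell_sum; 
        (intro continuous_on_sum continuous_on_mult continuous_on_const smooth_fun_continuous_on[OF smooth_fun_pd(1)] sper_smooth[OF f])?;
         simp add: integral_cell_const[OF R_pos])+
    finally show "a * (norm \<xi>)\<^sup>2 * ?V \<le> energy R w \<xi> f" using integral_pd[OF f] by (simp add: mult.commute)
  qed
  also have "\<dots> \<le> q \<xi> * (?V * b)" using q_nonneg Z by (rule mult_left_mono[rotated])
  finally show ?thesis using V b by (simp add: field_simps)
qed

end

section \<open>Smooth partition of unity and periodization\<close>

text \<open>Differentiation preserves this family, so its members are smooth by coinduction.\<close>

definition psi :: "real poly \<Rightarrow> real \<Rightarrow> real" where
  "psi p x = (if x > 0 then poly p (1 / x) * exp (- (1 / x)) else 0)"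

lemma poly_exp_decay: "((\<lambda>t. poly p t * exp (- t)) \<longlongrightarrow> 0) at_top" for p :: "real poly"
proof -
  have "((\<lambda>t. \<Sum>i\<le>degree p. coeff p i * (t ^ i / exp t)) \<longlongrightarrow> (\<Sum>i\<le>degree p. coeff p i * 0)) at_top"
    by (intro tendsto_sum tendsto_mult tendsto_const tendsto_power_div_exp_0)
  then show ?thesis
    by (simp add: poly_altdef sum_distrib_right exp_minus divide_inverse mult.assoc)
qed

lemma psi_tendsto_0: "(psi p \<longlongrightarrow> 0) (at 0)"
proof (rule filterlim_split_at)
  have "((\<lambda>x. poly p (inverse x) * exp (- (inverse x))) \<longlongrightarrow> 0) (at_right 0)"
    by (rule filterlim_compose[OF poly_exp_decay filterlim_inverse_at_top_right])
  then show "(psi p \<longlongrightarrow> 0) (at_right 0)"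
    by (rule Lim_transform_eventually) (auto simp: psi_def eventually_at_filter field_simps)
  show "(psi p \<longlongrightarrow> 0) (at_left 0)"
    by (rule Lim_transform_eventually[of "\<lambda>x. 0"]) (auto simp: psi_def eventually_at_filter)
qed

text \<open>With u = 1 / x, differentiating p(u) exp (-u) in x gives u^2 (p - p')(u) exp (-u), which
  is again of the same form.\<close>

lemma psi_deriv: "(psi p has_real_derivative psi ([:0, 0, 1:] * (p - pderiv p)) x) (at x)"
proof -
  consider "x > 0" | "x = 0" | "x < 0" by linarith
  then show ?thesis
  proof cases
    case 1
    have "((\<lambda>x. poly p (1 / x) * exp (- (1 / x))) has_real_derivative
        (poly (pderiv p) (1 / x) * (- 1 / x\<^sup>2)) * exp (- (1 / x)) + poly p (1 / x) * (exp (- (1 / x)) * (1 / x\<^sup>2))) (at x)"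
      using 1 by (auto intro!: derivative_eq_intros poly_DERIV[THEN DERIV_chain2] simp: power2_eq_square field_simps)
    then have "((\<lambda>x. poly p (1 / x) * exp (- (1 / x))) has_real_derivative psi ([:0, 0, 1:] * (p - pderiv p)) x) (at x)"
      using 1 by (simp add: psi_def power2_eq_square field_simps)
    then show ?thesis
      by (rule has_field_derivative_transform_within_open[of _ _ _ "{0<..}"]) (use 1 in \<open>auto simp: psi_def\<close>)
  next
    case 2
    have "((\<lambda>h. psi (pCons 0 p) h) \<longlongrightarrow> 0) (at 0)" by (rule psi_tendsto_0)
    \<comment> \<open>The difference quotient at 0 is itself a member of the family: multiplying the
      polynomial by its variable divides by h.\<close>
    moreover have "psi (pCons 0 p) h = (psi p (0 + h) - psi p 0) / h" for h by (simp add: psi_def)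
    ultimately have "(psi p has_real_derivative 0) (at 0)" by (simp add: DERIV_def)
    then show ?thesis using 2 by (simp add: psi_def)
  next
    case 3
    have "((\<lambda>x. 0) has_real_derivative 0) (at x)" by simp
    then have "(psi p has_real_derivative 0) (at x)"
      by (rule has_field_derivative_transform_within_open[of _ _ _ "{..<0}"]) (use 3 in \<open>auto simp: psi_def\<close>)
    then show ?thesis using 3 by (simp add: psi_def)
  qed
qed

lemma psi_cont: "continuous_on A (psi p)"
  using psi_deriv DERIV_isCont continuous_at_imp_continuous_on by blast

lemma smooth_fun_psi: "smooth_fun (\<lambda>z::real^'n. psi p (s * z $ i + a))"
proof (rule smooth_fun_coinduct[where S="range (\<lambda>p z. psi p (s * z $ i + a))"])
  fix g :: "real^'n \<Rightarrow> real" assume "g \<in> range (\<lambda>p z. psi p (s * z $ i + a))"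
  then show "continuous_on UNIV g"
    by (auto intro!: continuous_on_compose2[OF psi_cont[of UNIV]] continuous_intros)
next
  fix g :: "real^'n \<Rightarrow> real" and j assume "g \<in> range (\<lambda>p z. psi p (s * z $ i + a))"
  then obtain p where g: "g = (\<lambda>z. psi p (s * z $ i + a))" by auto
  let ?e = "s * (if j = i then 1 else 0)"
  let ?p = "smult ?e ([:0, 0, 1:] * (p - pderiv p))"
  have "((\<lambda>t. g (x + t *\<^sub>R axis j 1)) has_real_derivative psi ?p (s * x $ i + a)) (at 0)" for x
  proof -
    have "((\<lambda>t. s * x $ i + a + ?e * t) has_real_derivative ?e) (at 0)"
      by (auto intro!: derivative_eq_intros)
    from DERIV_chain2[OF psi_deriv this, of p]
    have "((\<lambda>t. psi p (s * x $ i + a + ?e * t)) has_real_derivative psi ([:0, 0, 1:] * (p - pderiv p)) (s * x $ i + a) * ?e) (at 0)"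
      by simp
    moreover have "psi ([:0, 0, 1:] * (p - pderiv p)) y * ?e = psi ?p y" for y by (simp add: psi_def)
    moreover have "g (x + t *\<^sub>R axis j 1) = psi p (s * x $ i + a + ?e * t)" for t
      by (simp add: g axis_def algebra_simps)
    ultimately show ?thesis by simp
  qed
  then show "\<exists>h\<in>range (\<lambda>p z. psi p (s * z $ i + a)). \<forall>x. ((\<lambda>t. g (x + t *\<^sub>R axis j 1)) has_real_derivative h x) (at 0)"
    by (intro bexI[of _ "\<lambda>z. psi ?p (s * z $ i + a)"]) auto
qed auto

text \<open>By the quotient rule a derivative of g / h^k is a smooth function over h^(k + 1), so
  these quotients form a closed family.\<close>

lemma smooth_fun_inverse:
  fixes h :: "real^'n \<Rightarrow> real"
  assumes h: "smooth_fun h" and pos: "\<And>x. h x > 0"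
  shows "smooth_fun (\<lambda>x. inverse (h x))"
proof (rule smooth_fun_coinduct[where S="{\<lambda>x. g x * inverse (h x) ^ k | g k. smooth_fun g}"])
  have nz: "h x \<noteq> 0" for x using pos[of x] by simp
  show "(\<lambda>x. inverse (h x)) \<in> {\<lambda>x. g x * inverse (h x) ^ k | g k. smooth_fun g}"
    by (auto intro!: exI[of _ "\<lambda>x. 1"] exI[of _ "1::nat"])
  fix f assume "f \<in> {\<lambda>x. g x * inverse (h x) ^ k | g k. smooth_fun g}"
  then obtain g k where f: "f = (\<lambda>x. g x * inverse (h x) ^ k)" "smooth_fun g" by blast
  show "continuous_on UNIV f"
    unfolding f(1) using nz by (intro continuous_on_mult continuous_on_power continuous_on_inverse
      smooth_fun_continuous f(2) h) auto
  fix i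
  let ?d = "\<lambda>x. (pd i g x * h x - real k * (g x * pd i h x)) * inverse (h x) ^ (k + 1)"
  have "((\<lambda>t. f (x + t *\<^sub>R axis i 1)) has_real_derivative ?d x) (at 0)" for x
  proof -
    let ?I = "inverse (h x)"
    have hI: "h x * ?I = 1" using nz[of x] by simp
    have "((\<lambda>t. inverse (h (x + t *\<^sub>R axis i 1))) has_real_derivative - (?I * pd i h x * ?I)) (at 0)"
      using DERIV_inverse'[OF smooth_fun_pd(2)[OF h, of x i]] nz[of x] by simp
    from DERIV_mult[OF smooth_fun_pd(2)[OF f(2), of x i] DERIV_power[OF this, of k]]
    have "((\<lambda>t. f (x + t *\<^sub>R axis i 1)) has_real_derivative
        (pd i g x * ?I ^ k + real k * (- (?I * pd i h x * ?I) * ?I ^ (k - 1)) * g x)) (at 0)"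
      by (simp add: f(1))
    moreover have "pd i g x * ?I ^ k = pd i g x * (h x * ?I) * ?I ^ k" by (simp only: hI mult_1_right)
    moreover have "real k * (- (?I * pd i h x * ?I) * ?I ^ (k - 1)) * g x = - (real k * (g x * pd i h x)) * ?I ^ (k + 1)"
      by (cases k) (simp_all add: mult_ac)
    moreover have "a * (y * I) * I ^ k + - b * I ^ (k + 1) = (a * y - b) * I ^ (k + 1)" for a b y I :: real
      by (simp add: algebra_simps)
    ultimately show ?thesis by (simp only:)
  qed
  moreover have "smooth_fun (\<lambda>x. pd i g x * h x - real k * (g x * pd i h x))"
    by (intro smooth_fun_diff smooth_fun_mult smooth_fun_const smooth_fun_pd f h)
  ultimately show "\<exists>h\<in>{\<lambda>x. g x * inverse (h x) ^ k | g k. smooth_fun g}. \<forall>x. ((\<lambda>t. f (x + t *\<^sub>R axis i 1)) has_real_derivative h x) (at 0)"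
    by (intro bexI[of _ ?d] allI CollectI exI[of _ "k + 1"] exI[of _ "\<lambda>x. pd i g x * h x - real k * (g x * pd i h x)"] conjI refl)
qed

text \<open>A smooth step: it is 0 up to 0 and 1 from 1 on. The denominator is positive since at
  least one of t and 1 - t is.\<close>

definition eta :: "real \<Rightarrow> real" where
  "eta t = psi 1 t * inverse (psi 1 t + psi 1 (1 - t))"

lemma psi_1_pos: "psi 1 t + psi 1 (1 - t) > 0"
  by (auto simp: psi_def add_pos_pos)

lemma eta_0: "t \<le> 0 \<Longrightarrow> eta t = 0" by (simp add: eta_def psi_def)
lemma eta_1: "t \<ge> 1 \<Longrightarrow> eta t = 1" by (simp add: eta_def psi_def)

lemma smooth_fun_eta: "smooth_fun (\<lambda>z::real^'n. eta (z $ i + a))"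
proof -
  have "smooth_fun (\<lambda>z::real^'n. psi 1 (1 * z $ i + a) * inverse (psi 1 (1 * z $ i + a) + psi 1 ((-1) * z $ i + (1 - a))))"
    using psi_1_pos[of "z $ i + a" for z :: "real^'n"]
    by (intro smooth_fun_mult smooth_fun_inverse smooth_fun_add smooth_fun_psi) (simp add: algebra_simps)
  then show ?thesis by (simp add: eta_def algebra_simps)
qed

text \<open>The difference of two steps one unit apart, so that integer translates telescope to 1
  while each one vanishes outside (-1, 1).\<close>

definition theta1 :: "real \<Rightarrow> real" where "theta1 t = eta (t + 1) - eta t"

lemma theta1_0: "\<bar>t\<bar> \<ge> 1 \<Longrightarrow> theta1 t = 0"
  by (cases "t \<ge> 0") (auto simp: theta1_def eta_0 eta_1)

lemma theta1_partition: "0 \<le> t \<Longrightarrow> t \<le> 1 \<Longrightarrow> theta1 (t - 1) + theta1 t = 1"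
  by (simp add: theta1_def eta_0 eta_1)

definition theta :: "real^'n \<Rightarrow> real" where "theta z = (\<Prod>i\<in>UNIV. theta1 (z $ i))"

lemma smooth_fun_theta: "smooth_fun theta"
  unfolding theta_def theta1_def
  by (intro smooth_fun_prod smooth_fun_diff smooth_fun_eta smooth_fun_eta[where a=0, simplified])

definition supp1 :: "(real^'n \<Rightarrow> real) \<Rightarrow> bool" where
  "supp1 k \<longleftrightarrow> (\<forall>z. (\<exists>i. \<bar>z $ i\<bar> \<ge> 1) \<longrightarrow> k z = 0)"

lemma supp1_theta: "supp1 theta"
  unfolding supp1_def theta_def using theta1_0 by (metis UNIV_I finite prod_zero_iff)

lemma supp1_mult: "supp1 k \<Longrightarrow> supp1 (\<lambda>z. k z * h z)"
  unfolding supp1_def by simp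

text \<open>On the faces of the cube k is known to vanish on one side only. Since the two-sided
  derivative exists, it equals the one-sided derivative towards the outside, which is 0.\<close>

lemma supp1_pd:
  fixes k :: "real^'n \<Rightarrow> real"
  assumes k: "smooth_fun k" "supp1 k" shows "supp1 (pd j k)"
  unfolding supp1_def
proof (intro allI impI)
  fix z :: "real^'n" assume "\<exists>i. \<bar>z $ i\<bar> \<ge> 1"
  then obtain i where i: "\<bar>z $ i\<bar> \<ge> 1" by blast
  \<comment> \<open>The sign points outward, so that moving by s t along axis j never decreases the
    modulus of coordinate i, whether or not j = i.\<close>
  define s :: real where "s = (if z $ i \<ge> 0 then 1 else - 1)"
  have k0: "k (z + (s * t) *\<^sub>R axis j 1) = 0" if "t \<ge> 0" for t
  proof -
    have "1 \<le> \<bar>(z + (s * t) *\<^sub>R axis j 1) $ i\<bar>"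
      using i that by (auto simp: s_def axis_def split: if_splits)
    then show ?thesis using k(2) unfolding supp1_def by blast
  qed
  have d: "((\<lambda>t. k (z + (s * t) *\<^sub>R axis j 1)) has_real_derivative s * pd j k z) (at 0 within {0..})"
    using smooth_fun_line_scaled[OF k(1), of z s j 0] by (simp add: has_field_derivative_at_within)
  have "((\<lambda>t. 0) has_real_derivative s * pd j k z) (at 0 within {0..})"
    by (rule has_field_derivative_transform_within[OF d, of 1]) (auto simp: k0)
  moreover have "((\<lambda>t. 0) has_real_derivative 0) (at 0 within {0::real..})" by simp
  ultimately have "s * pd j k z = 0"
    by (rule has_field_derivative_unique) (simp add: at_within_Ici_at_right)
  then show "pd j k z = 0" by (auto simp: s_def split: if_splits)
qed

section \<open>Periodization over the integer lattice\<close>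

definition lattice :: "(real^'n) set" where "lattice = {m. \<forall>i. m $ i \<in> \<int>}"

text \<open>The sum over all lattice translates, restricted to the finitely many that can be nonzero
  at y. Any larger finite set of lattice points gives the same value, so near a given y one fixed
  index set may be used and the sum differentiated term by term.\<close>

definition perio :: "(real^'n \<Rightarrow> real) \<Rightarrow> real^'n \<Rightarrow> real" where
  "perio k y = (\<Sum>m | m \<in> lattice \<and> (\<forall>i. \<bar>y $ i + m $ i\<bar> < 1). k (y + m))"

lemma finite_lattice_box: "finite {m \<in> lattice. \<forall>i. \<bar>m $ i\<bar> \<le> real K}"
proof (rule finite_subset)
  show "{m \<in> lattice. \<forall>i. \<bar>m $ i\<bar> \<le> real K} \<subseteq> (\<lambda>f. \<chi> i. of_int (f i)) ` (PiE UNIV (\<lambda>i::'a. {- int K..int K}))"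
  proof
    fix m :: "real^'a" assume m: "m \<in> {m \<in> lattice. \<forall>i. \<bar>m $ i\<bar> \<le> real K}"
    have "m = (\<chi> i. of_int \<lfloor>m $ i\<rfloor>)" using m by (auto simp: vec_eq_iff lattice_def)
    moreover have "- int K \<le> \<lfloor>m $ i\<rfloor>" "\<lfloor>m $ i\<rfloor> \<le> int K" for i
    proof -
      have "\<bar>m $ i\<bar> \<le> real K" using m by auto
      then show "- int K \<le> \<lfloor>m $ i\<rfloor>" "\<lfloor>m $ i\<rfloor> \<le> int K" by linarith+
    qed
    ultimately show "m \<in> (\<lambda>f. \<chi> i. of_int (f i)) ` (PiE UNIV (\<lambda>i::'a. {- int K..int K}))"
      by (intro image_eqI[of _ _ "\<lambda>i. \<lfloor>m $ i\<rfloor>"]) auto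
  qed
qed (auto intro!: finite_imageI finite_PiE)

lemma perio_eq:
  assumes k: "supp1 k" and M: "finite M" "M \<subseteq> lattice" "\<And>m. m \<in> lattice \<Longrightarrow> (\<And>i. \<bar>y $ i + m $ i\<bar> < 1) \<Longrightarrow> m \<in> M"
  shows "perio k y = (\<Sum>m\<in>M. k (y + m))"
  unfolding perio_def
proof (rule sum.mono_neutral_left)
  show "\<forall>m\<in>M - {m. m \<in> lattice \<and> (\<forall>i. \<bar>y $ i + m $ i\<bar> < 1)}. k (y + m) = 0"
  proof
    fix m assume m: "m \<in> M - {m. m \<in> lattice \<and> (\<forall>i. \<bar>y $ i + m $ i\<bar> < 1)}"
    then have "\<not> (\<forall>i. \<bar>y $ i + m $ i\<bar> < 1)" using M(2) by blast
    then have "\<exists>i. \<bar>(y + m) $ i\<bar> \<ge> 1" by (auto simp: not_less)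
    then show "k (y + m) = 0" using k unfolding supp1_def by blast
  qed
qed (use M in auto)

lemma perio_eq_box:
  assumes k: "supp1 k" and y: "norm y + 1 \<le> real K"
  shows "perio k y = (\<Sum>m | m \<in> lattice \<and> (\<forall>i. \<bar>m $ i\<bar> \<le> real K). k (y + m))"
proof (rule perio_eq[OF k])
  show "finite {m \<in> lattice. \<forall>i. \<bar>m $ i\<bar> \<le> real K}" by (rule finite_lattice_box)
  fix m assume m: "m \<in> lattice" "\<And>i. \<bar>y $ i + m $ i\<bar> < 1"
  have "\<bar>m $ i\<bar> \<le> real K" for i using m(2)[of i] component_le_norm_cart[of y i] y by linarith
  then show "m \<in> {m \<in> lattice. \<forall>i. \<bar>m $ i\<bar> \<le> real K}" using m by auto
qed auto

lemma axis_lattice: "axis i 1 \<in> lattice"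
  by (auto simp: lattice_def axis_def)

lemma lattice_add: "a \<in> lattice \<Longrightarrow> b \<in> lattice \<Longrightarrow> a + b \<in> lattice"
  and lattice_diff: "a \<in> lattice \<Longrightarrow> b \<in> lattice \<Longrightarrow> a - b \<in> lattice"
  by (auto simp: lattice_def)

lemma perio_periodic: fixes k :: "real^'n \<Rightarrow> real" shows "periodic_R 1 (perio k)"
  unfolding periodic_R_def
proof (intro allI)
  fix x :: "real^'n" and i
  show "perio k (x + 1 *\<^sub>R axis i 1) = perio k x"
    unfolding perio_def
    by (rule sum.reindex_bij_witness[of _ "\<lambda>m. m - axis i 1" "\<lambda>m. m + axis i 1"])
      (auto simp: lattice_add lattice_diff axis_lattice algebra_simps)
qed

lemma has_pd_perio:
  assumes k: "smooth_fun k" "supp1 k"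
  shows "((\<lambda>t. perio k (y + t *\<^sub>R axis i 1)) has_real_derivative perio (pd i k) y) (at 0)"
proof -
  \<comment> \<open>One unit more than y itself requires, so that the same box serves every point at
    distance less than 1 from y.\<close>
  define K where "K = nat \<lceil>norm y\<rceil> + 2"
  have K: "norm y + 2 \<le> real K" unfolding K_def by linarith
  let ?B = "{m. m \<in> lattice \<and> (\<forall>i. \<bar>m $ i\<bar> \<le> real K)}"
  have "((\<lambda>t. \<Sum>m\<in>?B. k ((y + m) + t *\<^sub>R axis i 1)) has_real_derivative (\<Sum>m\<in>?B. pd i k (y + m))) (at 0)"
    by (intro DERIV_sum smooth_fun_pd(2) k)
  moreover have "(\<Sum>m\<in>?B. pd i k (y + m)) = perio (pd i k) y"
    using K by (intro perio_eq_box[symmetric] supp1_pd k) auto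
  ultimately have "((\<lambda>t. \<Sum>m\<in>?B. k ((y + m) + t *\<^sub>R axis i 1)) has_real_derivative perio (pd i k) y) (at 0)"
    by simp
  then show ?thesis
  proof (rule has_field_derivative_transform_within_open[of _ _ _ "{-1<..<1}"])
    fix t :: real assume t: "t \<in> {-1<..<1}"
    have "norm (y + t *\<^sub>R axis i 1) \<le> norm y + \<bar>t\<bar>"
      using norm_triangle_ineq[of y "t *\<^sub>R axis i 1"] by simp
    then have "norm (y + t *\<^sub>R axis i 1) + 1 \<le> real K" using K t by auto
    from perio_eq_box[OF k(2) this]
    show "(\<Sum>m\<in>?B. k ((y + m) + t *\<^sub>R axis i 1)) = perio k (y + t *\<^sub>R axis i 1)"
      by (simp add: algebra_simps)
  qed auto
qed

lemma perio_continuous: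
  assumes k: "continuous_on UNIV k" "supp1 k"
  shows "continuous_on UNIV (perio k)"
proof -
  have "isCont (perio k) y" for y
  proof -
    define K where "K = nat \<lceil>norm y\<rceil> + 2"
    have K: "norm y + 2 \<le> real K" unfolding K_def by linarith
    let ?B = "{m. m \<in> lattice \<and> (\<forall>i. \<bar>m $ i\<bar> \<le> real K)}"
    have "continuous_on (ball y 1) (\<lambda>y. \<Sum>m\<in>?B. k (y + m))"
      by (intro continuous_on_sum continuous_on_compose2[OF k(1)] continuous_intros) auto
    moreover have "(\<Sum>m\<in>?B. k (z + m)) = perio k z" if "z \<in> ball y 1" for z
    proof -
      have "norm z \<le> norm y + dist y z" by (metis dist_norm norm_triangle_sub norm_minus_commute)
      then show ?thesis using K that by (intro perio_eq_box[symmetric] k) auto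
    qed
    ultimately have "continuous_on (ball y 1) (perio k)" using continuous_on_cong[OF refl, of "ball y 1"] by (metis (no_types, lifting))
    then show ?thesis by (simp add: continuous_on_eq_continuous_at)
  qed
  then show ?thesis by (simp add: continuous_on_eq_continuous_at)
qed

lemma smooth_fun_perio:
  assumes k: "smooth_fun k" "supp1 k" shows "smooth_fun (perio k)"
proof (rule smooth_fun_coinduct[where S="{perio k | k. smooth_fun k \<and> supp1 k}"])
  show "perio k \<in> {perio k | k. smooth_fun k \<and> supp1 k}" using k by blast
  fix g i assume "g \<in> {perio k | k. smooth_fun k \<and> supp1 k}"
  then show "\<exists>h\<in>{perio k | k. smooth_fun k \<and> supp1 k}. \<forall>x. ((\<lambda>t. g (x + t *\<^sub>R axis i 1)) has_real_derivative h x) (at 0)"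
    using has_pd_perio smooth_fun_pd(1) supp1_pd by blast
qed (auto intro!: perio_continuous intro: smooth_fun_continuous)

lemma sper_perio: "smooth_fun k \<Longrightarrow> supp1 k \<Longrightarrow> sper 1 (perio k)"
  by (simp add: sper_def smooth_fun_perio perio_periodic)

lemma pd_perio: "smooth_fun k \<Longrightarrow> supp1 k \<Longrightarrow> pd i (perio k) = perio (pd i k)"
  by (rule ext, rule has_pd_unique, rule has_pd_perio)

definition ind :: "'n set \<Rightarrow> real^'n" where "ind S = (\<chi> i. if i \<in> S then 1 else 0)"

lemma ind_nth [simp]: "ind S $ i = (if i \<in> S then 1 else 0)" by (simp add: ind_def)

text \<open>With coordinates of y in [0, 1], a translate reaches the open cube only if each
  coordinate of m is 0 or -1. The sum therefore runs over the 2^d sets of coordinates shifted by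
  -1.\<close>

lemma perio_cell:
  assumes k: "supp1 k" and y: "y \<in> cell 1"
  shows "perio k y = (\<Sum>S\<in>UNIV. k (y - ind S))"
proof -
  have "perio k y = (\<Sum>m\<in>range (\<lambda>S. - ind S). k (y + m))"
  proof (rule perio_eq[OF k])
    show "range (\<lambda>S. - ind S) \<subseteq> lattice" by (auto simp: lattice_def)
    fix m assume m: "m \<in> lattice" "\<And>i. \<bar>y $ i + m $ i\<bar> < 1"
    have "m $ i = (- ind {i. m $ i = - 1}) $ i" for i
    proof -
      obtain z where z: "m $ i = of_int z" using m(1) by (auto simp: lattice_def Ints_def)
      have "0 \<le> y $ i" "y $ i \<le> 1" using y by (auto simp: mem_cell)
      then have "z < 1" "z > -2" using m(2)[of i] z by linarith+
      then have "z = 0 \<or> z = -1" by auto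
      then show ?thesis using z by auto
    qed
    then have "m = - ind {i. m $ i = - 1}" by (simp add: vec_eq_iff)
    then show "m \<in> range (\<lambda>S. - ind S)" by blast
  qed auto
  also have "\<dots> = (\<Sum>S\<in>UNIV. k (y - ind S))"
  proof (subst sum.reindex)
    show "inj (\<lambda>S. - ind S :: real^'n)"
    proof (rule injI)
      fix S T :: "'n set" assume "- ind S = - ind T"
      then have "ind S $ i = ind T $ i" for i by (simp add: vec_eq_iff)
      then show "S = T" by (simp add: set_eq_iff) (metis zero_neq_one)
    qed
  qed simp
  finally show ?thesis .
qed

text \<open>Expanding the product over coordinates of the one-dimensional partitions gives one term
  for each set of shifted coordinates.\<close>

lemma theta_partition: assumes y: "y \<in> cell 1" shows "(\<Sum>S\<in>UNIV. theta (y - ind S)) = 1"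
proof -
  have "1 = (\<Prod>i\<in>UNIV. theta1 (y $ i - 1) + theta1 (y $ i))"
    using y by (simp add: theta1_partition mem_cell)
  also have "\<dots> = (\<Sum>S\<in>Pow UNIV. (\<Prod>i\<in>S. theta1 (y $ i - 1)) * (\<Prod>i\<in>UNIV - S. theta1 (y $ i)))"
    by (rule prod_add) simp
  also have "\<dots> = (\<Sum>S\<in>Pow UNIV. theta (y - ind S))"
  proof (rule sum.cong)
    fix S :: "'a set"
    have "theta (y - ind S) = (\<Prod>i\<in>S. theta1 ((y - ind S) $ i)) * (\<Prod>i\<in>UNIV - S. theta1 ((y - ind S) $ i))"
      unfolding theta_def by (subst prod.subset_diff[of S UNIV]) (auto simp: mult.commute)
    then show "(\<Prod>i\<in>S. theta1 (y $ i - 1)) * (\<Prod>i\<in>UNIV - S. theta1 (y $ i)) = theta (y - ind S)" by simp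
  qed simp
  finally show ?thesis by simp
qed

lemma periodic_lattice:
  assumes f: "periodic_R 1 f" and m: "m \<in> lattice" shows "f (y + m) = f y"
proof -
  have "f (y + (\<Sum>i\<in>S. (m $ i) *\<^sub>R axis i 1)) = f y" for S
  proof (induction S rule: infinite_finite_induct)
    case (insert i S)
    obtain z where z: "m $ i = of_int z" using m by (auto simp: lattice_def Ints_def)
    have "f (y + (\<Sum>i\<in>insert i S. (m $ i) *\<^sub>R axis i 1)) = f (y + (\<Sum>i\<in>S. (m $ i) *\<^sub>R axis i 1) + (of_int z * 1) *\<^sub>R axis i 1)"
      using insert z by (simp add: algebra_simps)
    then show ?case using periodic_R_int[OF f] insert by simp
  qed auto
  from this[of UNIV] show ?thesis by (simp add: vec_axis_sum[symmetric])
qed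

lemma cell_representative:
  obtains m where "m \<in> lattice" "y + m \<in> cell 1"
proof
  show "(\<chi> i. - of_int \<lfloor>y $ i\<rfloor>) \<in> lattice" by (simp add: lattice_def)
  show "y + (\<chi> i. - of_int \<lfloor>y $ i\<rfloor>) \<in> cell 1"
    unfolding mem_cell by (simp add: less_imp_le) (metis frac_def frac_ge_0 frac_lt_1 less_imp_le diff_ge_0_iff_ge diff_le_eq add.commute)
qed

lemma perio_theta: "perio theta = (\<lambda>y. 1)"
proof
  fix y :: "real^'n"
  obtain m where "m \<in> lattice" "y + m \<in> cell 1" by (rule cell_representative)
  then show "perio theta y = 1"
    using periodic_lattice[OF perio_periodic, of m theta y] perio_cell[OF supp1_theta] theta_partition by metis
qed

text \<open>The identity on the closed cell alone could not be differentiated at its faces; the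
  periodization is constant on the whole space, and its derivative is evaluated on the cell.\<close>

lemma pd_theta_sum: assumes "y \<in> cell 1" shows "(\<Sum>S\<in>UNIV. pd j theta (y - ind S)) = 0"
proof -
  have "(\<Sum>S\<in>UNIV. pd j theta (y - ind S)) = perio (pd j theta) y"
    by (rule perio_cell[symmetric, OF supp1_pd[OF smooth_fun_theta supp1_theta] assms])
  also have "\<dots> = pd j (perio theta) y" by (simp add: pd_perio smooth_fun_theta supp1_theta)
  finally show ?thesis by (simp add: perio_theta)
qed

lemma supp1_bounded:
  fixes k :: "real^'n \<Rightarrow> real"
  assumes "continuous_on UNIV k" "supp1 k" obtains K where "K \<ge> 0" "\<And>z. \<bar>k z\<bar> \<le> K"
proof -
  have "compact (k ` cbox (- One) One)"
    by (intro compact_continuous_image compact_cbox continuous_on_subset[OF assms(1)]) auto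
  then obtain K where K: "\<And>x. x \<in> cbox (- One) One \<Longrightarrow> norm (k x) \<le> K"
    using compact_imp_bounded bounded_iff by (metis imageI)
  have "\<bar>k z\<bar> \<le> max K 0" for z
  proof (cases "z \<in> cbox (- One) One")
    case False
    then obtain i where "\<not> (- 1 \<le> z $ i \<and> z $ i \<le> 1)" by (auto simp: mem_box_cart)
    then have "\<exists>i. \<bar>z $ i\<bar> \<ge> 1" by (intro exI[of _ i]) auto
    then show ?thesis using assms(2) unfolding supp1_def by auto
  qed (use K in force)
  then show ?thesis using that[of "max K 0"] by simp
qed

section \<open>Two-scale comparison\<close>

definition coords :: "'n::finite list" where "coords = (SOME xs. set xs = UNIV \<and> distinct xs)"

lemma coords: "set (coords :: 'n::finite list) = UNIV \<and> distinct (coords :: 'n list)"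
  unfolding coords_def by (rule someI_ex) (rule finite_distinct_list[OF finite])

lemma set_coords [simp]: "i \<in> set coords" using coords by blast
lemma length_coords [simp]: "length (coords :: 'n::finite list) = CARD('n)"
  using coords distinct_card by metis

section \<open>Averages of a test function and their defects from periodicity\<close>

locale slow_approx = slow_weight R \<omega> c N for R :: real and \<omega> :: "real^'n \<Rightarrow> real" and c :: real and N :: nat +
  fixes f :: "real^'n \<Rightarrow> real" and l :: "real^'n"
  assumes f: "sper R f"
begin

definition F :: "real^'n \<Rightarrow> real" where "F = Lts N coords f"
definition g :: "real^'n \<Rightarrow> real" where "g = Avs coords F"
definition \<Phi> :: "'n \<Rightarrow> real^'n \<Rightarrow> real" where "\<Phi> j x = l $ j - pd j f x"
definition v :: "'n \<Rightarrow> real^'n \<Rightarrow> real" where "v j x = l $ j - pd j F x"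
definition \<xi> :: "'n \<Rightarrow> real^'n \<Rightarrow> real" where "\<xi> j x = l $ j - pd j g x"

lemma sper_F: "sper R F" unfolding F_def by (rule sper_Lts[OF f])
lemma sper_g: "sper R g" unfolding g_def by (rule sper_Avs[OF sper_F])
lemma sper_\<Phi>: "sper R (\<Phi> j)" unfolding \<Phi>_def by (intro sper_diff sper_const sper_pd f)
lemma sper_v: "sper R (v j)" unfolding v_def by (intro sper_diff sper_const sper_pd sper_F)
lemma sper_\<xi>: "sper R (\<xi> j)" unfolding \<xi>_def by (intro sper_diff sper_const sper_pd sper_g)

text \<open>Averages fix constants, so the residual field is averaged together with the gradient.
  Hence all later bounds are relative to the energy of f in direction l rather than to the size of
  its gradient.\<close>

lemma v_eq: "v j = Lts N coords (\<Phi> j)"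
  unfolding v_def \<Phi>_def F_def pd_Lts[OF f] Lts_diff Lts_const[OF N_pos] ..

lemma \<xi>_eq: "\<xi> j = Avs coords (v j)"
proof -
  have "Avs coords (v j) = (\<lambda>x. Avs coords (\<lambda>x. l $ j) x - Avs coords (pd j F) x)"
    unfolding v_def by (rule Avs_diff) (auto intro: sper_cper sper_pd sper_F)
  then show ?thesis unfolding \<xi>_def g_def by (simp add: pd_Avs sper_smooth[OF sper_F])
qed

lemma E_eq: "energy R \<omega> l f = (\<Sum>j\<in>UNIV. wsq R \<omega> (\<Phi> j))"
  unfolding \<Phi>_def by (rule energy_sum[OF f])

lemma wsq\<Phi>_nonneg: "0 \<le> wsq R \<omega> (\<Phi> j)" by (intro wsq_nonneg sper_cper sper_\<Phi>)

lemma wsq\<Phi>_le: "wsq R \<omega> (\<Phi> j) \<le> energy R \<omega> l f"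
  unfolding E_eq by (rule member_le_sum) (auto intro: wsq\<Phi>_nonneg)

lemma E_nonneg: "0 \<le> energy R \<omega> l f" by (rule energy_nonneg[OF f])

lemma wsq_\<xi>: "wsq R \<omega> (\<xi> j) \<le> c ^ (2 * CARD('n)) * wsq R \<omega> (\<Phi> j)"
proof -
  have "wsq R \<omega> (\<xi> j) \<le> c ^ CARD('n) * wsq R \<omega> (v j)"
    using wsq_Avs[OF sper_cper[OF sper_v], of coords j] by (simp add: \<xi>_eq)
  also have "\<dots> \<le> c ^ CARD('n) * (c ^ CARD('n) * wsq R \<omega> (\<Phi> j))"
    using c_ge1 wsq_Lts'[OF sper_cper[OF sper_\<Phi>], of coords j] by (intro mult_left_mono) (auto simp: v_eq)
  finally show ?thesis by (simp add: power_add mult_2)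
qed

lemma wsq_Dl_v: "wsq R \<omega> (Dl i (v j)) \<le> 4 * c ^ CARD('n) / (real N)\<^sup>2 * wsq R \<omega> (\<Phi> j)"
  using wsq_Dl_Lts[OF sper_cper[OF sper_\<Phi>], of i coords j] by (simp add: v_eq)

lemma pd_g: "pd i g = Avs (remove1 i coords) (Dl i F)"
  unfolding g_def by (rule pd_Avs_mem[OF set_coords sper_F])

lemma Dl_pd_F: "Dl i (pd k F) = (\<lambda>x. - Dl i (v k) x)"
  by (simp add: fun_eq_iff Dl_def v_def)

lemma length_remove: "length (remove1 i (coords :: 'n list)) \<le> CARD('n)"
  by (simp add: length_remove1)

text \<open>The derivative in direction i has become a unit difference of F, and the one in
  direction k passes through to the gradient of F. So the Hessian of g is an average of unit
  differences of \<open>v\<close>, each of order 1 / N.\<close>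

lemma wsq_pd_\<xi>: "wsq R \<omega> (pd k (\<xi> i)) \<le> c ^ CARD('n) * (4 * c ^ CARD('n) / (real N)\<^sup>2) * wsq R \<omega> (\<Phi> k)"
proof -
  have "pd k (\<xi> i) = (\<lambda>x. - pd k (pd i g) x)"
    unfolding \<xi>_def pd_diff[OF smooth_fun_const sper_smooth[OF sper_pd[OF sper_g]]] by simp
  also have "pd k (pd i g) = Avs (remove1 i coords) (Dl i (pd k F))"
    unfolding pd_g pd_Avs[OF sper_smooth[OF sper_Dl[OF sper_F]]] pd_Dl[OF sper_smooth[OF sper_F]] ..
  finally have "wsq R \<omega> (pd k (\<xi> i)) = wsq R \<omega> (Avs (remove1 i coords) (Dl i (pd k F)))"
    by (simp add: wsq_minus)
  also have "\<dots> \<le> c ^ length (remove1 i (coords :: 'n list)) * wsq R \<omega> (Dl i (pd k F))"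
    by (intro wsq_Avs sper_cper sper_Dl sper_pd sper_F)
  also have "\<dots> \<le> c ^ CARD('n) * (4 * c ^ CARD('n) / (real N)\<^sup>2 * wsq R \<omega> (\<Phi> k))"
    using wsq_Dl_v[of i k] c_ge1 length_remove[of i]
    by (intro mult_mono power_increasing) (auto simp: Dl_pd_F wsq_minus intro: wsq_nonneg sper_cper sper_Dl sper_v)
  finally show ?thesis by simp
qed

lemma grad_wsq_Dl_F: "grad_wsq (Dl i F) \<le> 4 * c ^ CARD('n) / (real N)\<^sup>2 * energy R \<omega> l f"
proof -
  have "grad_wsq (Dl i F) = (\<Sum>k\<in>UNIV. wsq R \<omega> (Dl i (v k)))"
    unfolding grad_wsq_def pd_Dl[OF sper_smooth[OF sper_F]] by (simp add: Dl_pd_F wsq_minus)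
  also have "\<dots> \<le> (\<Sum>k\<in>UNIV. 4 * c ^ CARD('n) / (real N)\<^sup>2 * wsq R \<omega> (\<Phi> k))"
    by (intro sum_mono wsq_Dl_v)
  finally show ?thesis by (simp add: E_eq sum_distrib_left)
qed

text \<open>Both the unit difference of F at x + y and the derivative of g at x are compared with
  the unit difference of F at x. The Poincare-type bounds apply because the gradient of that
  difference is of order 1 / N.\<close>

lemma wsq_slow_gradient:
  assumes y: "\<And>j. \<bar>y $ j\<bar> \<le> 1"
  shows "wsq R \<omega> (\<lambda>x. Dl i F (x + y) - pd i g x) \<le> 4 * (4 * c) ^ CARD('n) * (4 * c ^ CARD('n) / (real N)\<^sup>2 * energy R \<omega> l f)"
proof -
  let ?D = "Dl i F"
  have D: "sper R ?D" by (rule sper_Dl[OF sper_F])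
  have "wsq R \<omega> (\<lambda>x. ?D (x + y) - pd i g x) = wsq R \<omega> (\<lambda>x. (?D (x + y) - ?D x) - (Avs (remove1 i coords) ?D x - ?D x))"
    by (simp add: pd_g)
  also have "\<dots> \<le> 2 * ((4 * c) ^ CARD('n) * grad_wsq ?D) + 2 * ((4 * c) ^ CARD('n) * grad_wsq ?D)"
  proof (rule order.trans[OF wsq_diff_le add_mono[OF mult_left_mono mult_left_mono]])
    show "wsq R \<omega> (\<lambda>x. ?D (x + y) - ?D x) \<le> (4 * c) ^ CARD('n) * grad_wsq ?D"
      by (rule wsq_unit_shift_diff[OF D y])
    have "wsq R \<omega> (\<lambda>x. Avs (remove1 i coords) ?D x - ?D x) \<le> (4 * c) ^ length (remove1 i (coords :: 'n list)) * grad_wsq ?D"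
      by (rule wsq_Avs_diff[OF D])
    also have "\<dots> \<le> (4 * c) ^ CARD('n) * grad_wsq ?D"
      using c_ge1 length_remove[of i] by (intro mult_right_mono power_increasing grad_wsq_nonneg D) auto
    finally show "wsq R \<omega> (\<lambda>x. Avs (remove1 i coords) ?D x - ?D x) \<le> (4 * c) ^ CARD('n) * grad_wsq ?D" .
  qed (auto intro!: cper_diff cper_shift cper_Avs sper_cper[OF D])
  also have "\<dots> = 4 * (4 * c) ^ CARD('n) * grad_wsq ?D" by simp
  also have "\<dots> \<le> 4 * (4 * c) ^ CARD('n) * (4 * c ^ CARD('n) / (real N)\<^sup>2 * energy R \<omega> l f)"
    using c_ge1 by (intro mult_left_mono grad_wsq_Dl_F) auto
  finally show ?thesis .
qed

text \<open>Goes from y to \<open>y - ind S\<close> along unit steps, each of which is a unit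
  difference of h to be matched with k. Keeping h and k general serves F with the gradient of g, and
  \<open>v\<close> with 0.\<close>

lemma wsq_chain:
  assumes h: "cper R h" and k: "\<And>i. cper R (k i)" and B0: "b \<ge> 0"
    and B: "\<And>i y. (\<And>j. \<bar>y $ j\<bar> \<le> 1) \<Longrightarrow> wsq R \<omega> (\<lambda>x. Dl i h (x + y) - k i x) \<le> b"
    and y: "\<And>j. \<bar>y $ j\<bar> \<le> 1" "\<And>j. j \<in> S \<Longrightarrow> 0 \<le> y $ j"
  shows "wsq R \<omega> (\<lambda>x. h (x + (y - ind S)) - h (x + y) + (\<Sum>i\<in>S. k i x)) \<le> 4 ^ card S * b"
proof -
  have "finite S" by simp
  then show ?thesis using y
  proof (induction S arbitrary: y rule: finite_induct)
    case empty
    then show ?case using B0 by (simp add: wsq_def ind_def zero_vec_def[symmetric])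
  next
    case (insert i S)
    \<comment> \<open>Coordinate i lay in [0, 1], so after the step it lies in [-1, 0] and the bound
      for displacements of modulus at most 1 still applies.\<close>
    define z where "z = y - axis i 1"
    have z1: "\<bar>z $ j\<bar> \<le> 1" for j using insert.prems(1)[of j] insert.prems(2)[of i] by (auto simp: z_def axis_def)
    have z2: "0 \<le> z $ j" if "j \<in> S" for j
      using insert.prems(2)[of j] insert.hyps that by (auto simp: z_def axis_def)
    have ii: "y - ind (insert i S) = z - ind S"
      using insert.hyps by (auto simp: z_def vec_eq_iff axis_def)
    have yz: "x + y = (x + z) + axis i 1" for x by (simp add: z_def)
    let ?a = "\<lambda>x. h (x + (z - ind S)) - h (x + z) + (\<Sum>i\<in>S. k i x)"
    let ?b = "\<lambda>x. Dl i h (x + z) - k i x"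
    have "wsq R \<omega> (\<lambda>x. h (x + (y - ind (insert i S))) - h (x + y) + (\<Sum>i\<in>insert i S. k i x)) = wsq R \<omega> (\<lambda>x. ?a x - ?b x)"
      unfolding ii yz using insert.hyps by (simp add: Dl_def algebra_simps)
    also have "\<dots> \<le> 2 * (4 ^ card S * b) + 2 * (4 ^ card S * b)"
    proof (rule order.trans[OF wsq_diff_le add_mono[OF mult_left_mono mult_left_mono]])
      show "wsq R \<omega> ?a \<le> 4 ^ card S * b" by (rule insert.IH[OF z1 z2])
      have "wsq R \<omega> ?b \<le> 1 * b" using B[OF z1] by simp
      also have "\<dots> \<le> 4 ^ card S * b" using B0 by (intro mult_right_mono) auto
      finally show "wsq R \<omega> ?b \<le> 4 ^ card S * b" .
    qed (auto intro!: cper_diff cper_add cper_sum cper_shift cper_Dl h k)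
    finally show ?case using insert.hyps by (simp add: mult_ac)
  qed
qed

text \<open>Says that F minus the linear function with slope \<open>grad g x\<close> is nearly
  unchanged when coordinates in S are shifted by one unit: this is the defect met when lattice
  translates are glued.\<close>

lemma wsq_gap:
  assumes y: "y \<in> cell 1"
  shows "wsq R \<omega> (\<lambda>x. F (x + (y - ind S)) - F (x + y) + (\<Sum>i\<in>S. pd i g x))
    \<le> 4 ^ CARD('n) * (4 * (4 * c) ^ CARD('n) * (4 * c ^ CARD('n) / (real N)\<^sup>2 * energy R \<omega> l f))"
proof -
  let ?B = "4 * (4 * c) ^ CARD('n) * (4 * c ^ CARD('n) / (real N)\<^sup>2 * energy R \<omega> l f)"
  have B: "?B \<ge> 0" using c_ge1 E_nonneg by simp
  have "wsq R \<omega> (\<lambda>x. F (x + (y - ind S)) - F (x + y) + (\<Sum>i\<in>S. pd i g x)) \<le> 4 ^ card S * ?B"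
    by (rule wsq_chain[OF _ _ B wsq_slow_gradient]) (use y in \<open>auto intro!: sper_cper sper_F sper_pd sper_g simp: mem_cell\<close>)
  also have "\<dots> \<le> 4 ^ CARD('n) * ?B" by (intro mult_right_mono power_increasing B card_mono) auto
  finally show ?thesis .
qed

lemma wsq_v_shift:
  assumes y: "y \<in> cell 1"
  shows "wsq R \<omega> (\<lambda>x. v j (x + (y - ind S)) - v j (x + y)) \<le> 4 ^ CARD('n) * (c * (4 * c ^ CARD('n) / (real N)\<^sup>2 * energy R \<omega> l f))"
proof -
  let ?B = "c * (4 * c ^ CARD('n) / (real N)\<^sup>2 * energy R \<omega> l f)"
  have B: "?B \<ge> 0" using c_ge1 E_nonneg by simp
  have D: "wsq R \<omega> (\<lambda>x. Dl i (v j) (x + y) - 0) \<le> ?B" if "\<And>j. \<bar>y $ j\<bar> \<le> 1" for i y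
  proof -
    have "wsq R \<omega> (\<lambda>x. Dl i (v j) (x + y)) \<le> c * wsq R \<omega> (Dl i (v j))"
      using that N_pos by (intro wsq_shift' sper_cper sper_Dl sper_v) (fastforce intro: order.trans)
    also have "\<dots> \<le> c * (4 * c ^ CARD('n) / (real N)\<^sup>2 * wsq R \<omega> (\<Phi> j))" using c_ge1 by (intro mult_left_mono wsq_Dl_v) auto
    also have "\<dots> \<le> ?B" using c_ge1 by (intro mult_left_mono wsq\<Phi>_le) auto
    finally show ?thesis by simp
  qed
  have "wsq R \<omega> (\<lambda>x. v j (x + (y - ind S)) - v j (x + y) + (\<Sum>i\<in>S. 0)) \<le> 4 ^ card S * ?B"
    by (rule wsq_chain[OF _ _ B D]) (use y in \<open>auto intro!: sper_cper sper_v simp: mem_cell\<close>)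
  also have "\<dots> \<le> 4 ^ CARD('n) * ?B" by (intro mult_right_mono power_increasing B card_mono) auto
  finally show ?thesis by simp
qed

end

section \<open>Averaging over the relative translation of the two scales\<close>

lemma integral_cell_swap:
  fixes H :: "(real^'n) \<times> (real^'n) \<Rightarrow> real"
  assumes "continuous_on UNIV H"
  shows "integral (cell r) (\<lambda>y. integral (cell R) (\<lambda>x. H (x, y))) = integral (cell R) (\<lambda>x. integral (cell r) (\<lambda>y. H (x, y)))"
  unfolding cell_def
  by (rule integral_swap_continuous[symmetric], rule continuous_on_subset[of UNIV]) (auto simp: assms split_beta)

lemma continuous_on_integral_cell:
  fixes H :: "(real^'n) \<times> (real^'n) \<Rightarrow> real"
  assumes "continuous_on UNIV H"
  shows "continuous_on A (\<lambda>x. integral (cell r) (\<lambda>y. H (x, y)))" "continuous_on A (\<lambda>y. integral (cell r) (\<lambda>x. H (x, y)))"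
proof -
  show "continuous_on A (\<lambda>x. integral (cell r) (\<lambda>y. H (x, y)))" unfolding cell_def
    by (rule integral_continuous_on_param, rule continuous_on_subset[of UNIV]) (auto simp: assms split_beta)
  show "continuous_on A (\<lambda>y. integral (cell r) (\<lambda>x. H (x, y)))" unfolding cell_def
    by (rule integral_continuous_on_param) (auto intro!: continuous_on_compose2[OF assms] continuous_intros simp: split_beta)
qed

text \<open>The unit cell has volume 1, so averaging over y changes no constant. After the exchange,
  y runs through a full fast period while the slow variable x is frozen.\<close>

lemma average_upper:
  fixes H :: "(real^'n) \<times> (real^'n) \<Rightarrow> real"
  assumes H: "continuous_on UNIV H" and k: "continuous_on (cell R) k"
    and 1: "\<And>y. y \<in> cell 1 \<Longrightarrow> a \<le> integral (cell R) (\<lambda>x. H (x, y))"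
    and 2: "\<And>x. integral (cell 1) (\<lambda>y. H (x, y)) \<le> k x"
  shows "a \<le> integral (cell R) k"
proof -
  have "a = integral (cell 1) (\<lambda>y::real^'n. a)" by (simp add: integral_cell_const)
  also have "\<dots> \<le> integral (cell 1) (\<lambda>y. integral (cell R) (\<lambda>x. H (x, y)))"
    by (intro integral_cell_mono continuous_on_integral_cell H 1) auto
  also have "\<dots> \<le> integral (cell R) k"
    unfolding integral_cell_swap[OF H] by (intro integral_cell_mono continuous_on_integral_cell H 2 k)
  finally show ?thesis .
qed

lemma average_lower:
  fixes H :: "(real^'n) \<times> (real^'n) \<Rightarrow> real"
  assumes H: "continuous_on UNIV H" and k: "continuous_on (cell R) k"
    and 1: "\<And>y. y \<in> cell 1 \<Longrightarrow> integral (cell R) (\<lambda>x. H (x, y)) \<le> a"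
    and 2: "\<And>x. k x \<le> integral (cell 1) (\<lambda>y. H (x, y))"
  shows "integral (cell R) k \<le> a"
proof -
  have "integral (cell R) k \<le> integral (cell 1) (\<lambda>y. integral (cell R) (\<lambda>x. H (x, y)))"
    unfolding integral_cell_swap[OF H] by (intro integral_cell_mono continuous_on_integral_cell H 2 k)
  also have "\<dots> \<le> integral (cell 1) (\<lambda>y::real^'n. a)"
    by (intro integral_cell_mono continuous_on_integral_cell H 1) auto
  also have "\<dots> = a" by (simp add: integral_cell_const)
  finally show ?thesis .
qed

lemma cper_comp: "cper R h \<Longrightarrow> continuous_on A f \<Longrightarrow> continuous_on A (\<lambda>p. h (f p))"
  by (rule continuous_on_compose2[OF cper_cont[of R h UNIV]]) auto

lemma young_sq:
  fixes a b \<eta> :: real assumes "\<eta> > 0"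
  shows "(a + b)\<^sup>2 \<le> (1 + \<eta>) * a\<^sup>2 + (1 + 1 / \<eta>) * b\<^sup>2"
proof -
  have "0 \<le> (\<eta> * a - b)\<^sup>2 / \<eta>" using assms by simp
  also have "\<dots> = \<eta> * a\<^sup>2 - 2 * a * b + b\<^sup>2 / \<eta>" using assms by (simp add: power2_eq_square field_simps)
  finally show ?thesis by (simp add: power2_sum algebra_simps)
qed

lemma sper_mult_nat: "sper 1 h \<Longrightarrow> sper (real m) h"
  by (simp add: sper_def periodic_R_mult_nat)

lemma cper_mult_nat: "cper 1 h \<Longrightarrow> cper (real m) h"
  by (simp add: cper_def periodic_R_mult_nat)

text \<open>R is an integer so that the fast potential is also R-periodic and the sum has an
  effective diffusivity on the large cell. The bounds a and b are all that is known of the fast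
  weight, c and N all that is known of the variation of the slow one.\<close>

locale two_scale = fast: potential 1 U + slow: potential R T + slow_weight R "ew T" c N
  for U T :: "real^'n \<Rightarrow> real" and R c :: real and N :: nat +
  fixes m :: nat and a b :: real
  assumes R_nat: "R = real m" and a_pos: "a > 0" and ew_lower: "a \<le> ew U x" and ew_upper: "ew U x \<le> b"
begin

definition UT :: "real^'n \<Rightarrow> real" where "UT x = U x + T x"

lemma ew_UT: "ew UT x = ew U x * ew T x"
  by (simp add: ew_def UT_def exp_add[symmetric] algebra_simps)

lemma U_cper_R: "cper R U" unfolding R_nat by (rule cper_mult_nat[OF fast.U_cper])

sublocale both: potential R UT
proof
  show "cper R UT" unfolding UT_def by (intro cper_add U_cper_R slow.U_cper)
qed (rule slow.R_pos')

lemma cper_ewU: "cper 1 (ew U)" by (rule fast.w_cper)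
lemma cper_ewT: "cper R (ew T)" by (rule slow.w_cper)

abbreviation "ZU \<equiv> integral (cell 1) (ew U)"
abbreviation "ZT \<equiv> integral (cell R) (ew T)"
abbreviation "ZUT \<equiv> integral (cell R) (ew UT)"

lemma cell_abs: "y \<in> cell 1 \<Longrightarrow> \<bar>y $ i\<bar> \<le> real N" for y :: "real^'n"
  using N_pos by (auto simp: mem_cell intro: order.trans)

lemma ewT_shift: assumes "y \<in> cell 1" shows "ew T x \<le> c * ew T (x + y)" "ew T (x + y) \<le> c * ew T x"
proof -
  show "ew T x \<le> c * ew T (x + y)" using cell_abs[OF assms] by (rule slow)
  show "ew T (x + y) \<le> c * ew T x" using slow[of "- y" "x + y"] cell_abs[OF assms] by simp
qed

lemma integral_fast: "integral (cell 1) (\<lambda>y. h (x + y)) = integral (cell 1) h" if "cper 1 h" for h :: "real^'n \<Rightarrow> real"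
  using integral_cell_shift[OF that, of x] by (simp add: add.commute)

lemma cont_UT: "continuous_on A (\<lambda>p. ew U (fst p + snd p) * ew T (fst p))"
  by (intro continuous_on_mult cper_comp[OF cper_ewU] cper_comp[OF cper_ewT] continuous_intros)

lemma ewUT_shift_integral:
  assumes h: "cper R h"
  shows "integral (cell R) (\<lambda>x. h (x + y) * (ew U (x + y) * ew T (x + y))) = integral (cell R) (\<lambda>x. h x * ew UT x)"
  using integral_cell_shift[OF cper_mult[OF h both.w_cper] slow.R_pos', of y] by (simp add: ew_UT)

text \<open>The mass of the combined weight is unchanged by translating both factors by y. Replacing
  the slow factor at x + y by its value at x costs c, and the integral over y then
  factorises.\<close>

lemma ZUT_bounds: "ZUT \<le> c * (ZU * ZT)" "ZU * ZT \<le> c * ZUT"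
proof -
  have i: "integral (cell 1) (\<lambda>y. ew U (x + y) * ew T x) = ew T x * ZU" for x
    using integral_fast[OF cper_ewU, of x] by (simp add: mult.commute)
  have eq: "ZUT = integral (cell R) (\<lambda>x. ew U (x + y) * ew T (x + y))" for y
    using ewUT_shift_integral[of "\<lambda>x. 1" y] by simp
  have "ZUT \<le> integral (cell R) (\<lambda>x. c * (ew T x * ZU))"
  proof (rule average_upper[where H="\<lambda>p. c * (ew U (fst p + snd p) * ew T (fst p))"])
    fix y :: "real^'n" assume y: "y \<in> cell 1"
    show "ZUT \<le> integral (cell R) (\<lambda>x. c * (ew U (fst (x, y) + snd (x, y)) * ew T (fst (x, y))))"
      unfolding eq[of y] fst_conv snd_conv
      using ewT_shift(2)[OF y] fast.w_pos
      by (intro integral_cell_mono) (auto intro!: continuous_intros cper_comp[OF cper_ewU] cper_comp[OF cper_ewT] simp: less_imp_le mult.left_commute[of c])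
  next
    show "integral (cell 1) (\<lambda>y. c * (ew U (fst (x, y) + snd (x, y)) * ew T (fst (x, y)))) \<le> c * (ew T x * ZU)" for x
      unfolding fst_conv snd_conv integral_cell_cmult i ..
  qed (intro continuous_on_mult_left cont_UT continuous_on_mult_right slow.w_cont)+
  then show "ZUT \<le> c * (ZU * ZT)" by (simp add: mult.commute)
  have "integral (cell R) (\<lambda>x. ew T x * ZU) \<le> c * ZUT"
  proof (rule average_lower[where H="\<lambda>p. ew U (fst p + snd p) * ew T (fst p)"])
    fix y :: "real^'n" assume y: "y \<in> cell 1"
    have "integral (cell R) (\<lambda>x. ew U (x + y) * ew T x) \<le> integral (cell R) (\<lambda>x. c * (ew U (x + y) * ew T (x + y)))"
      using ewT_shift(1)[OF y] fast.w_pos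
      by (intro integral_cell_mono) (auto intro!: continuous_intros cper_comp[OF cper_ewU] cper_comp[OF cper_ewT] simp: less_imp_le mult.left_commute[of c])
    then show "integral (cell R) (\<lambda>x. ew U (fst (x, y) + snd (x, y)) * ew T (fst (x, y))) \<le> c * ZUT"
      unfolding eq[of y] fst_conv snd_conv by simp
  next
    show "ew T x * ZU \<le> integral (cell 1) (\<lambda>y. ew U (fst (x, y) + snd (x, y)) * ew T (fst (x, y)))" for x
      unfolding fst_conv snd_conv i ..
  qed (intro cont_UT continuous_on_mult_right slow.w_cont)+
  then show "ZU * ZT \<le> c * ZUT" by (simp add: mult.commute)
qed

text \<open>Testing with G translated by -y and changing variables puts the fast weight at x + y
  while G stays at x. The slow weight moves along and is brought back to x at the cost of c.\<close>

lemma translated_test_function: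
  assumes G: "sper R G" and y: "y \<in> cell 1"
  shows "eff_quad R UT l * ZUT \<le> c * integral (cell R) (\<lambda>x. (norm (l - grad G x))\<^sup>2 * (ew U (x + y) * ew T x))"
proof -
  have gr: "grad (\<lambda>x. G (x + - y)) = (\<lambda>x. grad G (x + - y))"
    using pd_shift[OF sper_smooth[OF G], of _ "- y"] by (simp add: fun_eq_iff vec_eq_iff)
  have n: "cper R (\<lambda>x. (norm (l - grad G x))\<^sup>2)"
    unfolding norm_sq_sum using G by (intro cper_sum cper_power sper_cper[of R]) (simp add: sper_diff sper_pd)
  have "eff_quad R UT l * ZUT \<le> energy R (ew UT) l (\<lambda>x. G (x + - y))"
    by (rule both.q_le[OF sper_shift[OF G]])
  also have "\<dots> = integral (cell R) (\<lambda>x. (norm (l - grad G x))\<^sup>2 * (ew U (x + y) * ew T (x + y)))"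
    unfolding energy_def gr using ewUT_shift_integral[OF cper_shift[OF n, of "- y"], of y] by simp
  also have "\<dots> \<le> integral (cell R) (\<lambda>x. c * ((norm (l - grad G x))\<^sup>2 * (ew U (x + y) * ew T x)))"
  proof (rule integral_cell_mono)
    fix x
    have "(norm (l - grad G x))\<^sup>2 * ew U (x + y) * ew T (x + y) \<le> (norm (l - grad G x))\<^sup>2 * ew U (x + y) * (c * ew T x)"
      using fast.w_pos[of "x + y"] by (intro mult_left_mono ewT_shift y) auto
    then show "(norm (l - grad G x))\<^sup>2 * (ew U (x + y) * ew T (x + y)) \<le> c * ((norm (l - grad G x))\<^sup>2 * (ew U (x + y) * ew T x))"
      by (simp add: mult_ac)
  qed (auto intro!: continuous_intros cper_comp[OF cper_ewU] cper_comp[OF cper_ewT] cper_comp[OF n])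
  finally show ?thesis by simp
qed

lemma b_pos: "b > 0" using a_pos ew_lower[of 0] ew_upper[of 0] by linarith

text \<open>Subtracting the average over unit segments leaves the gradient of a 1-periodic function unchanged,
  because that gradient averages to a unit lattice difference; this replaces a Poincare inequality.\<close>

lemma corrector_L2:
  assumes h: "sper 1 h" and energy: "energy 1 (ew U) (axis i 1) h \<le> 3 * ZU"
  obtains k where "sper 1 k" "\<And>j. pd j k = pd j h" "wsq 1 (ew U) k \<le> b / a * (4 ^ CARD('n) * (8 * ZU))"
proof -
  \<comment> \<open>For the constant weight the loss c is 1; passing from the fast weight to this
    one and back produces b / a.\<close>
  interpret one: slow_weight 1 "\<lambda>x::real^'n. 1" 1 1
    by unfold_locales auto
  define k where "k = (\<lambda>x. h x - Avs coords h x)"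
  have k: "sper 1 k" unfolding k_def by (intro sper_diff h sper_Avs)
  have pd0: "pd j (Avs coords h) = (\<lambda>x. 0)" for j
  proof -
    have "Dl j h = (\<lambda>x. 0)" using h by (auto simp: Dl_def sper_def periodic_R_def)
    then show ?thesis using pd_Avs_mem[OF set_coords h, of j] by simp
  qed
  have "wsq 1 (ew U) k \<le> b * wsq 1 (\<lambda>x. 1) k"
  proof -
    have "wsq 1 (ew U) k \<le> integral (cell 1) (\<lambda>x. b * ((k x)\<^sup>2 * 1))"
      unfolding wsq_def using ew_upper
      by (intro integral_cell_mono fast.wsq_integrand sper_cper[OF k] continuous_on_mult_left one.wsq_integrand)
        (simp add: mult.commute[of b] mult_left_mono)
    then show ?thesis by (simp add: wsq_def)
  qed
  also have "wsq 1 (\<lambda>x. 1) k = wsq 1 (\<lambda>x. 1) (\<lambda>x. Avs coords h x - h x)"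
    unfolding k_def wsq_def by (simp add: power2_commute)
  also have "\<dots> \<le> 4 ^ CARD('n) * one.grad_wsq h" using one.wsq_Avs_diff[OF h, of coords] by simp
  also have "one.grad_wsq h \<le> (1 / a) * (8 * ZU)"
  proof -
    have "one.grad_wsq h \<le> (\<Sum>j\<in>UNIV. (1 / a) * wsq 1 (ew U) (pd j h))"
      unfolding one.grad_wsq_def
    proof (rule sum_mono)
      fix j
      have "wsq 1 (\<lambda>x. 1) (pd j h) \<le> integral (cell 1) (\<lambda>x. (1 / a) * ((pd j h x)\<^sup>2 * ew U x))"
        unfolding wsq_def
      proof (rule integral_cell_mono)
        fix x
        have "(pd j h x)\<^sup>2 * a \<le> (pd j h x)\<^sup>2 * ew U x" by (intro mult_left_mono ew_lower) auto
        then show "(pd j h x)\<^sup>2 * 1 \<le> (1 / a) * ((pd j h x)\<^sup>2 * ew U x)" using a_pos by (simp add: field_simps)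
      qed (intro one.wsq_integrand continuous_on_mult_left fast.wsq_integrand sper_cper[OF sper_pd[OF h]])+
      then show "wsq 1 (\<lambda>x. 1) (pd j h) \<le> (1 / a) * wsq 1 (ew U) (pd j h)" by (simp add: wsq_def)
    qed
    also have "\<dots> = (1 / a) * (\<Sum>j\<in>UNIV. wsq 1 (ew U) (pd j h))" by (simp add: sum_distrib_left)
    also have "(\<Sum>j\<in>UNIV. wsq 1 (ew U) (pd j h)) \<le> (\<Sum>j\<in>UNIV. 2 * wsq 1 (ew U) (\<lambda>x. axis i 1 $ j) + 2 * wsq 1 (ew U) (\<lambda>x. axis i 1 $ j - pd j h x))"
    proof (rule sum_mono)
      fix j
      have "wsq 1 (ew U) (\<lambda>x. axis i 1 $ j - (axis i 1 $ j - pd j h x)) \<le> 2 * wsq 1 (ew U) (\<lambda>x. axis i 1 $ j) + 2 * wsq 1 (ew U) (\<lambda>x. axis i 1 $ j - pd j h x)"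
        by (intro fast.wsq_diff_le cper_const cper_diff sper_cper[OF sper_pd[OF h]])
      then show "wsq 1 (ew U) (pd j h) \<le> 2 * wsq 1 (ew U) (\<lambda>x. axis i 1 $ j) + 2 * wsq 1 (ew U) (\<lambda>x. axis i 1 $ j - pd j h x)" by simp
    qed
    also have "\<dots> = 2 * (\<Sum>j\<in>UNIV. (axis i 1 $ j)\<^sup>2) * ZU + 2 * energy 1 (ew U) (axis i 1) h"
      unfolding fast.energy_sum[OF h] by (simp add: sum.distrib sum_distrib_left sum_distrib_right wsq_def mult.assoc)
    also have "(\<Sum>j\<in>UNIV. ((axis i 1 :: real^'n) $ j)\<^sup>2) = 1"
      using norm_sq_sum[of "axis i 1 :: real^'n"] by simp
    also have "2 * 1 * ZU + 2 * energy 1 (ew U) (axis i 1) h \<le> 8 * ZU" using energy by simp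
    finally show ?thesis using a_pos by (simp add: mult_left_mono divide_right_mono)
  qed
  finally have "wsq 1 (ew U) k \<le> b * (4 ^ CARD('n) * (1 / a * (8 * ZU)))" using b_pos by simp
  then have "wsq 1 (ew U) k \<le> b / a * (4 ^ CARD('n) * (8 * ZU))" by (simp add: field_simps)
  moreover have "pd j k = pd j h" for j
    unfolding k_def using pd0 by (simp add: pd_diff sper_smooth[OF h] sper_smooth[OF sper_Avs[OF h]])
  ultimately show ?thesis using that k by blast
qed

end

lemma norm_add_young:
  fixes x y :: "real^'n" assumes "\<eta> > 0"
  shows "(norm (x + y))\<^sup>2 \<le> (1 + \<eta>) * (norm x)\<^sup>2 + (1 + 1 / \<eta>) * (norm y)\<^sup>2"
proof -
  have "(norm (x + y))\<^sup>2 \<le> (norm x + norm y)\<^sup>2" by (intro power_mono norm_triangle_ineq) simp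
  with young_sq[OF assms, of "norm x" "norm y"] show ?thesis by linarith
qed

context two_scale
begin

text \<open>The gradient of the test function has a main part, with the direction frozen at x, and
  an error part consisting of correctors times the Hessian of g. Integrating over y turns the main
  part into the energy of a near-minimiser in direction \<open>\<Xi> x\<close>, and the error into
  the L2 norm of the correctors times that of the Hessian.\<close>

lemma upper_energy:
  assumes f: "sper R f" and \<kappa>: "0 < \<kappa>" "\<kappa> \<le> 1" and \<eta>: "\<eta> > 0"
  shows "eff_quad R UT l * ZUT \<le> c * ZU * ((1 + \<eta>) * (lam_max (eff_diff 1 U) + \<kappa>) * c ^ (2 * CARD('n)) +
    (1 + 1 / \<eta>) * (real CARD('n) * (b / a * (4 ^ CARD('n) * 8))) * (real CARD('n) * (c ^ CARD('n) * (4 * c ^ CARD('n) / (real N)\<^sup>2)))) * energy R (ew T) l f"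
proof -
  interpret A: slow_approx R "ew T" c N f l by unfold_locales (rule f)
  let ?L = "lam_max (eff_diff 1 U)"
  obtain h where h: "\<And>i. sper 1 (h i)"
    and hJ: "\<And>\<xi>. energy 1 (ew U) \<xi> (\<lambda>x. \<Sum>i\<in>UNIV. \<xi> $ i * h i x) \<le> ZU * (eff_quad 1 U \<xi> + \<kappa> * (norm \<xi>)\<^sup>2)"
    by (rule fast.simultaneous_near_minimizers[OF \<kappa>(1)]) (rule that)
  have "\<exists>k. sper 1 k \<and> (\<forall>j. pd j k = pd j (h i)) \<and> wsq 1 (ew U) k \<le> b / a * (4 ^ CARD('n) * (8 * ZU))" for i
  proof -
    have "(\<lambda>x. \<Sum>j\<in>UNIV. axis i 1 $ j * h j x) = h i" by (simp add: fun_eq_iff sum_axis_mult)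
    then have "energy 1 (ew U) (axis i 1) (h i) \<le> ZU * (eff_quad 1 U (axis i 1) + \<kappa> * 1)"
      using hJ[of "axis i 1"] by simp
    \<comment> \<open>On a unit vector \<open>q\<close> is at most 1, and so is \<kappa>.\<close>
    also have "\<dots> \<le> ZU * 3"
      using fast.q_le_norm[of "axis i 1"] \<kappa> fast.Z_pos by (intro mult_left_mono) auto
    finally show ?thesis using corrector_L2[OF h, of i i] by (metis mult.commute)
  qed
  then obtain k where k: "\<And>i. sper 1 (k i)" and kpd: "\<And>i j. pd j (k i) = pd j (h i)"
    and kQ: "\<And>i. wsq 1 (ew U) (k i) \<le> b / a * (4 ^ CARD('n) * (8 * ZU))"
    by metis
  define \<Xi> :: "real^'n \<Rightarrow> real^'n" where "\<Xi> x = (\<chi> i. A.\<xi> i x)" for x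
  define D where "D x = (\<Sum>i\<in>UNIV. \<Sum>j\<in>UNIV. (pd j (A.\<xi> i) x)\<^sup>2)" for x
  define S where "S z = (\<Sum>i\<in>UNIV. (k i z)\<^sup>2)" for z
  define W where "W x z = (\<Sum>j\<in>UNIV. (A.\<xi> j x - (\<Sum>i\<in>UNIV. A.\<xi> i x * pd j (h i) z))\<^sup>2)" for x z
  define H where "H p = (1 + \<eta>) * (W (fst p) (fst p + snd p) * ew U (fst p + snd p) * ew T (fst p))
     + (1 + 1 / \<eta>) * (D (fst p) * ew T (fst p) * (S (fst p + snd p) * ew U (fst p + snd p)))" for p
  define X where "X = real CARD('n) * (b / a * (4 ^ CARD('n) * 8)) * ZU"
  define Kf where "Kf x = (1 + \<eta>) * (ZU * (?L + \<kappa>)) * (\<Sum>j\<in>UNIV. (A.\<xi> j x)\<^sup>2 * ew T x) + (1 + 1 / \<eta>) * X * (D x * ew T x)" for x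
  have cS: "cper 1 S" unfolding S_def by (intro cper_sum cper_power sper_cper k)
  have cD: "cper R D" unfolding D_def by (intro cper_sum cper_power sper_cper sper_pd A.sper_\<xi>)
  have cW: "continuous_on UNIV (\<lambda>p. W (fst p) (fst p + snd p))" unfolding W_def
    by (intro continuous_intros cper_comp[OF sper_cper[OF A.sper_\<xi>]] cper_comp[OF sper_cper[OF sper_pd[OF h]]])
  have "eff_quad R UT l * ZUT \<le> integral (cell R) (\<lambda>x. c * Kf x)"
  proof (rule average_upper[where H="\<lambda>p. c * H p"])
    show "continuous_on UNIV (\<lambda>p. c * H p)" unfolding H_def
      by (intro continuous_intros cW cper_comp[OF cS] cper_comp[OF cD] cper_comp[OF cper_ewU] cper_comp[OF cper_ewT])
    show "continuous_on (cell R) (\<lambda>x. c * Kf x)" unfolding Kf_def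
      by (intro continuous_intros cper_cont[OF cD] slow.w_cont cper_cont[OF sper_cper[OF A.sper_\<xi>]])
  next
    fix y :: "real^'n" assume y: "y \<in> cell 1"
    \<comment> \<open>The correctors enter as \<open>k i\<close>, which share their gradients with
      \<open>h i\<close> but have a controlled L2 norm.\<close>
    define G where "G x = A.g x + (\<Sum>i\<in>UNIV. k i (x + y) * A.\<xi> i x)" for x
    have ky: "sper R (\<lambda>x. k i (x + y))" for i
      unfolding R_nat by (intro sper_mult_nat sper_shift k)
    have G: "sper R G" unfolding G_def by (intro sper_add A.sper_g sper_sum sper_mult ky A.sper_\<xi>)
    have pdG: "pd j G x = pd j A.g x + (\<Sum>i\<in>UNIV. pd j (h i) (x + y) * A.\<xi> i x + k i (x + y) * pd j (A.\<xi> i) x)" for j x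
    proof -
      note sm = sper_smooth[OF ky] sper_smooth[OF A.sper_\<xi>]
      have "pd j G x = pd j A.g x + (\<Sum>i\<in>UNIV. pd j (\<lambda>x. k i (x + y) * A.\<xi> i x) x)"
        unfolding G_def by (subst pd_add pd_sum; (intro sper_smooth[OF A.sper_g] smooth_fun_sum smooth_fun_mult sm)?; simp)+
      then show ?thesis by (simp add: pd_mult[OF sm] pd_shift[OF sper_smooth[OF k]] kpd)
    qed
    have pt: "(norm (l - grad G x))\<^sup>2 \<le> (1 + \<eta>) * W x (x + y) + (1 + 1 / \<eta>) * (D x * S (x + y))" for x
    proof -
      define u :: "real^'n" where "u = (\<chi> j. A.\<xi> j x - (\<Sum>i\<in>UNIV. A.\<xi> i x * pd j (h i) (x + y)))"
      define v :: "real^'n" where "v = (\<chi> j. - (\<Sum>i\<in>UNIV. k i (x + y) * pd j (A.\<xi> i) x))"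
      have "l - grad G x = u + v"
        by (simp add: vec_eq_iff u_def v_def pdG A.\<xi>_def sum.distrib mult.commute)
      then have "(norm (l - grad G x))\<^sup>2 \<le> (1 + \<eta>) * (norm u)\<^sup>2 + (1 + 1 / \<eta>) * (norm v)\<^sup>2"
        using norm_add_young[OF \<eta>] by simp
      moreover have "(norm u)\<^sup>2 = W x (x + y)" by (simp add: norm_sq_sum u_def W_def)
      moreover have "(norm v)\<^sup>2 \<le> D x * S (x + y)"
      proof -
        have "(norm v)\<^sup>2 = (\<Sum>j\<in>UNIV. (\<Sum>i\<in>UNIV. k i (x + y) * pd j (A.\<xi> i) x)\<^sup>2)"
          by (simp add: norm_sq_sum v_def)
        also have "\<dots> \<le> (\<Sum>j\<in>UNIV. S (x + y) * (\<Sum>i\<in>UNIV. (pd j (A.\<xi> i) x)\<^sup>2))"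
          unfolding S_def by (intro sum_mono Cauchy_Schwarz_ineq_sum)
        also have "\<dots> = D x * S (x + y)"
        proof -
          have "D x = (\<Sum>j\<in>UNIV. \<Sum>i\<in>UNIV. (pd j (A.\<xi> i) x)\<^sup>2)" unfolding D_def by (rule sum.swap)
          then show ?thesis by (simp only: sum_distrib_left mult.commute)
        qed
        finally show ?thesis .
      qed
      moreover have "0 < 1 + 1 / \<eta>" using \<eta> by (simp add: add_pos_pos)
      ultimately show ?thesis by (smt (verit, best) mult_left_mono)
    qed
    have "eff_quad R UT l * ZUT \<le> c * integral (cell R) (\<lambda>x. (norm (l - grad G x))\<^sup>2 * (ew U (x + y) * ew T x))"
      by (rule translated_test_function[OF G y])
    also have "\<dots> \<le> c * integral (cell R) (\<lambda>x. H (x, y))"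
    proof (intro mult_left_mono integral_cell_mono)
      fix x
      have "0 \<le> ew U (x + y) * ew T x" using fast.w_pos[of "x + y"] slow.w_pos[of x] by simp
      from mult_right_mono[OF pt this]
      show "(norm (l - grad G x))\<^sup>2 * (ew U (x + y) * ew T x) \<le> H (x, y)" unfolding H_def by (simp add: algebra_simps)
    next
      show "continuous_on (cell R) (\<lambda>x. H (x, y))" unfolding H_def W_def fst_conv snd_conv
        by (intro continuous_intros cper_comp[OF cS] cper_comp[OF cD] cper_comp[OF cper_ewU] cper_comp[OF cper_ewT]
          cper_comp[OF sper_cper[OF A.sper_\<xi>]] cper_comp[OF sper_cper[OF sper_pd[OF h]]])
      show "continuous_on (cell R) (\<lambda>x. (norm (l - grad G x))\<^sup>2 * (ew U (x + y) * ew T x))"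
        by (intro continuous_intros cper_comp[OF cper_ewU] cper_comp[OF cper_ewT] continuous_on_grad sper_smooth[OF G])
    qed (use c_ge1 in auto)
    finally show "eff_quad R UT l * ZUT \<le> integral (cell R) (\<lambda>x. c * H (x, y))" by simp
  next
    fix x
    \<comment> \<open>For fixed x, \<open>W x\<close> is the energy density of the near-minimiser in
      direction \<open>\<Xi> x\<close>; a full period in y removes the shift by x.\<close>
    have W: "integral (cell 1) (\<lambda>y. W x (x + y) * ew U (x + y)) \<le> ZU * ((?L + \<kappa>) * (norm (\<Xi> x))\<^sup>2)"
    proof -
      have cWx: "cper 1 (W x)" unfolding W_def
        by (intro cper_sum cper_power cper_diff cper_const cper_mult sper_cper sper_pd h)
      have "W x z = (norm (\<Xi> x - grad (\<lambda>z. \<Sum>i\<in>UNIV. \<Xi> x $ i * h i z) z))\<^sup>2" for z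
        unfolding norm_sq_sum W_def by (simp add: grad_sum[OF finite sper_smooth[OF h]] \<Xi>_def)
      then have "integral (cell 1) (\<lambda>y. W x (x + y) * ew U (x + y)) = energy 1 (ew U) (\<Xi> x) (\<lambda>z. \<Sum>i\<in>UNIV. \<Xi> x $ i * h i z)"
        using integral_fast[OF cper_mult[OF cWx cper_ewU], of x] by (simp add: energy_def)
      also have "\<dots> \<le> ZU * (eff_quad 1 U (\<Xi> x) + \<kappa> * (norm (\<Xi> x))\<^sup>2)" by (rule hJ)
      also have "\<dots> \<le> ZU * ((?L + \<kappa>) * (norm (\<Xi> x))\<^sup>2)"
        using fast.q_le_lam_max[of "\<Xi> x"] fast.Z_pos by (intro mult_left_mono) (auto simp: algebra_simps)
      finally show ?thesis .
    qed
    have S: "integral (cell 1) (\<lambda>y. S (x + y) * ew U (x + y)) \<le> X"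
    proof -
      have "integral (cell 1) (\<lambda>y. S (x + y) * ew U (x + y)) = integral (cell 1) (\<lambda>y. \<Sum>i\<in>UNIV. (k i y)\<^sup>2 * ew U y)"
        using integral_fast[OF cper_mult[OF cS cper_ewU], of x] by (simp add: S_def sum_distrib_right)
      also have "\<dots> = (\<Sum>i\<in>UNIV. wsq 1 (ew U) (k i))"
        unfolding wsq_def by (intro integral_cell_sum fast.wsq_integrand sper_cper k) auto
      also have "\<dots> \<le> (\<Sum>i\<in>(UNIV::'n set). b / a * (4 ^ CARD('n) * (8 * ZU)))" by (intro sum_mono kQ)
      also have "\<dots> = X" by (simp add: X_def)
      finally show ?thesis .
    qed
    have c1: "continuous_on (cell 1) (\<lambda>y. W x (x + y) * ew U (x + y) * ew T x)" unfolding W_def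
      by (intro continuous_intros cper_comp[OF cper_ewU] cper_comp[OF sper_cper[OF sper_pd[OF h]]])
    have c2: "continuous_on (cell 1) (\<lambda>y. D x * ew T x * (S (x + y) * ew U (x + y)))"
      by (intro continuous_intros cper_comp[OF cper_ewU] cper_comp[OF cS])
    have "integral (cell 1) (\<lambda>y. H (x, y)) = (1 + \<eta>) * (integral (cell 1) (\<lambda>y. W x (x + y) * ew U (x + y)) * ew T x)
        + (1 + 1 / \<eta>) * (D x * ew T x * integral (cell 1) (\<lambda>y. S (x + y) * ew U (x + y)))"
      unfolding H_def fst_conv snd_conv
      by (subst integral_cell_add[OF continuous_on_mult_left[OF c1] continuous_on_mult_left[OF c2]]) simp
    also have "\<dots> \<le> (1 + \<eta>) * (ZU * ((?L + \<kappa>) * (norm (\<Xi> x))\<^sup>2) * ew T x) + (1 + 1 / \<eta>) * (D x * ew T x * X)"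
    proof -
      have "0 \<le> D x" unfolding D_def by (intro sum_nonneg) simp
      then show ?thesis using W S \<eta> slow.w_pos[of x]
        by (intro add_mono mult_left_mono mult_right_mono) (auto simp: less_imp_le)
    qed
    also have "\<dots> = Kf x" unfolding Kf_def norm_sq_sum by (simp add: \<Xi>_def sum_distrib_left sum_distrib_right mult_ac)
    finally show "integral (cell 1) (\<lambda>y. c * H (x, y)) \<le> c * Kf x" using c_ge1 by simp
  qed
  also have "\<dots> = c * ((1 + \<eta>) * (ZU * (?L + \<kappa>)) * (\<Sum>j\<in>UNIV. wsq R (ew T) (A.\<xi> j)) + (1 + 1 / \<eta>) * X * (\<Sum>i\<in>UNIV. \<Sum>j\<in>UNIV. wsq R (ew T) (pd j (A.\<xi> i))))"
  proof -
    have e1: "integral (cell R) (\<lambda>x. \<Sum>j\<in>UNIV. (A.\<xi> j x)\<^sup>2 * ew T x) = (\<Sum>j\<in>UNIV. wsq R (ew T) (A.\<xi> j))"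
      unfolding wsq_def by (intro integral_cell_sum slow.wsq_integrand sper_cper A.sper_\<xi>) auto
    have "integral (cell R) (\<lambda>x. D x * ew T x) = integral (cell R) (\<lambda>x. \<Sum>i\<in>UNIV. \<Sum>j\<in>UNIV. (pd j (A.\<xi> i) x)\<^sup>2 * ew T x)"
      by (simp add: D_def sum_distrib_right)
    also have "\<dots> = (\<Sum>i\<in>UNIV. \<Sum>j\<in>UNIV. wsq R (ew T) (pd j (A.\<xi> i)))" unfolding wsq_def
      by (subst integral_cell_sum; (intro continuous_on_sum slow.wsq_integrand sper_cper sper_pd A.sper_\<xi>)?; simp?)
         (intro sum.cong refl integral_cell_sum finite slow.wsq_integrand sper_cper sper_pd A.sper_\<xi>)
    finally have e2: "integral (cell R) (\<lambda>x. D x * ew T x) = (\<Sum>i\<in>UNIV. \<Sum>j\<in>UNIV. wsq R (ew T) (pd j (A.\<xi> i)))" .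
    have c1: "continuous_on (cell R) (\<lambda>x. \<Sum>j\<in>UNIV. (A.\<xi> j x)\<^sup>2 * ew T x)"
      by (intro continuous_on_sum slow.wsq_integrand sper_cper A.sper_\<xi>)
    have c2: "continuous_on (cell R) (\<lambda>x. D x * ew T x)" by (intro continuous_on_mult cper_cont[OF cD] slow.w_cont)
    have "integral (cell R) Kf = (1 + \<eta>) * (ZU * (?L + \<kappa>)) * (\<Sum>j\<in>UNIV. wsq R (ew T) (A.\<xi> j)) + (1 + 1 / \<eta>) * X * (\<Sum>i\<in>UNIV. \<Sum>j\<in>UNIV. wsq R (ew T) (pd j (A.\<xi> i)))"
      unfolding Kf_def e1[symmetric] e2[symmetric]
      by (subst integral_cell_add[OF continuous_on_mult_left[OF c1] continuous_on_mult_left[OF c2]]) simp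
    then show ?thesis by simp
  qed
  also have "\<dots> \<le> c * ((1 + \<eta>) * (ZU * (?L + \<kappa>)) * (c ^ (2 * CARD('n)) * energy R (ew T) l f) +
     (1 + 1 / \<eta>) * X * (real CARD('n) * (c ^ CARD('n) * (4 * c ^ CARD('n) / (real N)\<^sup>2)) * energy R (ew T) l f))"
  proof (intro mult_left_mono add_mono)
    show "(\<Sum>j\<in>UNIV. wsq R (ew T) (A.\<xi> j)) \<le> c ^ (2 * CARD('n)) * energy R (ew T) l f"
      unfolding A.E_eq sum_distrib_left by (intro sum_mono A.wsq_\<xi>)
    have "(\<Sum>i\<in>UNIV. \<Sum>j\<in>UNIV. wsq R (ew T) (pd j (A.\<xi> i))) \<le> (\<Sum>i\<in>(UNIV::'n set). \<Sum>j\<in>UNIV. c ^ CARD('n) * (4 * c ^ CARD('n) / (real N)\<^sup>2) * wsq R (ew T) (A.\<Phi> j))"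
      by (intro sum_mono A.wsq_pd_\<xi>)
    also have "\<dots> = real CARD('n) * (c ^ CARD('n) * (4 * c ^ CARD('n) / (real N)\<^sup>2)) * energy R (ew T) l f"
    proof -
      have "(\<Sum>i\<in>(UNIV::'n set). \<Sum>j\<in>UNIV. K * wsq R (ew T) (A.\<Phi> j)) = real CARD('n) * K * (\<Sum>j\<in>UNIV. wsq R (ew T) (A.\<Phi> j))" for K
        by (simp add: sum_distrib_left[symmetric])
      then show ?thesis unfolding A.E_eq .
    qed
    finally show "(\<Sum>i\<in>UNIV. \<Sum>j\<in>UNIV. wsq R (ew T) (pd j (A.\<xi> i))) \<le> real CARD('n) * (c ^ CARD('n) * (4 * c ^ CARD('n) / (real N)\<^sup>2)) * energy R (ew T) l f" .
    have "0 \<le> eff_quad 1 U (axis undefined 1)" by (rule fast.q_nonneg)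
    also have "\<dots> \<le> ?L" using fast.q_le_lam_max[of "axis undefined 1"] by simp
    finally show "0 \<le> (1 + \<eta>) * (ZU * (?L + \<kappa>))" using \<eta> \<kappa> fast.Z_pos by simp
    show "0 \<le> (1 + 1 / \<eta>) * X" using \<eta> a_pos b_pos fast.Z_pos by (simp add: X_def)
  qed (use c_ge1 in auto)
  finally show ?thesis by (simp add: X_def algebra_simps)
qed

end

lemma smooth_fun_linear: "smooth_fun (\<lambda>z::real^'n. \<Sum>i\<in>UNIV. z $ i * a i)"
  by (intro smooth_fun_sum smooth_fun_mult smooth_fun_nth smooth_fun_const)

lemma pd_linear: "pd j (\<lambda>z::real^'n. \<Sum>i\<in>UNIV. z $ i * a i) = (\<lambda>z. a j)"
proof -
  have "pd j (\<lambda>z::real^'n. \<Sum>i\<in>UNIV. z $ i * a i) = (\<lambda>z. \<Sum>i\<in>UNIV. (if j = i then 1 else 0) * a i)"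
    by (subst pd_sum) (auto simp: pd_mult smooth_fun_mult pd_nth fun_eq_iff)
  also have "\<dots> = (\<lambda>z. \<Sum>i\<in>UNIV. if j = i then a i else 0)" by (intro ext sum.cong) auto
  finally show ?thesis by simp
qed

context two_scale
begin

text \<open>At fixed x, the integral over y of the gluing's energy density dominates the quadratic
  form of D(U). At fixed y, the integral over x of its main term and errors is bounded by the energy
  of f. \<open>average_lower\<close> joins the two orders of integration.\<close>

lemma lower_energy:
  assumes f: "sper R f" and \<eta>: "\<eta> > 0"
    and \<Theta>: "\<And>z. \<bar>theta (z :: real^'n)\<bar> \<le> \<Theta>" "\<And>j z. \<bar>pd j theta (z :: real^'n)\<bar> \<le> \<Theta>"
  shows "ZU * lam_min (eff_diff 1 U) * (eff_quad R T l * ZT) \<le>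
    ((1 + \<eta>) * (c * c ^ CARD('n)) +
     (1 + 1 / \<eta>) * (2 * 2 ^ CARD('n) * \<Theta>\<^sup>2) * (b / a) * (real CARD('n) * (2 ^ CARD('n) *
       (4 ^ CARD('n) * (c * (4 * c ^ CARD('n) / (real N)\<^sup>2)) + 4 ^ CARD('n) * (4 * (4 * c) ^ CARD('n) * (4 * c ^ CARD('n) / (real N)\<^sup>2)))))) *
    energy R (ew UT) l f"
proof -
  interpret A: slow_approx R "ew T" c N f l by unfold_locales (rule f)
  let ?L = "lam_min (eff_diff 1 U)"
  define K where "K = 2 * 2 ^ CARD('n) * \<Theta>\<^sup>2"
  have K0: "K \<ge> 0" by (simp add: K_def)
  define \<Xi> :: "real^'n \<Rightarrow> real^'n" where "\<Xi> x = (\<chi> i. A.\<xi> i x)" for x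
  define dv where "dv j S y x = A.v j (x + (y - ind S)) - A.v j (x + y)" for j S y x
  define gap where "gap S y x = A.F (x + (y - ind S)) - A.F (x + y) + (\<Sum>i\<in>S. pd i A.g x)" for S y x
  \<comment> \<open>By the product rule a gluing error involves the cutoff times the defect
    \<open>dv\<close> of the gradient, or the derivative of the cutoff times the defect
    \<open>gap\<close> of the function; both are collected over the 2^d translates.\<close>
  define RR where "RR j p = (\<Sum>S\<in>UNIV. (dv j S (snd p) (fst p))\<^sup>2 + (gap S (snd p) (fst p))\<^sup>2)" for j p
  define H where "H p = (\<Sum>j\<in>UNIV. (1 + \<eta>) * ((A.v j (fst p + snd p))\<^sup>2 * (ew U (fst p + snd p) * ew T (fst p)))
    + (1 + 1 / \<eta>) * K * (RR j p * (ew U (fst p + snd p) * ew T (fst p))))" for p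
  have cv: "cper R (A.v j)" for j by (rule sper_cper[OF A.sper_v])
  have cF: "cper R A.F" by (rule sper_cper[OF A.sper_F])
  have cg: "cper R (pd i A.g)" for i by (rule sper_cper[OF sper_pd[OF A.sper_g]])
  have cRR: "continuous_on UNIV (RR j)" for j unfolding RR_def dv_def gap_def
    by (intro continuous_intros cper_comp[OF cv] cper_comp[OF cF] cper_comp[OF cg])
  have cH: "continuous_on UNIV H" unfolding H_def
    by (intro continuous_intros cRR cper_comp[OF cv] cper_comp[OF cper_ewU] cper_comp[OF cper_ewT])
  have B1: "wsq R (ew T) (dv j S y) \<le> 4 ^ CARD('n) * (c * (4 * c ^ CARD('n) / (real N)\<^sup>2 * energy R (ew T) l f))" if "y \<in> cell 1" for j S y
    unfolding dv_def by (rule A.wsq_v_shift[OF that])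
  have B2: "wsq R (ew T) (gap S y) \<le> 4 ^ CARD('n) * (4 * (4 * c) ^ CARD('n) * (4 * c ^ CARD('n) / (real N)\<^sup>2 * energy R (ew T) l f))" if "y \<in> cell 1" for S y
    unfolding gap_def by (rule A.wsq_gap[OF that])
  define Bd where "Bd = 4 ^ CARD('n) * (c * (4 * c ^ CARD('n) / (real N)\<^sup>2)) + 4 ^ CARD('n) * (4 * (4 * c) ^ CARD('n) * (4 * c ^ CARD('n) / (real N)\<^sup>2))"
  have "integral (cell R) (\<lambda>x. ZU * ?L * (\<Sum>j\<in>UNIV. (A.\<xi> j x)\<^sup>2 * ew T x)) \<le>
    (1 + \<eta>) * (c * c ^ CARD('n) * energy R (ew UT) l f) + (1 + 1 / \<eta>) * K * (real CARD('n) * (2 ^ CARD('n) * Bd)) * (b * energy R (ew T) l f)"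
  proof (rule average_lower[OF cH])
    show "continuous_on (cell R) (\<lambda>x. ZU * ?L * (\<Sum>j\<in>UNIV. (A.\<xi> j x)\<^sup>2 * ew T x))"
      by (intro continuous_on_mult_left continuous_on_sum slow.wsq_integrand sper_cper A.sper_\<xi>)
  next
    fix y :: "real^'n" assume y: "y \<in> cell 1"
    have c1: "continuous_on (cell R) (\<lambda>x. (A.v j (x + y))\<^sup>2 * (ew U (x + y) * ew T x))" for j
      by (intro continuous_intros cper_comp[OF cv] cper_comp[OF cper_ewU] cper_comp[OF cper_ewT])
    have c0: "continuous_on (cell R) (\<lambda>x. RR j (x, y))" for j
      by (rule continuous_on_compose2[OF cRR]) (auto intro!: continuous_intros)
    have c2: "continuous_on (cell R) (\<lambda>x. RR j (x, y) * (ew U (x + y) * ew T x))" for j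
      by (intro continuous_intros c0 cper_comp[OF cper_ewU] cper_comp[OF cper_ewT])
    have I1: "(\<Sum>j\<in>UNIV. integral (cell R) (\<lambda>x. (A.v j (x + y))\<^sup>2 * (ew U (x + y) * ew T x))) \<le> c * c ^ CARD('n) * energy R (ew UT) l f"
    proof -
      have "(\<Sum>j\<in>UNIV. integral (cell R) (\<lambda>x. (A.v j (x + y))\<^sup>2 * (ew U (x + y) * ew T x))) \<le> (\<Sum>j\<in>UNIV. c * (c ^ CARD('n) * wsq R (ew UT) (A.\<Phi> j)))"
      proof (rule sum_mono)
        fix j
        have "integral (cell R) (\<lambda>x. (A.v j (x + y))\<^sup>2 * (ew U (x + y) * ew T x)) \<le>
          integral (cell R) (\<lambda>x. c * ((A.v j (x + y))\<^sup>2 * (ew U (x + y) * ew T (x + y))))"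
        proof (rule integral_cell_mono[OF c1])
          fix x
          have "((A.v j (x + y))\<^sup>2 * ew U (x + y)) * ew T x \<le> ((A.v j (x + y))\<^sup>2 * ew U (x + y)) * (c * ew T (x + y))"
            using fast.w_pos[of "x + y"] by (intro mult_left_mono ewT_shift y) auto
          then show "(A.v j (x + y))\<^sup>2 * (ew U (x + y) * ew T x) \<le> c * ((A.v j (x + y))\<^sup>2 * (ew U (x + y) * ew T (x + y)))"
            by (simp add: mult_ac)
        qed (intro continuous_intros cper_comp[OF cv] cper_comp[OF cper_ewU] cper_comp[OF cper_ewT])
        also have "\<dots> = c * wsq R (ew UT) (A.v j)"
          using ewUT_shift_integral[OF cper_power[OF cv[of j], of 2], of y] by (simp add: wsq_def)
        \<comment> \<open>Lattice translations fix the fast factor, so along them the full weight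
          varies slowly although it oscillates on the unit scale.\<close>
        also have "wsq R (ew UT) (A.v j) \<le> c ^ length (coords :: 'n list) * wsq R (ew UT) (A.\<Phi> j)"
          unfolding A.v_eq
        proof (rule both.wsq_Lts[OF sper_cper[OF A.sper_\<Phi>] N_pos])
          fix x :: "real^'n" and p :: nat and i :: 'n assume p: "p < N"
          have "ew U (x + real p *\<^sub>R axis i 1) = ew U x"
            using periodic_R_nat[of 1 "ew U" x p i] cper_ewU by (simp add: cper_def)
          then show "ew UT x \<le> c * ew UT (x + real p *\<^sub>R axis i 1)"
            using slow_axis[of "real p" x i] p fast.w_pos[of x] by (simp add: ew_UT mult.left_commute[of c])
        qed (use c_ge1 in auto)
        finally show "integral (cell R) (\<lambda>x. (A.v j (x + y))\<^sup>2 * (ew U (x + y) * ew T x)) \<le> c * (c ^ CARD('n) * wsq R (ew UT) (A.\<Phi> j))"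
          using c_ge1 by simp
      qed
      also have "\<dots> = c * c ^ CARD('n) * energy R (ew UT) l f"
        unfolding both.energy_sum[OF f] A.\<Phi>_def by (simp add: sum_distrib_left mult.assoc)
      finally show ?thesis .
    qed
    have I2: "(\<Sum>j\<in>(UNIV::'n set). integral (cell R) (\<lambda>x. RR j (x, y) * (ew U (x + y) * ew T x))) \<le> (real CARD('n) * (2 ^ CARD('n) * Bd)) * (b * energy R (ew T) l f)"
    proof -
      have "integral (cell R) (\<lambda>x. RR j (x, y) * (ew U (x + y) * ew T x)) \<le> 2 ^ CARD('n) * Bd * (b * energy R (ew T) l f)" for j :: 'n
      proof -
        have d: "cper R (dv j S y)" "cper R (gap S y)" for S
          unfolding dv_def gap_def by (intro cper_diff cper_add cper_sum cper_shift cv cF cg)+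
        have "integral (cell R) (\<lambda>x. RR j (x, y) * (ew U (x + y) * ew T x)) \<le> integral (cell R) (\<lambda>x. b * (RR j (x, y) * ew T x))"
        proof (rule integral_cell_mono[OF c2])
          fix x
          have "0 \<le> RR j (x, y)" unfolding RR_def by (intro sum_nonneg) simp
          then have "(RR j (x, y) * ew T x) * ew U (x + y) \<le> (RR j (x, y) * ew T x) * b"
            using slow.w_pos[of x] by (intro mult_left_mono ew_upper) auto
          then show "RR j (x, y) * (ew U (x + y) * ew T x) \<le> b * (RR j (x, y) * ew T x)" by (simp add: mult_ac)
        qed (intro continuous_intros c0 slow.w_cont)
        also have "\<dots> = b * integral (cell R) (\<lambda>x. \<Sum>S\<in>UNIV. (dv j S y x)\<^sup>2 * ew T x + (gap S y x)\<^sup>2 * ew T x)"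
          unfolding integral_cell_cmult RR_def fst_conv snd_conv sum_distrib_right distrib_right ..
        also have "integral (cell R) (\<lambda>x. \<Sum>S\<in>UNIV. (dv j S y x)\<^sup>2 * ew T x + (gap S y x)\<^sup>2 * ew T x)
          = (\<Sum>S\<in>UNIV. integral (cell R) (\<lambda>x. (dv j S y x)\<^sup>2 * ew T x + (gap S y x)\<^sup>2 * ew T x))"
          by (intro integral_cell_sum continuous_on_add slow.wsq_integrand d) simp
        also have "\<dots> = (\<Sum>S\<in>UNIV. wsq R (ew T) (dv j S y) + wsq R (ew T) (gap S y))"
          unfolding wsq_def by (intro sum.cong refl integral_cell_add slow.wsq_integrand d)
        also have "b * \<dots> \<le> b * (\<Sum>S\<in>(UNIV::'n set set). Bd * energy R (ew T) l f)"
        proof (intro mult_left_mono sum_mono)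
          fix S :: "'n set"
          show "wsq R (ew T) (dv j S y) + wsq R (ew T) (gap S y) \<le> Bd * energy R (ew T) l f"
            using add_mono[OF B1[OF y, of j S] B2[OF y, of S]] by (simp add: Bd_def algebra_simps)
        qed (use b_pos in auto)
        also have "\<dots> = 2 ^ CARD('n) * Bd * (b * energy R (ew T) l f)"
          using card_Pow[of "UNIV :: 'n set"] by simp
        finally show ?thesis .
      qed
      then have "(\<Sum>j\<in>(UNIV::'n set). integral (cell R) (\<lambda>x. RR j (x, y) * (ew U (x + y) * ew T x))) \<le> (\<Sum>j\<in>(UNIV::'n set). 2 ^ CARD('n) * Bd * (b * energy R (ew T) l f))"
        by (rule sum_mono)
      then show ?thesis by (simp add: mult.assoc)
    qed
    have "integral (cell R) (\<lambda>x. H (x, y)) = (\<Sum>j\<in>UNIV. integral (cell R) (\<lambda>x. (1 + \<eta>) * ((A.v j (x + y))\<^sup>2 * (ew U (x + y) * ew T x))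
        + (1 + 1 / \<eta>) * K * (RR j (x, y) * (ew U (x + y) * ew T x))))"
      unfolding H_def fst_conv snd_conv
      by (intro integral_cell_sum continuous_on_add continuous_on_mult_left c1 c2) simp
    also have "\<dots> = (\<Sum>j\<in>UNIV. (1 + \<eta>) * integral (cell R) (\<lambda>x. (A.v j (x + y))\<^sup>2 * (ew U (x + y) * ew T x))
        + (1 + 1 / \<eta>) * K * integral (cell R) (\<lambda>x. RR j (x, y) * (ew U (x + y) * ew T x)))"
      by (intro sum.cong refl) (simp add: integral_cell_add[OF continuous_on_mult_left[OF c1] continuous_on_mult_left[OF c2]])
    also have "\<dots> = (1 + \<eta>) * (\<Sum>j\<in>UNIV. integral (cell R) (\<lambda>x. (A.v j (x + y))\<^sup>2 * (ew U (x + y) * ew T x)))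
        + (1 + 1 / \<eta>) * K * (\<Sum>j\<in>UNIV. integral (cell R) (\<lambda>x. RR j (x, y) * (ew U (x + y) * ew T x)))"
      by (simp add: sum.distrib sum_distrib_left)
    also have "\<dots> \<le> (1 + \<eta>) * (c * c ^ CARD('n) * energy R (ew UT) l f) + (1 + 1 / \<eta>) * K * ((real CARD('n) * (2 ^ CARD('n) * Bd)) * (b * energy R (ew T) l f))"
      using \<eta> K0 by (intro add_mono mult_left_mono I1 I2) auto
    finally show "integral (cell R) (\<lambda>x. H (x, y)) \<le> (1 + \<eta>) * (c * c ^ CARD('n) * energy R (ew UT) l f) + (1 + 1 / \<eta>) * K * (real CARD('n) * (2 ^ CARD('n) * Bd)) * (b * energy R (ew T) l f)"
      by (simp only: mult.assoc)
  next
    fix x :: "real^'n"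
    define Hx where "Hx z = A.F (x + z) - (\<Sum>i\<in>UNIV. z $ i * pd i A.g x)" for z
    have sH: "smooth_fun Hx" unfolding Hx_def
      by (intro smooth_fun_diff smooth_fun_shift' sper_smooth[OF A.sper_F] smooth_fun_linear)
    have pdH: "pd j Hx z = pd j A.F (x + z) - pd j A.g x" for j z
      unfolding Hx_def
      by (simp add: pd_diff[OF smooth_fun_shift'[OF sper_smooth[OF A.sper_F]] smooth_fun_linear] pd_linear pd_shift'[OF sper_smooth[OF A.sper_F]])
    define kx where "kx z = theta z * Hx z" for z
    have skx: "smooth_fun kx" and supp: "supp1 kx" unfolding kx_def
      by (intro smooth_fun_mult smooth_fun_theta sH) (intro supp1_mult supp1_theta)
    define ph where "ph = perio kx"
    have sph: "sper 1 ph" unfolding ph_def by (rule sper_perio[OF skx supp])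
    have key: "A.\<xi> j x - pd j ph y = A.v j (x + y) + (\<Sum>S\<in>UNIV. theta (y - ind S) * dv j S y x - pd j theta (y - ind S) * gap S y x)"
      if y: "y \<in> cell 1" for j y
    proof -
      have "pd j ph y = (\<Sum>S\<in>UNIV. pd j kx (y - ind S))"
        unfolding ph_def pd_perio[OF skx supp] by (rule perio_cell[OF supp1_pd[OF skx supp] y])
      also have "\<dots> = (\<Sum>S\<in>UNIV. pd j theta (y - ind S) * Hx (y - ind S) + theta (y - ind S) * pd j Hx (y - ind S))"
        unfolding kx_def pd_mult[OF smooth_fun_theta sH] ..
      also have "\<dots> = (\<Sum>S\<in>UNIV. pd j theta (y - ind S) * (Hx y + gap S y x) + theta (y - ind S) * (l $ j - pd j A.g x - A.v j (x + y) - dv j S y x))"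
      proof (intro sum.cong refl arg_cong2[where f="(+)"] arg_cong2[where f="(*)"])
        fix S
        have "(\<Sum>i\<in>UNIV. ind S $ i * pd i A.g x) = (\<Sum>i\<in>S. pd i A.g x)"
          by (simp add: if_distrib[of "\<lambda>u. u * _"] sum.If_cases cong: if_cong)
        then show "Hx (y - ind S) = Hx y + gap S y x"
          by (simp add: Hx_def gap_def left_diff_distrib sum_subtractf)
        show "pd j Hx (y - ind S) = l $ j - pd j A.g x - A.v j (x + y) - dv j S y x"
          by (simp add: pdH dv_def A.v_def)
      qed
      \<comment> \<open>The value \<open>Hx y\<close>, which has no useful bound, is multiplied by a
        sum that is 0, and the common gradient by a sum that is 1. Only the defects from periodicity
        remain.\<close>
      also have "\<dots> = (\<Sum>S\<in>UNIV. pd j theta (y - ind S)) * Hx y + (\<Sum>S\<in>UNIV. theta (y - ind S)) * (l $ j - pd j A.g x - A.v j (x + y))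
         - (\<Sum>S\<in>UNIV. theta (y - ind S) * dv j S y x - pd j theta (y - ind S) * gap S y x)"
        unfolding sum_distrib_right sum.distrib[symmetric] sum_subtractf[symmetric]
        by (intro sum.cong refl) (simp add: algebra_simps)
      also have "\<dots> = (l $ j - pd j A.g x - A.v j (x + y)) - (\<Sum>S\<in>UNIV. theta (y - ind S) * dv j S y x - pd j theta (y - ind S) * gap S y x)"
        unfolding pd_theta_sum[OF y] theta_partition[OF y] by simp
      finally show ?thesis by (simp add: A.\<xi>_def)
    qed
    have err: "(\<Sum>S\<in>UNIV. theta (y - ind S) * dv j S y x - pd j theta (y - ind S) * gap S y x)\<^sup>2 \<le> K * RR j (x, y)" for j y
    proof -
      have "(\<Sum>S\<in>UNIV. theta (y - ind S) * dv j S y x - pd j theta (y - ind S) * gap S y x)\<^sup>2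
        \<le> (\<Sum>S\<in>UNIV. (theta (y - ind S) * dv j S y x - pd j theta (y - ind S) * gap S y x)\<^sup>2) * real CARD('n set)"
        by (rule sum_squared_le_sum_of_squares)
      also have "\<dots> \<le> (\<Sum>S\<in>UNIV. 2 * \<Theta>\<^sup>2 * ((dv j S y x)\<^sup>2 + (gap S y x)\<^sup>2)) * real CARD('n set)"
      proof (intro mult_right_mono sum_mono)
        fix S
        have "(theta (y - ind S) * dv j S y x - pd j theta (y - ind S) * gap S y x)\<^sup>2 \<le>
          2 * (theta (y - ind S) * dv j S y x)\<^sup>2 + 2 * (pd j theta (y - ind S) * gap S y x)\<^sup>2"
          using sum_squares_bound[of "theta (y - ind S) * dv j S y x" "- (pd j theta (y - ind S) * gap S y x)"]
          by (simp add: power2_diff)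
        also have "\<dots> \<le> 2 * (\<Theta>\<^sup>2 * (dv j S y x)\<^sup>2) + 2 * (\<Theta>\<^sup>2 * (gap S y x)\<^sup>2)"
        proof -
          have "(theta (y - ind S))\<^sup>2 \<le> \<Theta>\<^sup>2" "(pd j theta (y - ind S))\<^sup>2 \<le> \<Theta>\<^sup>2"
            using power_mono[OF \<Theta>(1)[of "y - ind S"], of 2] power_mono[OF \<Theta>(2)[of j "y - ind S"], of 2] by auto
          then show ?thesis unfolding power_mult_distrib by (intro add_mono mult_left_mono mult_right_mono) auto
        qed
        finally show "(theta (y - ind S) * dv j S y x - pd j theta (y - ind S) * gap S y x)\<^sup>2 \<le> 2 * \<Theta>\<^sup>2 * ((dv j S y x)\<^sup>2 + (gap S y x)\<^sup>2)"
          by (simp add: algebra_simps)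
      qed simp
      also have "\<dots> = K * RR j (x, y)"
        using card_Pow[of "UNIV :: 'n set"] by (simp add: RR_def K_def sum_distrib_left sum_distrib_right mult_ac)
      finally show ?thesis .
    qed
    have "ZU * ?L * (norm (\<Xi> x))\<^sup>2 \<le> ZU * eff_quad 1 U (\<Xi> x)"
      using fast.lam_min_le_q[of "\<Xi> x"] fast.Z_pos by (simp add: mult.assoc)
    \<comment> \<open>\<open>ph\<close> is built in coordinates centred at x; the translation by -x
      matches it with the fast weight at x + y.\<close>
    also have "\<dots> \<le> energy 1 (ew U) (\<Xi> x) (\<lambda>z. ph (z + - x))"
      using fast.q_le[OF sper_shift[OF sph], of "\<Xi> x" "- x"] by (simp add: mult.commute)
    also have "\<dots> = integral (cell 1) (\<lambda>y. (norm (\<Xi> x - grad ph y))\<^sup>2 * ew U (x + y))"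
    proof -
      have n: "cper 1 (\<lambda>z. (norm (\<Xi> x - grad ph (z + - x)))\<^sup>2)"
        unfolding norm_sq_sum using sph by (intro cper_sum cper_power sper_cper[of 1]) (simp del: add_uminus_conv_diff add: sper_diff sper_shift[of 1 "pd _ ph"] sper_pd)
      have "grad (\<lambda>z. ph (z + - x)) = (\<lambda>z. grad ph (z + - x))"
        using pd_shift[OF sper_smooth[OF sph], of _ "- x"] by (simp add: fun_eq_iff vec_eq_iff)
      then show ?thesis unfolding energy_def using integral_fast[OF cper_mult[OF n cper_ewU], of x] by simp
    qed
    finally have "ZU * ?L * (norm (\<Xi> x))\<^sup>2 * ew T x \<le> integral (cell 1) (\<lambda>y. (norm (\<Xi> x - grad ph y))\<^sup>2 * ew U (x + y)) * ew T x"
      using slow.w_pos[of x] by (intro mult_right_mono) auto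
    also have "\<dots> = integral (cell 1) (\<lambda>y. (norm (\<Xi> x - grad ph y))\<^sup>2 * (ew U (x + y) * ew T x))"
      by (simp add: mult.assoc[symmetric])
    also have "\<dots> \<le> integral (cell 1) (\<lambda>y. H (x, y))"
    proof (rule integral_cell_mono)
      show "continuous_on (cell 1) (\<lambda>y. (norm (\<Xi> x - grad ph y))\<^sup>2 * (ew U (x + y) * ew T x))"
        by (intro continuous_intros cper_comp[OF cper_ewU] continuous_on_grad sper_smooth[OF sph])
      show "continuous_on (cell 1) (\<lambda>y. H (x, y))"
        by (rule continuous_on_compose2[OF cH]) (auto intro!: continuous_intros)
      fix y :: "real^'n" assume y: "y \<in> cell 1"
      have "(norm (\<Xi> x - grad ph y))\<^sup>2 \<le> (\<Sum>j\<in>UNIV. (1 + \<eta>) * (A.v j (x + y))\<^sup>2 + (1 + 1 / \<eta>) * (K * RR j (x, y)))"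
        unfolding norm_sq_sum
      proof (rule sum_mono)
        fix j
        have "((\<Xi> x - grad ph y) $ j)\<^sup>2 = (A.v j (x + y) + (\<Sum>S\<in>UNIV. theta (y - ind S) * dv j S y x - pd j theta (y - ind S) * gap S y x))\<^sup>2"
          using key[OF y, of j] by (simp add: \<Xi>_def)
        also have "\<dots> \<le> (1 + \<eta>) * (A.v j (x + y))\<^sup>2 + (1 + 1 / \<eta>) * (\<Sum>S\<in>UNIV. theta (y - ind S) * dv j S y x - pd j theta (y - ind S) * gap S y x)\<^sup>2"
          by (rule young_sq[OF \<eta>])
        also have "\<dots> \<le> (1 + \<eta>) * (A.v j (x + y))\<^sup>2 + (1 + 1 / \<eta>) * (K * RR j (x, y))"
          using \<eta> by (intro add_left_mono mult_left_mono err) auto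
        finally show "((\<Xi> x - grad ph y) $ j)\<^sup>2 \<le> (1 + \<eta>) * (A.v j (x + y))\<^sup>2 + (1 + 1 / \<eta>) * (K * RR j (x, y))" .
      qed
      moreover have "0 \<le> ew U (x + y) * ew T x" using fast.w_pos[of "x + y"] slow.w_pos[of x] by simp
      ultimately have "(norm (\<Xi> x - grad ph y))\<^sup>2 * (ew U (x + y) * ew T x)
         \<le> (\<Sum>j\<in>UNIV. (1 + \<eta>) * (A.v j (x + y))\<^sup>2 + (1 + 1 / \<eta>) * (K * RR j (x, y))) * (ew U (x + y) * ew T x)"
        by (rule mult_right_mono)
      also have "\<dots> = H (x, y)" unfolding H_def fst_conv snd_conv sum_distrib_right
        by (intro sum.cong refl) (simp only: distrib_right mult.assoc)
      finally show "(norm (\<Xi> x - grad ph y))\<^sup>2 * (ew U (x + y) * ew T x) \<le> H (x, y)" .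
    qed
    finally show "ZU * ?L * (\<Sum>j\<in>UNIV. (A.\<xi> j x)\<^sup>2 * ew T x) \<le> integral (cell 1) (\<lambda>y. H (x, y))"
      unfolding norm_sq_sum by (simp add: \<Xi>_def sum_distrib_right[symmetric] mult.assoc)
  qed
  moreover have "integral (cell R) (\<lambda>x. ZU * ?L * (\<Sum>j\<in>UNIV. (A.\<xi> j x)\<^sup>2 * ew T x)) = ZU * ?L * energy R (ew T) l A.g"
  proof -
    have "integral (cell R) (\<lambda>x. \<Sum>j\<in>UNIV. (A.\<xi> j x)\<^sup>2 * ew T x) = energy R (ew T) l A.g"
      unfolding slow.energy_sum[OF A.sper_g] wsq_def A.\<xi>_def[symmetric]
      by (intro integral_cell_sum slow.wsq_integrand sper_cper A.sper_\<xi>) auto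
    then show ?thesis by simp
  qed
  moreover have "ZU * ?L * (eff_quad R T l * ZT) \<le> ZU * ?L * energy R (ew T) l A.g"
    using fast.Z_pos fast.lam_min_eff_diff_nonneg by (intro mult_left_mono slow.q_le A.sper_g) auto
  moreover have "(1 + 1 / \<eta>) * K * (real CARD('n) * (2 ^ CARD('n) * Bd)) * (b * energy R (ew T) l f) \<le>
      (1 + 1 / \<eta>) * K * (real CARD('n) * (2 ^ CARD('n) * Bd)) * (b / a * energy R (ew UT) l f)"
  proof (rule mult_left_mono)
    \<comment> \<open>The defects are bounded in the slow weight alone; the pointwise lower bound of
      the fast weight returns them to the full weight. Together with the upper bound used for
      \<open>RR\<close> this produces b / a.\<close>
    have "a * energy R (ew T) l f \<le> energy R (ew UT) l f"
    proof -
      have n: "continuous_on (cell R) (\<lambda>x. (norm (l - grad f x))\<^sup>2)"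
        by (intro continuous_intros continuous_on_grad sper_smooth[OF f])
      have "integral (cell R) (\<lambda>x. a * ((norm (l - grad f x))\<^sup>2 * ew T x)) \<le> energy R (ew UT) l f"
        unfolding energy_def
      proof (rule integral_cell_mono)
        fix x
        have "(norm (l - grad f x))\<^sup>2 * ew T x * a \<le> (norm (l - grad f x))\<^sup>2 * ew T x * ew U x"
          using slow.w_pos[of x] by (intro mult_left_mono ew_lower) auto
        then show "a * ((norm (l - grad f x))\<^sup>2 * ew T x) \<le> (norm (l - grad f x))\<^sup>2 * ew UT x"
          by (simp add: ew_UT mult_ac)
      qed (intro continuous_on_mult continuous_on_const n slow.w_cont both.w_cont)+
      then show ?thesis by (simp add: energy_def)
    qed
    then have "b * energy R (ew T) l f * a \<le> b * energy R (ew UT) l f" using b_pos by (simp add: mult.assoc mult.commute[of _ a])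
    then show "b * energy R (ew T) l f \<le> b / a * energy R (ew UT) l f" using a_pos by (simp add: field_simps)
    show "0 \<le> (1 + 1 / \<eta>) * K * (real CARD('n) * (2 ^ CARD('n) * Bd))"
      using \<eta> K0 c_ge1 unfolding Bd_def by (intro mult_nonneg_nonneg add_nonneg_nonneg) auto
  qed
  ultimately have "ZU * ?L * (eff_quad R T l * ZT) \<le> (1 + \<eta>) * (c * c ^ CARD('n) * energy R (ew UT) l f) +
      (1 + 1 / \<eta>) * K * (real CARD('n) * (2 ^ CARD('n) * Bd)) * (b / a * energy R (ew UT) l f)"
    by linarith
  also have "\<dots> = ((1 + \<eta>) * (c * c ^ CARD('n)) + (1 + 1 / \<eta>) * K * (b / a) * (real CARD('n) * (2 ^ CARD('n) * Bd))) * energy R (ew UT) l f"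
  proof -
    have "p * (q * j) + s * k * n * (t * j) = (p * q + s * k * t * n) * j" for p q s k n t j :: real
      by (simp add: algebra_simps)
    then show ?thesis .
  qed
  finally show ?thesis unfolding K_def Bd_def .
qed

end

section \<open>Two-scale bounds with relative errors\<close>

lemma exp_upper_aux:
  fixes u v t :: real assumes "0 \<le> u" "0 \<le> v" "0 \<le> t"
  shows "(1 + u) * (1 + v) + t \<le> exp (u + v + t)"
proof -
  have p: "1 \<le> (1 + u) * (1 + v)" using mult_mono[of 1 "1 + u" 1 "1 + v"] assms by simp
  have "(1 + u) * (1 + v) + t \<le> (1 + u) * (1 + v) * (1 + t)"
    using mult_right_mono[OF p, of t] assms by (simp add: algebra_simps)
  also have "\<dots> \<le> exp u * exp v * exp t"
    using assms by (intro mult_mono exp_ge_add_one_self) auto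
  finally show ?thesis by (simp add: exp_add)
qed

text \<open>Serves the choice \<eta> = 1 / N in Young's inequality: the main term gains only the
  factor 1 + 1 / N, while the error of size 1 / N^2 is enlarged to order 1 / N.\<close>

lemma one_plus_N_bound: "N > 0 \<Longrightarrow> (1 + 1 / (1 / real N)) / (real N)\<^sup>2 \<le> 2 / real N"
  by (simp add: power2_eq_square field_simps)

context two_scale
begin

text \<open>In the upper bound both \<kappa> and the corrector error are additive; this positive
  lower bound turns them into errors relative to the largest eigenvalue.\<close>

lemma lam_max_lower: "a / b \<le> lam_max (eff_diff 1 U)"
proof -
  have "a / b * (norm (axis undefined 1 :: real^'n))\<^sup>2 \<le> eff_quad 1 U (axis undefined 1)"
    by (rule fast.q_lower[OF a_pos ew_lower ew_upper])
  also have "\<dots> \<le> lam_max (eff_diff 1 U) * (norm (axis undefined 1 :: real^'n))\<^sup>2" by (rule fast.q_le_lam_max)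
  finally show ?thesis by simp
qed

text \<open>Both \<kappa> and \<eta> are taken as 1 / N. Of the exponent of c, 2 d comes from the
  two averages, one from freezing the slow weight and one from comparing the masses.\<close>

lemma upper_step:
  defines "M \<equiv> 1 + b / a + 2 * (real CARD('n) * (b / a * (4 ^ CARD('n) * 8)) * (real CARD('n) * 4)) * (b / a)"
  shows "eff_quad R UT l \<le> exp (M / real N) * c ^ (2 * CARD('n) + 2) * lam_max (eff_diff 1 U) * eff_quad R T l"
proof -
  let ?L = "lam_max (eff_diff 1 U)" and ?d = "CARD('n)" and ?N = "real N"
  define m0 where "m0 = real ?d * (b / a * (4 ^ ?d * 8)) * (real ?d * 4)"
  have m0: "m0 \<ge> 0" using a_pos b_pos by (simp add: m0_def)
  have N: "?N > 0" using N_pos by simp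
  have c0: "c > 0" using c_ge1 by simp
  have L: "?L > 0" using lam_max_lower a_pos b_pos by (meson divide_pos_pos less_le_trans)
  define BR where "BR = (1 + 1 / ?N) * (?L + 1 / ?N) * c ^ (2 * ?d) +
    (1 + 1 / (1 / ?N)) * (real ?d * (b / a * (4 ^ ?d * 8))) * (real ?d * (c ^ ?d * (4 * c ^ ?d / ?N\<^sup>2)))"
  have BRe: "BR = c ^ (2 * ?d) * ((1 + 1 / ?N) * (?L + 1 / ?N) + m0 * ((1 + 1 / (1 / ?N)) / ?N\<^sup>2))"
  proof -
    have "c ^ (2 * ?d) = c ^ ?d * c ^ ?d" by (simp only: mult_2 power_add)
    then show ?thesis unfolding BR_def m0_def by (simp add: add_divide_distrib distrib_left distrib_right mult_ac)
  qed
  have "BR \<le> c ^ (2 * ?d) * (?L * ((1 + 1 / ?N) * (1 + b / a / ?N) + 2 * m0 * (b / a) / ?N))"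
    unfolding BRe
  proof (rule mult_left_mono)
    have one: "1 \<le> ?L * (b / a)" using lam_max_lower a_pos b_pos by (simp add: field_simps)
    have "?L + 1 / ?N \<le> ?L * (1 + b / a / ?N)"
      using divide_right_mono[OF one, of ?N] N by (simp add: algebra_simps)
    then have 1: "(1 + 1 / ?N) * (?L + 1 / ?N) \<le> (1 + 1 / ?N) * (?L * (1 + b / a / ?N))"
      using N by (intro mult_left_mono) auto
    have "m0 * ((1 + 1 / (1 / ?N)) / ?N\<^sup>2) \<le> m0 * (2 / ?N)"
      using one_plus_N_bound[OF N_pos] m0 by (rule mult_left_mono)
    also have "\<dots> \<le> m0 * (2 / ?N) * (?L * (b / a))" using mult_left_mono[OF one, of "m0 * (2 / ?N)"] m0 N by simp
    finally show "(1 + 1 / ?N) * (?L + 1 / ?N) + m0 * ((1 + 1 / (1 / ?N)) / ?N\<^sup>2) \<le> ?L * ((1 + 1 / ?N) * (1 + b / a / ?N) + 2 * m0 * (b / a) / ?N)"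
      using 1 by (simp add: algebra_simps)
  qed (use c0 in simp)
  also have "\<dots> \<le> c ^ (2 * ?d) * (?L * exp (M / ?N))"
  proof -
    have "(1 + 1 / ?N) * (1 + b / a / ?N) + 2 * m0 * (b / a) / ?N \<le> exp (1 / ?N + b / a / ?N + 2 * m0 * (b / a) / ?N)"
      using N a_pos b_pos m0 by (intro exp_upper_aux) auto
    also have "1 / ?N + b / a / ?N + 2 * m0 * (b / a) / ?N = M / ?N"
      by (simp add: M_def m0_def add_divide_distrib)
    finally show ?thesis using c0 L by (intro mult_left_mono) auto
  qed
  finally have BR: "BR \<le> c ^ (2 * ?d) * (?L * exp (M / ?N))" .
  have "0 < (1 + 1 / ?N) * (?L + 1 / ?N)" using N L by (intro mult_pos_pos add_pos_pos) auto
  moreover have "0 \<le> m0 * ((1 + 1 / (1 / ?N)) / ?N\<^sup>2)" using m0 N by simp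
  ultimately have BR0: "BR > 0" unfolding BRe using c0 by (intro mult_pos_pos[of "c ^ _"] add_pos_nonneg[of "_ * _"]) auto
  have pos: "c * ZU * BR > 0" using c0 fast.Z_pos BR0 by simp
  have "eff_quad R UT l * ZUT / (c * ZU * BR) \<le> eff_quad R T l * ZT"
  proof (rule slow.le_q)
    fix f :: "real^'n \<Rightarrow> real" assume f: "sper R f"
    have "eff_quad R UT l * ZUT \<le> (c * ZU * BR) * energy R (ew T) l f"
      using upper_energy[OF f, of "1 / ?N" "1 / ?N" l] N N_pos unfolding BR_def by simp
    then show "eff_quad R UT l * ZUT / (c * ZU * BR) \<le> energy R (ew T) l f"
      using pos by (simp add: pos_divide_le_eq mult.commute)
  qed
  then have "eff_quad R UT l * ZUT \<le> eff_quad R T l * ZT * (c * ZU * BR)"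
    using pos by (simp add: pos_divide_le_eq)
  also have "\<dots> = (eff_quad R T l * c * BR) * (ZU * ZT)" by (simp add: mult_ac)
  also have "\<dots> \<le> (eff_quad R T l * c * BR) * (c * ZUT)"
    using slow.q_nonneg c0 BR0 by (intro mult_left_mono ZUT_bounds) auto
  finally have "eff_quad R UT l \<le> eff_quad R T l * c * BR * c"
    using both.Z_pos by (simp add: mult.assoc[symmetric])
  also have "\<dots> \<le> eff_quad R T l * c * (c ^ (2 * ?d) * (?L * exp (M / ?N))) * c"
    using slow.q_nonneg c0 by (intro mult_left_mono mult_right_mono BR) auto
  finally show ?thesis by (simp add: mult_ac)
qed

text \<open>Again \<eta> = 1 / N. Here the error is already proportional to the energy of the test
  function under the full weight, so it is relative from the start and the infimum can be taken at
  once.\<close>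

lemma lower_step:
  assumes \<Theta>: "\<And>z. \<bar>theta (z :: real^'n)\<bar> \<le> \<Theta>" "\<And>j z. \<bar>pd j theta (z :: real^'n)\<bar> \<le> \<Theta>"
  defines "M \<equiv> 1 + 2 * ((2 * 2 ^ CARD('n) * \<Theta>\<^sup>2) * (b / a) * (real CARD('n) * (2 ^ CARD('n) * (4 ^ CARD('n) * 4 + 4 ^ CARD('n) * (4 * 4 ^ CARD('n) * 4)))))"
  shows "lam_min (eff_diff 1 U) * eff_quad R T l \<le> exp (M / real N) * c ^ (2 * CARD('n) + 2) * eff_quad R UT l"
proof -
  let ?L = "lam_min (eff_diff 1 U)" and ?d = "CARD('n)" and ?N = "real N"
  define m1 where "m1 = (2 * 2 ^ ?d * \<Theta>\<^sup>2) * (b / a)"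
  define m2 where "m2 = real ?d * (2 ^ ?d * (4 ^ ?d * 4 + 4 ^ ?d * (4 * 4 ^ ?d * 4)))"
  have m1: "m1 \<ge> 0" using a_pos b_pos by (simp add: m1_def)
  have m2: "m2 \<ge> 0" by (simp add: m2_def)
  have N: "?N > 0" using N_pos by simp
  have c0: "c > 0" using c_ge1 by simp
  define Y where "Y = real ?d * (2 ^ ?d * (4 ^ ?d * (c * (4 * c ^ ?d / ?N\<^sup>2)) + 4 ^ ?d * (4 * (4 * c) ^ ?d * (4 * c ^ ?d / ?N\<^sup>2))))"
  define BR where "BR = (1 + 1 / ?N) * (c * c ^ ?d) + (1 + 1 / (1 / ?N)) * (2 * 2 ^ ?d * \<Theta>\<^sup>2) * (b / a) * Y"
  \<comment> \<open>All powers of c are raised to the common exponent 2 d + 1; the comparison of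
    masses adds the last one, as in the upper bound.\<close>
  have p1: "c * c ^ ?d \<le> c ^ (2 * ?d + 1)" using power_increasing[of "Suc ?d" "2 * ?d + 1" c] c_ge1 by simp
  have p2: "(4 * c) ^ ?d * c ^ ?d \<le> 4 ^ ?d * c ^ (2 * ?d + 1)"
  proof -
    have "(4 * c) ^ ?d * c ^ ?d = 4 ^ ?d * c ^ (2 * ?d)" by (simp add: power_mult_distrib mult_2 power_add)
    also have "\<dots> \<le> 4 ^ ?d * c ^ (2 * ?d + 1)" using c_ge1 by (intro mult_left_mono power_increasing) auto
    finally show ?thesis .
  qed
  have Y: "Y \<le> c ^ (2 * ?d + 1) * m2 / ?N\<^sup>2"
  proof -
    have "Y = real ?d * (2 ^ ?d * (4 ^ ?d * 4 * (c * c ^ ?d) + 4 ^ ?d * (4 * 4 * ((4 * c) ^ ?d * c ^ ?d)))) / ?N\<^sup>2"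
      unfolding Y_def by (simp add: add_divide_distrib distrib_left mult_ac)
    also have "\<dots> \<le> real ?d * (2 ^ ?d * (4 ^ ?d * 4 * c ^ (2 * ?d + 1) + 4 ^ ?d * (4 * 4 * (4 ^ ?d * c ^ (2 * ?d + 1))))) / ?N\<^sup>2"
      by (intro divide_right_mono mult_left_mono add_mono p1 p2) auto
    also have "\<dots> = c ^ (2 * ?d + 1) * m2 / ?N\<^sup>2" by (simp add: m2_def algebra_simps)
    finally show ?thesis .
  qed
  have "BR \<le> (1 + 1 / ?N) * c ^ (2 * ?d + 1) + (1 + 1 / (1 / ?N)) * (2 * 2 ^ ?d * \<Theta>\<^sup>2) * (b / a) * (c ^ (2 * ?d + 1) * m2 / ?N\<^sup>2)"
    unfolding BR_def using N a_pos b_pos by (intro add_mono mult_left_mono p1 Y) auto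
  also have "\<dots> = c ^ (2 * ?d + 1) * ((1 + 1 / ?N) * (1 + 0) + m1 * m2 * ((1 + 1 / (1 / ?N)) / ?N\<^sup>2))"
    by (simp add: m1_def add_divide_distrib distrib_left distrib_right mult_ac)
  also have "\<dots> \<le> c ^ (2 * ?d + 1) * ((1 + 1 / ?N) * (1 + 0) + m1 * m2 * (2 / ?N))"
    using c0 m1 m2 by (intro mult_left_mono add_left_mono one_plus_N_bound N_pos) auto
  also have "\<dots> \<le> c ^ (2 * ?d + 1) * exp (1 / ?N + 0 + m1 * m2 * (2 / ?N))"
    using c0 m1 m2 N by (intro mult_left_mono exp_upper_aux) auto
  also have "1 / ?N + 0 + m1 * m2 * (2 / ?N) = M / ?N"
    by (simp add: M_def m1_def m2_def add_divide_distrib)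
  finally have BR: "BR \<le> c ^ (2 * ?d + 1) * exp (M / ?N)" .
  have "0 \<le> Y" unfolding Y_def using c0 by simp
  then have BR0: "BR > 0" unfolding BR_def using c0 N a_pos b_pos by (intro add_pos_nonneg mult_pos_pos mult_nonneg_nonneg) (auto intro: add_pos_pos)
  have "ZU * ?L * (eff_quad R T l * ZT) / BR \<le> eff_quad R UT l * ZUT"
  proof (rule both.le_q)
    fix f :: "real^'n \<Rightarrow> real" assume f: "sper R f"
    have "ZU * ?L * (eff_quad R T l * ZT) \<le> BR * energy R (ew UT) l f"
      using lower_energy[OF f _ \<Theta>, of "1 / ?N" l] N unfolding BR_def Y_def by simp
    then show "ZU * ?L * (eff_quad R T l * ZT) / BR \<le> energy R (ew UT) l f"
      using BR0 by (simp add: pos_divide_le_eq mult.commute)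
  qed
  then have "ZU * ?L * (eff_quad R T l * ZT) \<le> eff_quad R UT l * ZUT * BR"
    using BR0 by (simp add: pos_divide_le_eq)
  also have "\<dots> \<le> eff_quad R UT l * (c * (ZU * ZT)) * BR"
    using both.q_nonneg BR0 by (intro mult_right_mono mult_left_mono ZUT_bounds) auto
  finally have "(?L * eff_quad R T l) * (ZU * ZT) \<le> (c * BR * eff_quad R UT l) * (ZU * ZT)"
    by (simp add: mult_ac)
  then have "?L * eff_quad R T l \<le> c * BR * eff_quad R UT l"
    using mult_pos_pos[OF fast.Z_pos slow.Z_pos] by (simp only: mult_le_cancel_right_pos)
  also have "\<dots> \<le> c * (c ^ (2 * ?d + 1) * exp (M / ?N)) * eff_quad R UT l"
    using both.q_nonneg c0 by (intro mult_left_mono mult_right_mono BR) auto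
  finally show ?thesis by (simp add: mult_ac)
qed

end

lemma theta_bounds:
  obtains \<Theta> where "\<And>z. \<bar>theta (z :: real^'n)\<bar> \<le> \<Theta>" "\<And>j z. \<bar>pd j theta (z :: real^'n)\<bar> \<le> \<Theta>"
proof -
  obtain K0 where K0: "\<And>z. \<bar>theta (z :: real^'n)\<bar> \<le> K0"
    using supp1_bounded[OF smooth_fun_continuous[OF smooth_fun_theta] supp1_theta] by metis
  have "\<exists>K. \<forall>z. \<bar>pd j theta (z :: real^'n)\<bar> \<le> K" for j
    using supp1_bounded[OF smooth_fun_continuous[OF smooth_fun_pd(1)[OF smooth_fun_theta]] supp1_pd[OF smooth_fun_theta supp1_theta]] by metis
  then obtain K where K: "\<And>j z. \<bar>pd j theta (z :: real^'n)\<bar> \<le> K j" by metis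
  have fin: "finite (range K)" by simp
  have "\<bar>pd j theta (z :: real^'n)\<bar> \<le> max K0 (Max (range K))" for j z
    using order.trans[OF K[of j z] Max_ge[OF fin rangeI]] by (simp add: le_max_iff_disj)
  moreover have "\<bar>theta (z :: real^'n)\<bar> \<le> max K0 (Max (range K))" for z using K0[of z] by auto
  ultimately show ?thesis using that by blast
qed

text \<open>The constant is fixed before U, T, R, c and N and depends on the dimension, a and b
  alone. This uniformity is what the iteration needs.\<close>

lemma two_scale_estimate:
  fixes a b :: real
  assumes "a > 0" "b > 0"
  shows "\<exists>C\<ge>0. \<forall>(U :: real^'n \<Rightarrow> real) T R c N m l. two_scale U T R c N m a b \<longrightarrow>
    lam_min (eff_diff 1 U) * eff_quad R T l \<le> exp (C / real N) * c ^ (2 * CARD('n) + 2) * eff_quad R (\<lambda>x. U x + T x) l \<and>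
    eff_quad R (\<lambda>x. U x + T x) l \<le> exp (C / real N) * c ^ (2 * CARD('n) + 2) * lam_max (eff_diff 1 U) * eff_quad R T l"
proof -
  obtain \<Theta> where \<Theta>: "\<And>z. \<bar>theta (z :: real^'n)\<bar> \<le> \<Theta>" "\<And>j z. \<bar>pd j theta (z :: real^'n)\<bar> \<le> \<Theta>"
    using theta_bounds by metis
  define M1 where "M1 = 1 + b / a + 2 * (real CARD('n) * (b / a * (4 ^ CARD('n) * 8)) * (real CARD('n) * 4)) * (b / a)"
  define M2 where "M2 = 1 + 2 * ((2 * 2 ^ CARD('n) * \<Theta>\<^sup>2) * (b / a) * (real CARD('n) * (2 ^ CARD('n) * (4 ^ CARD('n) * 4 + 4 ^ CARD('n) * (4 * 4 ^ CARD('n) * 4)))))"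
  define C where "C = max 0 (max M1 M2)"
  have "lam_min (eff_diff 1 U) * eff_quad R T l \<le> exp (C / real N) * c ^ (2 * CARD('n) + 2) * eff_quad R (\<lambda>x. U x + T x) l \<and>
    eff_quad R (\<lambda>x. U x + T x) l \<le> exp (C / real N) * c ^ (2 * CARD('n) + 2) * lam_max (eff_diff 1 U) * eff_quad R T l"
    if "two_scale U T R c N m a b" for U T :: "real^'n \<Rightarrow> real" and R c N m l
  proof -
    interpret two_scale U T R c N m a b by (rule that)
    have UT: "UT = (\<lambda>x. U x + T x)" by (simp add: fun_eq_iff UT_def)
    have e: "exp (M1 / real N) \<le> exp (C / real N)" "exp (M2 / real N) \<le> exp (C / real N)"
      by (auto simp: C_def intro!: divide_right_mono)
    have "lam_min (eff_diff 1 U) * eff_quad R T l \<le> exp (M2 / real N) * c ^ (2 * CARD('n) + 2) * eff_quad R UT l"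
      unfolding M2_def by (rule lower_step[OF \<Theta>])
    also have "\<dots> \<le> exp (C / real N) * c ^ (2 * CARD('n) + 2) * eff_quad R UT l"
      using c_ge1 both.q_nonneg by (intro mult_right_mono e) auto
    finally have 1: "lam_min (eff_diff 1 U) * eff_quad R T l \<le> exp (C / real N) * c ^ (2 * CARD('n) + 2) * eff_quad R UT l" .
    have L: "0 \<le> lam_max (eff_diff 1 U)" using lam_max_lower a_pos b_pos by (meson divide_nonneg_pos less_imp_le order.trans)
    have "eff_quad R UT l \<le> exp (M1 / real N) * c ^ (2 * CARD('n) + 2) * lam_max (eff_diff 1 U) * eff_quad R T l"
      unfolding M1_def by (rule upper_step)
    also have "\<dots> \<le> exp (C / real N) * c ^ (2 * CARD('n) + 2) * lam_max (eff_diff 1 U) * eff_quad R T l"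
      using c_ge1 slow.q_nonneg L by (intro mult_right_mono e) auto
    finally show ?thesis using 1 by (simp add: UT)
  qed
  moreover have "C \<ge> 0" by (simp add: C_def)
  ultimately show ?thesis by blast
qed

section \<open>Iteration over the scales\<close>

lemma integral_cell_scale:
  fixes h :: "real^'n \<Rightarrow> real"
  assumes h: "continuous_on UNIV h" and s: "s > 0"
  shows "integral (cell (R / s)) (\<lambda>x. h (s *\<^sub>R x)) = integral (cell R) h / s ^ CARD('n)"
proof -
  have "(h has_integral integral (cell R) h) (cbox 0 (R *\<^sub>R One))"
    unfolding cell_def by (intro integrable_integral integrable_continuous continuous_on_subset[OF h]) auto
  from has_integral_affinity'[OF this s, of 0]
  have "((\<lambda>x. h (s *\<^sub>R x)) has_integral (integral (cell R) h /\<^sub>R s ^ CARD('n))) (cbox 0 ((R / s) *\<^sub>R One))"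
    by (simp add: divide_inverse mult.commute)
  then show ?thesis unfolding cell_def by (simp add: integral_unique divide_inverse mult.commute)
qed

lemma potential_scale:
  assumes "potential R V" "s > 0" shows "potential (R / s) (\<lambda>x. V (s *\<^sub>R x))"
proof
  interpret potential R V by fact
  show "R / s > 0" using R_pos assms(2) by simp
  have "V (s *\<^sub>R (x + (R / s) *\<^sub>R axis i 1)) = V (s *\<^sub>R x)" for x i
    using U_cper assms(2) by (auto simp: cper_def periodic_R_def scaleR_right_distrib)
  then show "cper (R / s) (\<lambda>x. V (s *\<^sub>R x))"
    by (intro cperI cper_comp[OF U_cper]) (auto intro!: continuous_intros simp: periodic_R_def)
qed

text \<open>The function f(s x) / s has at x the gradient of f at s x, and the Jacobian cancels in
  the normalised quotient. The reverse inequality comes from scaling back by 1 / s.\<close>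

lemma eff_quad_scale_le:
  fixes V :: "real^'n \<Rightarrow> real"
  assumes V: "potential R V" and s: "s > 0"
  shows "eff_quad (R / s) (\<lambda>x. V (s *\<^sub>R x)) l \<le> eff_quad R V l"
proof -
  interpret A: potential R V by fact
  interpret B: potential "R / s" "\<lambda>x. V (s *\<^sub>R x)" by (rule potential_scale[OF V s])
  let ?q = "eff_quad (R / s) (\<lambda>x. V (s *\<^sub>R x)) l"
  have ew: "ew (\<lambda>x. V (s *\<^sub>R x)) = (\<lambda>x. ew V (s *\<^sub>R x))" by (simp add: fun_eq_iff ew_def)
  have Z: "integral (cell (R / s)) (ew (\<lambda>x. V (s *\<^sub>R x))) = A.Z / s ^ CARD('n)"
    unfolding ew by (rule integral_cell_scale[where h="ew V", OF A.w_cont s])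
  have "?q * A.Z \<le> eff_quad R V l * A.Z"
  proof (rule A.le_q)
    fix f :: "real^'n \<Rightarrow> real" assume f: "sper R f"
    define g where "g x = (1 / s) * f (s *\<^sub>R x + 0)" for x
    have g1: "smooth_fun g" unfolding g_def by (intro smooth_fun_cmult smooth_fun_affine sper_smooth[OF f])
    have "f (s *\<^sub>R (x + (R / s) *\<^sub>R axis i 1)) = f (s *\<^sub>R x)" for x i
      using f s by (auto simp: sper_def periodic_R_def scaleR_right_distrib)
    then have g: "sper (R / s) g" using g1 by (simp add: sper_def g_def periodic_R_def)
    have "pd i g = (\<lambda>x. (1 / s) * (s * pd i f (s *\<^sub>R x + 0)))" for i
      unfolding g_def pd_cmult[OF smooth_fun_affine(1)[OF sper_smooth[OF f]]] smooth_fun_affine(2)[OF sper_smooth[OF f]] ..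
    then have gr: "grad g x = grad f (s *\<^sub>R x)" for x
      using s by (simp add: vec_eq_iff)
    have "?q * (A.Z / s ^ CARD('n)) \<le> energy (R / s) (\<lambda>x. ew V (s *\<^sub>R x)) l g"
      using B.q_le[OF g, of l] unfolding Z ew[symmetric] .
    also have "\<dots> = energy R (ew V) l f / s ^ CARD('n)"
      unfolding energy_def gr
      by (rule integral_cell_scale[where h="\<lambda>x. (norm (l - grad f x))\<^sup>2 * ew V x", OF _ s]) (intro continuous_intros A.w_cont continuous_on_grad sper_smooth[OF f])
    finally show "?q * A.Z \<le> energy R (ew V) l f" using s by (simp add: divide_le_cancel)
  qed
  then show ?thesis using A.Z_pos by simp
qed

lemma eff_quad_scale:
  assumes V: "potential R V" and s: "s > 0"
  shows "eff_quad (R / s) (\<lambda>x. V (s *\<^sub>R x)) l = eff_quad R V l"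
proof (rule antisym[OF eff_quad_scale_le[OF V s]])
  show "eff_quad R V l \<le> eff_quad (R / s) (\<lambda>x. V (s *\<^sub>R x)) l"
    using eff_quad_scale_le[OF potential_scale[OF V s], of "1 / s" l] s by simp
qed

section \<open>Multi-scale potentials\<close>

text \<open>Retains what survives dropping the fastest scale: a Hoelder constant K and a lower bound
  \<rho> for the ratios. The supremum and infimum themselves may change under the shift.\<close>

definition multiscale :: "real \<Rightarrow> real \<Rightarrow> real \<Rightarrow> (nat \<Rightarrow> real^'n \<Rightarrow> real) \<Rightarrow> (nat \<Rightarrow> nat) \<Rightarrow> bool" where
  "multiscale \<alpha> K \<rho> U r \<longleftrightarrow> (\<forall>k. periodic_R 1 (U k) \<and> U k 0 = 0 \<and> (\<forall>x y. \<bar>U k x - U k y\<bar> \<le> K * norm (x - y) powr \<alpha>))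
    \<and> (\<forall>k\<ge>1. \<rho> \<le> real (r k))"

lemma scaleR_k_0 [simp]: "scaleR_k r 0 = 1" by (simp add: scaleR_k_def)
lemma scaleR_k_Suc: "scaleR_k r (Suc k) = scaleR_k r k * real (r (Suc k))"
  by (simp add: scaleR_k_def)
lemma scaleR_k_Suc': "scaleR_k r (Suc k) = real (r 1) * scaleR_k (\<lambda>k. r (Suc k)) k"
  by (induction k) (simp_all add: scaleR_k_Suc)

lemma scaleR_k_nat: "\<exists>m. scaleR_k r n = real m" 
  unfolding scaleR_k_def by (metis of_nat_prod)

lemma scaleR_k_dvd: "k \<le> n \<Longrightarrow> \<exists>m. scaleR_k r n = real m * scaleR_k r k"
proof (induction n)
  case (Suc n)
  show ?case
  proof (cases "k = Suc n")
    case False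
    then obtain m where "scaleR_k r n = real m * scaleR_k r k" using Suc by auto
    then have "scaleR_k r (Suc n) = real (m * r (Suc n)) * scaleR_k r k" by (simp add: scaleR_k_Suc)
    then show ?thesis by blast
  qed (auto intro: exI[of _ 1])
qed (auto intro: exI[of _ 1])

locale multiscale_setup =
  fixes \<alpha> K \<rho> :: real and U :: "nat \<Rightarrow> real^'n \<Rightarrow> real" and r :: "nat \<Rightarrow> nat"
  assumes \<alpha>: "0 < \<alpha>" "\<alpha> \<le> 1" and K: "0 \<le> K" and \<rho>: "2 \<le> \<rho>" and ms: "multiscale \<alpha> K \<rho> U r"
begin

lemma hoelder: "\<bar>U k x - U k y\<bar> \<le> K * norm (x - y) powr \<alpha>"
  and U_per: "periodic_R 1 (U k)" and U_0: "U k 0 = 0"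
  using ms unfolding multiscale_def by blast+

lemma r_ge: "\<rho> \<le> real (r (Suc k))"
  using ms unfolding multiscale_def by simp

lemma scale_pos: "scaleR_k r k > 0"
  by (induction k) (use \<rho> r_ge in \<open>auto simp: scaleR_k_Suc intro!: mult_pos_pos intro: less_le_trans[of 0 \<rho>]\<close>)

text \<open>Only the first ratio is estimated by \<rho>, all later ones by 2. Increments of the slow
  part then carry a single power of \<rho> and a geometric series whose sum depends on \<alpha>
  alone.\<close>

lemma scale_ge: "\<rho> * 2 ^ k \<le> scaleR_k r (Suc k)"
proof (induction k)
  case 0
  then show ?case using r_ge[of 0] by (simp add: scaleR_k_Suc)
next
  case (Suc k)
  have "2 \<le> real (r (Suc (Suc k)))" using \<rho> r_ge[of "Suc k"] by linarith
  with Suc have "(\<rho> * 2 ^ k) * 2 \<le> scaleR_k r (Suc k) * real (r (Suc (Suc k)))"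
    using scale_pos[of "Suc k"] by (intro mult_mono) auto
  then show ?case by (simp add: scaleR_k_Suc[of r "Suc k"])
qed

lemma U_cont: "continuous_on UNIV (U k)"
  unfolding continuous_on_def
proof
  fix x :: "real^'n"
  have "((\<lambda>y. K * norm (y - x) powr \<alpha>) \<longlongrightarrow> K * norm (x - x) powr \<alpha>) (at x)"
    using \<alpha> by (intro tendsto_intros) auto
  then have "((\<lambda>y. K * norm (y - x) powr \<alpha>) \<longlongrightarrow> 0) (at x)" by simp
  then have "((\<lambda>y. U k y - U k x) \<longlongrightarrow> 0) (at x)"
    by (rule Lim_null_comparison[rotated]) (intro always_eventually allI, unfold real_norm_def, rule hoelder)
  then show "(U k \<longlongrightarrow> U k x) (at x within UNIV)" by (rule LIM_zero_cancel)
qed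

lemma norm_le_of_coords: assumes "\<And>i. \<bar>z $ i\<bar> \<le> M" shows "norm (z :: real^'n) \<le> real CARD('n) * M"
proof -
  have "norm z \<le> (\<Sum>i\<in>UNIV. \<bar>z $ i\<bar>)" by (rule norm_le_l1_cart)
  also have "\<dots> \<le> (\<Sum>i\<in>(UNIV::'n set). M)" by (intro sum_mono assms)
  finally show ?thesis by simp
qed

lemma powr_alpha_le: assumes "t \<ge> 1" shows "t powr \<alpha> \<le> t"
  using powr_mono[of \<alpha> 1 t] \<alpha> assms by simp

text \<open>Periodicity moves x into the unit cell, where the normalisation at 0 turns the Hoelder
  modulus into a bound on values. This provides the bounds a and b of the fast weight.\<close>

lemma U_bound: "\<bar>U k x\<bar> \<le> K * real CARD('n)"
proof -
  obtain m where m: "m \<in> lattice" "x + m \<in> cell 1" by (rule cell_representative)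
  have "\<bar>U k x\<bar> = \<bar>U k (x + m) - U k 0\<bar>" using periodic_lattice[OF U_per m(1)] U_0 by simp
  also have "\<dots> \<le> K * norm (x + m) powr \<alpha>" using hoelder[of k "x + m" 0] by simp
  also have "\<dots> \<le> K * real CARD('n) powr \<alpha>"
    using m(2) \<alpha> K norm_le_of_coords[of "x + m" 1] by (intro mult_left_mono powr_mono2) (auto simp: mem_cell)
  also have "\<dots> \<le> K * real CARD('n)"
    using K by (intro mult_left_mono powr_alpha_le) (auto simp: Suc_leI)
  finally show ?thesis .
qed

lemma potential_Vsum: "potential (scaleR_k r n) (Vsum U r p n)"
proof
  show "scaleR_k r n > 0" by (rule scale_pos)
  show "cper (scaleR_k r n) (Vsum U r p n)"
    unfolding Vsum_def
  proof (rule cper_sum)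
    fix k assume "k \<in> {p..n}"
    then obtain m where m: "scaleR_k r n = real m * scaleR_k r k" using scaleR_k_dvd by fastforce
    have "U k ((1 / scaleR_k r k) *\<^sub>R (x + scaleR_k r n *\<^sub>R axis i 1)) = U k ((1 / scaleR_k r k) *\<^sub>R x)" for x i
      using periodic_R_nat[OF U_per, of k "(1 / scaleR_k r k) *\<^sub>R x" m i] m scale_pos[of k]
      by (simp add: scaleR_right_distrib)
    then show "cper (scaleR_k r n) (\<lambda>x. U k ((1 / scaleR_k r k) *\<^sub>R x))"
      by (intro cperI continuous_on_compose2[OF U_cont]) (auto intro!: continuous_intros simp: periodic_R_def)
  qed
qed

lemma geometric_pos: "0 < 1 - 1 / 2 powr \<alpha>" using \<alpha> by simp

lemma geometric_le: "(\<Sum>k<n. (1 / 2 powr \<alpha>) ^ k) \<le> 1 / (1 - 1 / 2 powr \<alpha>)"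
proof -
  have x: "0 < 1 / 2 powr \<alpha>" "1 / 2 powr \<alpha> < 1" using \<alpha> by auto
  have "(\<Sum>k<n. (1 / 2 powr \<alpha>) ^ k) = (1 - (1 / 2 powr \<alpha>) ^ n) / (1 - 1 / 2 powr \<alpha>)"
    using x by (subst sum_gp_strict) auto
  also have "\<dots> \<le> 1 / (1 - 1 / 2 powr \<alpha>)" using x by (intro divide_right_mono) auto
  finally show ?thesis .
qed

lemma slow_part_increment:
  "\<bar>Vsum U r 1 n (x + z) - Vsum U r 1 n x\<bar> \<le> K / (1 - 1 / 2 powr \<alpha>) * norm z powr \<alpha> * \<rho> powr (- \<alpha>)"
proof -
  let ?B = "norm z powr \<alpha> * \<rho> powr (- \<alpha>)"
  have "\<bar>Vsum U r 1 n (x + z) - Vsum U r 1 n x\<bar> \<le> (\<Sum>k=1..n. \<bar>U k ((1 / scaleR_k r k) *\<^sub>R (x + z)) - U k ((1 / scaleR_k r k) *\<^sub>R x)\<bar>)"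
    unfolding Vsum_def sum_subtractf[symmetric] by (rule sum_abs)
  also have "\<dots> = (\<Sum>k<n. \<bar>U (Suc k) ((1 / scaleR_k r (Suc k)) *\<^sub>R (x + z)) - U (Suc k) ((1 / scaleR_k r (Suc k)) *\<^sub>R x)\<bar>)"
    by (rule sum.reindex_bij_witness[of _ Suc "\<lambda>k. k - 1"]) auto
  also have "\<dots> \<le> (\<Sum>k<n. K * ?B * (1 / 2 powr \<alpha>) ^ k)"
  proof (rule sum_mono)
    fix k
    have s: "scaleR_k r (Suc k) > 0" by (rule scale_pos)
    have "\<bar>U (Suc k) ((1 / scaleR_k r (Suc k)) *\<^sub>R (x + z)) - U (Suc k) ((1 / scaleR_k r (Suc k)) *\<^sub>R x)\<bar>
      \<le> K * norm ((1 / scaleR_k r (Suc k)) *\<^sub>R z) powr \<alpha>"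
      using hoelder[of "Suc k" "(1 / scaleR_k r (Suc k)) *\<^sub>R (x + z)" "(1 / scaleR_k r (Suc k)) *\<^sub>R x"]
      by (simp add: scaleR_right_distrib)
    also have "norm ((1 / scaleR_k r (Suc k)) *\<^sub>R z) = norm z / scaleR_k r (Suc k)" using s by simp
    also have "K * (norm z / scaleR_k r (Suc k)) powr \<alpha> \<le> K * (norm z / (\<rho> * 2 ^ k)) powr \<alpha>"
      using K \<alpha> \<rho> s scale_ge[of k] by (intro mult_left_mono powr_mono2 divide_left_mono) auto
    also have "(norm z / (\<rho> * 2 ^ k)) powr \<alpha> = ?B * (1 / 2 powr \<alpha>) ^ k"
    proof -
      have "(2 ^ k) powr \<alpha> = (2 powr \<alpha>) ^ k" by (simp add: powr_realpow[symmetric] powr_powr mult.commute)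
      then show ?thesis using \<rho> by (simp add: powr_divide powr_mult powr_minus field_simps)
    qed
    finally show "\<bar>U (Suc k) ((1 / scaleR_k r (Suc k)) *\<^sub>R (x + z)) - U (Suc k) ((1 / scaleR_k r (Suc k)) *\<^sub>R x)\<bar> \<le> K * ?B * (1 / 2 powr \<alpha>) ^ k"
      by (simp add: mult.assoc)
  qed
  also have "\<dots> = K * ?B * (\<Sum>k<n. (1 / 2 powr \<alpha>) ^ k)" by (simp add: sum_distrib_left)
  also have "\<dots> \<le> K * ?B * (1 / (1 - 1 / 2 powr \<alpha>))"
    using K by (intro mult_left_mono geometric_le) auto
  finally show ?thesis by (simp add: mult_ac)
qed

text \<open>A box of side N costs 1 / N in the averages and N^\<alpha> \<rho>^(-\<alpha>), up to a
  constant, in the variation of the slow part. With N of order \<rho>^(\<alpha>/2) and \<alpha>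
  \<le> 1 both are of order at most \<rho>^(-\<alpha>/2).\<close>

definition N :: nat where "N = nat \<lceil>\<rho> powr (\<alpha> / 2)\<rceil>"
text \<open>The first factor is K times the sum of the geometric series; the second comes from the
  norm in the box, at most d N, hence at most 2 d \<rho>^(\<alpha>/2).\<close>

definition A :: real where "A = K / (1 - 1 / 2 powr \<alpha>) * (2 * real CARD('n))"
text \<open>The outer 2 is the one in the weight \<open>exp (-2 * U x)\<close>.\<close>

definition c :: real where "c = exp (2 * (A * \<rho> powr (- \<alpha> / 2)))"

lemma \<rho>_half: "1 \<le> \<rho> powr (\<alpha> / 2)" using \<rho> \<alpha> by (intro ge_one_powr_ge_zero) auto

lemma N_bounds: "\<rho> powr (\<alpha> / 2) \<le> real N" "real N \<le> 2 * \<rho> powr (\<alpha> / 2)" "N > 0"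
  using \<rho>_half unfolding N_def by linarith+

lemma slow_increment:
  assumes "\<And>i. \<bar>z $ i\<bar> \<le> real N"
  shows "\<bar>Vsum U r 1 n (x + z) - Vsum U r 1 n x\<bar> \<le> A * \<rho> powr (- \<alpha> / 2)"
proof -
  have d: "1 \<le> 2 * real CARD('n)" using zero_less_card_finite[where 'a='n] by linarith
  have "norm z \<le> real CARD('n) * real N" by (rule norm_le_of_coords[OF assms])
  also have "\<dots> \<le> real CARD('n) * (2 * \<rho> powr (\<alpha> / 2))" by (intro mult_left_mono N_bounds) auto
  also have "\<dots> = (2 * real CARD('n)) * \<rho> powr (\<alpha> / 2)" by simp
  finally have "norm z powr \<alpha> \<le> ((2 * real CARD('n)) * \<rho> powr (\<alpha> / 2)) powr \<alpha>"
    using \<alpha> by (intro powr_mono2) auto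
  also have "\<dots> = (2 * real CARD('n)) powr \<alpha> * \<rho> powr (\<alpha> / 2 * \<alpha>)" by (simp add: powr_mult powr_powr)
  \<comment> \<open>Here \<alpha> \<le> 1 enters twice: t^\<alpha> is at most t for t at least 1,
    and \<alpha>^2 / 2 is at most \<alpha> / 2.\<close>
  also have "\<dots> \<le> (2 * real CARD('n)) * \<rho> powr (\<alpha> / 2)"
    using \<alpha> \<rho> d by (intro mult_mono powr_alpha_le powr_mono) (auto simp: mult_le_cancel_left1)
  finally have z: "norm z powr \<alpha> \<le> (2 * real CARD('n)) * \<rho> powr (\<alpha> / 2)" .
  have "\<bar>Vsum U r 1 n (x + z) - Vsum U r 1 n x\<bar> \<le> K / (1 - 1 / 2 powr \<alpha>) * norm z powr \<alpha> * \<rho> powr (- \<alpha>)"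
    by (rule slow_part_increment)
  also have "\<dots> \<le> K / (1 - 1 / 2 powr \<alpha>) * ((2 * real CARD('n)) * \<rho> powr (\<alpha> / 2)) * \<rho> powr (- \<alpha>)"
    using K geometric_pos by (intro mult_right_mono mult_left_mono z divide_nonneg_pos) auto
  also have "\<dots> = A * (\<rho> powr (\<alpha> / 2) * \<rho> powr (- \<alpha>))" by (simp add: A_def)
  also have "\<rho> powr (\<alpha> / 2) * \<rho> powr (- \<alpha>) = \<rho> powr (- \<alpha> / 2)" by (simp add: powr_add[symmetric])
  finally show ?thesis .
qed

lemma two_scale_first: "two_scale (U 0) (Vsum U r 1 n) (scaleR_k r n) c N (SOME m. scaleR_k r n = real m)
   (exp (- 2 * (K * real CARD('n)))) (exp (2 * (K * real CARD('n))))"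
proof -
  interpret V: potential "scaleR_k r n" "Vsum U r 1 n" by (rule potential_Vsum)
  interpret F: potential 1 "U 0" using U_cont U_per by unfold_locales (auto intro: cperI)
  show ?thesis
  proof
    show "N > 0" by (rule N_bounds)
    show "scaleR_k r n = real (SOME m. scaleR_k r n = real m)" using scaleR_k_nat by (rule someI_ex)
    fix x
    show "exp (- 2 * (K * real CARD('n))) \<le> ew (U 0) x" "ew (U 0) x \<le> exp (2 * (K * real CARD('n)))"
      using U_bound[of 0 x] by (auto simp: ew_def abs_le_iff)
    fix z :: "real^'n" assume "\<And>i. \<bar>z $ i\<bar> \<le> real N"
    from slow_increment[OF this, of n x]
    show "ew (Vsum U r 1 n) x \<le> c * ew (Vsum U r 1 n) (x + z)"
      by (simp add: ew_def c_def exp_add[symmetric] abs_le_iff)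
  qed simp
qed

lemma Vsum_split: "Vsum U r 0 n = (\<lambda>x. U 0 x + Vsum U r 1 n x)"
  by (simp add: Vsum_def fun_eq_iff sum.atLeast_Suc_atMost)

lemma slow_rescaled: "eff_quad (scaleR_k r (Suc n)) (Vsum U r 1 (Suc n)) l =
   eff_quad (scaleR_k (\<lambda>k. r (Suc k)) n) (Vsum (\<lambda>k. U (Suc k)) (\<lambda>k. r (Suc k)) 0 n) l"
proof -
  have r1: "real (r 1) > 0" using r_ge[of 0] \<rho> by simp
  have "scaleR_k r (Suc n) / real (r 1) = scaleR_k (\<lambda>k. r (Suc k)) n" using r1 by (simp add: scaleR_k_Suc')
  moreover have "(\<lambda>x. Vsum U r 1 (Suc n) (real (r 1) *\<^sub>R x)) = Vsum (\<lambda>k. U (Suc k)) (\<lambda>k. r (Suc k)) 0 n"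
  proof
    fix x
    have "Vsum U r 1 (Suc n) (real (r 1) *\<^sub>R x) = (\<Sum>k=0..n. U (Suc k) ((1 / scaleR_k r (Suc k)) *\<^sub>R (real (r 1) *\<^sub>R x)))"
      unfolding Vsum_def by (rule sum.reindex_bij_witness[of _ Suc "\<lambda>k. k - 1"]) auto
    then show "Vsum U r 1 (Suc n) (real (r 1) *\<^sub>R x) = Vsum (\<lambda>k. U (Suc k)) (\<lambda>k. r (Suc k)) 0 n x"
      using r1 by (simp add: Vsum_def scaleR_k_Suc')
  qed
  ultimately show ?thesis using eff_quad_scale[OF potential_Vsum[of "Suc n" 1] r1, of l] by simp
qed

lemma multiscale_shift: "multiscale \<alpha> K \<rho> (\<lambda>k. U (Suc k)) (\<lambda>k. r (Suc k))"
  using ms unfolding multiscale_def by simp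

end

lemma multiscale_estimate:
  assumes \<alpha>: "0 < \<alpha>" "\<alpha> \<le> 1" and K: "0 \<le> K"
  shows "\<exists>C. \<forall>\<rho>\<ge>2. \<forall>n (U :: nat \<Rightarrow> real^'n \<Rightarrow> real) r l. multiscale \<alpha> K \<rho> U r \<longrightarrow>
    exp (- real n * (C * \<rho> powr (- \<alpha> / 2))) * (\<Prod>k=0..n. lam_min (eff_diff 1 (U k))) * (norm l)\<^sup>2 \<le> eff_quad (scaleR_k r n) (Vsum U r 0 n) l \<and>
    eff_quad (scaleR_k r n) (Vsum U r 0 n) l \<le> exp (real n * (C * \<rho> powr (- \<alpha> / 2))) * (\<Prod>k=0..n. lam_max (eff_diff 1 (U k))) * (norm l)\<^sup>2"
proof -
  let ?a = "exp (- 2 * (K * real CARD('n)))" and ?b = "exp (2 * (K * real CARD('n)))" and ?d = "CARD('n)"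
  from two_scale_estimate[of ?a ?b, where 'n='n, OF exp_gt_zero exp_gt_zero] obtain C0 where C0: "C0 \<ge> 0"
    and "\<forall>(U :: real^'n \<Rightarrow> real) T R c N m l. two_scale U T R c N m ?a ?b \<longrightarrow>
    lam_min (eff_diff 1 U) * eff_quad R T l \<le> exp (C0 / real N) * c ^ (2 * ?d + 2) * eff_quad R (\<lambda>x. U x + T x) l \<and>
    eff_quad R (\<lambda>x. U x + T x) l \<le> exp (C0 / real N) * c ^ (2 * ?d + 2) * lam_max (eff_diff 1 U) * eff_quad R T l"
    by (elim exE conjE) (rule that)
  note est = this(2)[rule_format]
  define D where "D = K / (1 - 1 / 2 powr \<alpha>) * (2 * real ?d)"
  \<comment> \<open>C0 pays for the averaging error 1 / N, the other term for the 2 d + 2 powers of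
    \<open>c\<close>.\<close>
  define C where "C = C0 + real (2 * ?d + 2) * (2 * D)"
  have main: "exp (- real n * (C * \<rho> powr (- \<alpha> / 2))) * (\<Prod>k=0..n. lam_min (eff_diff 1 (U k))) * (norm l)\<^sup>2 \<le> eff_quad (scaleR_k r n) (Vsum U r 0 n) l \<and>
    eff_quad (scaleR_k r n) (Vsum U r 0 n) l \<le> exp (real n * (C * \<rho> powr (- \<alpha> / 2))) * (\<Prod>k=0..n. lam_max (eff_diff 1 (U k))) * (norm l)\<^sup>2"
    if \<rho>: "\<rho> \<ge> 2" and ms: "multiscale \<alpha> K \<rho> U r" for \<rho> n and U :: "nat \<Rightarrow> real^'n \<Rightarrow> real" and r l
    using ms
  proof (induction n arbitrary: U r)
    \<comment> \<open>A single scale satisfies both bounds with exponent 0, so n + 1 scales cost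
      only n error factors.\<close>
    case (0 U r)
    interpret multiscale_setup \<alpha> K \<rho> U r using assms \<rho> 0 by unfold_locales
    interpret F: potential 1 "U 0" using U_cont U_per by unfold_locales (auto intro: cperI)
    have "Vsum U r 0 0 = U 0" by (simp add: Vsum_def fun_eq_iff)
    then show ?case using F.lam_min_le_q[of l] F.q_le_lam_max[of l] by simp
  next
    case (Suc n U r)
    interpret multiscale_setup \<alpha> K \<rho> U r using assms \<rho> Suc.prems by unfold_locales
    interpret F: potential 1 "U 0" using U_cont U_per by unfold_locales (auto intro: cperI)
    define \<epsilon> where "\<epsilon> = C * \<rho> powr (- \<alpha> / 2)"
    define fac where "fac = exp (C0 / real N) * c ^ (2 * ?d + 2)"
    have fac: "fac \<le> exp \<epsilon>" "0 < fac"
    proof -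
      have p: "0 < \<rho> powr (\<alpha> / 2)" using \<rho>_half by linarith
      have N0: "0 < real N" using N_bounds(1) p by linarith
      have "1 / real N \<le> 1 / \<rho> powr (\<alpha> / 2)" by (rule divide_left_mono[OF N_bounds(1) zero_le_one mult_pos_pos[OF N0 p]])
      also have "\<dots> = \<rho> powr (- \<alpha> / 2)" by (simp add: powr_minus_divide)
      finally have "C0 * (1 / real N) \<le> C0 * \<rho> powr (- \<alpha> / 2)" by (intro mult_left_mono C0)
      moreover have "c ^ (2 * ?d + 2) = exp (real (2 * ?d + 2) * (2 * (D * \<rho> powr (- \<alpha> / 2))))"
        unfolding c_def exp_of_nat_mult[symmetric] A_def D_def ..
      ultimately show "fac \<le> exp \<epsilon>"
        unfolding fac_def by (simp add: exp_add[symmetric] \<epsilon>_def C_def algebra_simps)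
      show "0 < fac" unfolding fac_def c_def by simp
    qed
    let ?q = "eff_quad (scaleR_k r (Suc n)) (Vsum U r 0 (Suc n)) l"
    let ?qT = "eff_quad (scaleR_k r (Suc n)) (Vsum U r 1 (Suc n)) l"
    let ?m = "\<lambda>k. lam_min (eff_diff 1 (U k))" and ?M = "\<lambda>k. lam_max (eff_diff 1 (U k))"
    have q0: "0 \<le> ?q" "0 \<le> ?qT"
      using potential.q_nonneg[OF potential_Vsum] by blast+
    have step: "?m 0 * ?qT \<le> exp \<epsilon> * ?q" "?q \<le> exp \<epsilon> * ?M 0 * ?qT"
    proof -
      note e = est[OF two_scale_first, of "Suc n" l, folded Vsum_split fac_def]
      have "?m 0 * ?qT \<le> fac * ?q" using e by blast
      also have "\<dots> \<le> exp \<epsilon> * ?q" using fac q0 by (intro mult_right_mono) auto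
      finally show "?m 0 * ?qT \<le> exp \<epsilon> * ?q" .
      have "0 \<le> ?M 0"
        using order.trans[OF F.q_nonneg F.q_le_lam_max, of "axis undefined 1"] by simp
      then have "fac * ?M 0 * ?qT \<le> exp \<epsilon> * ?M 0 * ?qT" using fac q0 by (intro mult_right_mono) auto
      then show "?q \<le> exp \<epsilon> * ?M 0 * ?qT" using e by linarith
    qed
    \<comment> \<open>Rescaling by the first ratio identifies the slow part with the potential of
      the shifted sequences; the induction is general in U and r for this purpose.\<close>
    note IH = Suc.IH[OF multiscale_shift, folded \<epsilon>_def slow_rescaled]
    have pr: "(\<Prod>k=0..Suc n. f k) = f 0 * (\<Prod>k=0..n. f (Suc k))" for f :: "nat \<Rightarrow> real"
      by (simp only: prod.atLeast0_atMost_Suc_shift comp_def)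
    have m0: "0 \<le> ?m 0" by (rule F.lam_min_eff_diff_nonneg)
    have M0: "0 \<le> ?M 0"
      using order.trans[OF F.q_nonneg F.q_le_lam_max, of "axis undefined 1"] by simp
    have "?m 0 * (exp (- real n * \<epsilon>) * (\<Prod>k=0..n. ?m (Suc k)) * (norm l)\<^sup>2) \<le> ?m 0 * ?qT"
      using IH m0 by (intro mult_left_mono) auto
    also have "\<dots> \<le> exp \<epsilon> * ?q" by (rule step)
    finally have "exp (- \<epsilon>) * (?m 0 * (exp (- real n * \<epsilon>) * (\<Prod>k=0..n. ?m (Suc k)) * (norm l)\<^sup>2)) \<le> exp (- \<epsilon>) * (exp \<epsilon> * ?q)"
      by (intro mult_left_mono) auto
    also have "\<dots> = ?q" by (simp add: exp_minus)
    finally have "exp (- \<epsilon>) * (?m 0 * (exp (- real n * \<epsilon>) * (\<Prod>k=0..n. ?m (Suc k)) * (norm l)\<^sup>2)) \<le> ?q" .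
    moreover have "exp (- real (Suc n) * \<epsilon>) = exp (- \<epsilon>) * exp (- real n * \<epsilon>)"
      unfolding exp_add[symmetric] by (rule arg_cong[where f=exp]) (simp add: algebra_simps)
    ultimately have 1: "exp (- real (Suc n) * \<epsilon>) * (\<Prod>k=0..Suc n. ?m k) * (norm l)\<^sup>2 \<le> ?q"
      unfolding pr by (simp only: mult_ac)
    have "?q \<le> exp \<epsilon> * ?M 0 * ?qT" by (rule step)
    also have "\<dots> \<le> exp \<epsilon> * ?M 0 * (exp (real n * \<epsilon>) * (\<Prod>k=0..n. ?M (Suc k)) * (norm l)\<^sup>2)"
      using IH M0 by (intro mult_left_mono) auto
    also have "\<dots> = (exp \<epsilon> * exp (real n * \<epsilon>)) * (\<Prod>k=0..Suc n. ?M k) * (norm l)\<^sup>2"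
      unfolding pr by (simp add: mult_ac)
    also have "exp \<epsilon> * exp (real n * \<epsilon>) = exp (real (Suc n) * \<epsilon>)"
      by (simp add: exp_add[symmetric] algebra_simps)
    finally show ?case using 1 unfolding \<epsilon>_def by blast
  qed
  then show ?thesis by blast
qed

text \<open>The seminorm is a supremum of reals, and the boundedness contained in
  \<open>holder_torus\<close> is what makes it dominate each quotient.\<close>

lemma holder_torus_bound:
  assumes "holder_torus \<alpha> T" "holder_seminorm \<alpha> T \<le> K"
  shows "\<bar>T x - T y\<bar> \<le> K * norm (x - y) powr \<alpha>"
proof (cases "x = y")
  case False
  have "\<bar>T x - T y\<bar> / norm (x - y) powr \<alpha> \<le> holder_seminorm \<alpha> T"
    unfolding holder_seminorm_def using assms(1) False unfolding holder_torus_def by (intro cSup_upper) auto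
  with assms(2) have "\<bar>T x - T y\<bar> / norm (x - y) powr \<alpha> \<le> K" by linarith
  then show ?thesis using False by (simp add: pos_divide_le_eq)
qed simp

theorem theorem3p1:
  fixes \<alpha> K\<^sub>\<alpha> K\<^sub>0 :: real
  assumes "0 < \<alpha>" and "\<alpha> \<le> 1"
  shows "\<exists>C::real. \<forall>(U :: nat \<Rightarrow> real^'n \<Rightarrow> real) (r :: nat \<Rightarrow> nat).
     (\<forall>k. holder_torus \<alpha> (U k) \<and> U k 0 = 0)
     \<and> bdd_above (range (\<lambda>k. holder_seminorm \<alpha> (U k)))
     \<and> K\<^sub>\<alpha> = (SUP k. holder_seminorm \<alpha> (U k))
     \<and> bdd_above (range (\<lambda>k. osc (U k)))
     \<and> K\<^sub>0 = (SUP k. osc (U k))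
     \<and> (\<forall>k\<ge>1. r k \<ge> 2)
     \<and> (INF k\<in>{1..}. real (r k)) powr \<alpha> \<ge> K\<^sub>\<alpha>
     \<longrightarrow> (\<forall>n\<ge>1. let \<epsilon> = C * (INF k\<in>{1..}. real (r k)) powr (-\<alpha>/2) in
           loewner_le ((exp (- real n * \<epsilon>) * (\<Prod>k=0..n. lam_min (eff_diff 1 (U k)))) *\<^sub>R mat 1)
                      (eff_diff (scaleR_k r n) (Vsum U r 0 n))
         \<and> loewner_le (eff_diff (scaleR_k r n) (Vsum U r 0 n))
                      ((exp (real n * \<epsilon>) * (\<Prod>k=0..n. lam_max (eff_diff 1 (U k)))) *\<^sub>R mat 1))"
proof -
  \<comment> \<open>The constant is obtained before U and r are introduced. The absolute value
    supplies a nonnegative Hoelder constant from the bare real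
    \<open>K\<^sub>\<alpha>\<close>.\<close>
  from multiscale_estimate[OF assms, of "\<bar>K\<^sub>\<alpha>\<bar>", where 'n='n] obtain C where
    "\<forall>\<rho>\<ge>2. \<forall>n (U :: nat \<Rightarrow> real^'n \<Rightarrow> real) r l. multiscale \<alpha> \<bar>K\<^sub>\<alpha>\<bar> \<rho> U r \<longrightarrow>
    exp (- real n * (C * \<rho> powr (- \<alpha> / 2))) * (\<Prod>k=0..n. lam_min (eff_diff 1 (U k))) * (norm l)\<^sup>2 \<le> eff_quad (scaleR_k r n) (Vsum U r 0 n) l \<and>
    eff_quad (scaleR_k r n) (Vsum U r 0 n) l \<le> exp (real n * (C * \<rho> powr (- \<alpha> / 2))) * (\<Prod>k=0..n. lam_max (eff_diff 1 (U k))) * (norm l)\<^sup>2"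
    by (meson abs_ge_zero)
  note C = this[rule_format]
  show ?thesis
  proof (intro exI[of _ C] allI impI, elim conjE)
    fix U :: "nat \<Rightarrow> real^'n \<Rightarrow> real" and r :: "nat \<Rightarrow> nat" and n :: nat
    assume U: "\<forall>k. holder_torus \<alpha> (U k) \<and> U k 0 = 0"
      and bdd: "bdd_above (range (\<lambda>k. holder_seminorm \<alpha> (U k)))" and K: "K\<^sub>\<alpha> = (SUP k. holder_seminorm \<alpha> (U k))"
      and r: "\<forall>k\<ge>1. r k \<ge> 2"
    define \<rho> where "\<rho> = (INF k\<in>{1..}. real (r k))"
    have \<rho>2: "\<rho> \<ge> 2" unfolding \<rho>_def using r by (intro cINF_greatest) auto
    have \<rho>r: "\<rho> \<le> real (r k)" if "k \<ge> 1" for k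
      unfolding \<rho>_def using that by (intro cINF_lower bdd_belowI[of _ 0]) auto
    have "holder_seminorm \<alpha> (U k) \<le> \<bar>K\<^sub>\<alpha>\<bar>" for k
      using cSUP_upper[OF _ bdd, of k] K by auto
    then have ms: "multiscale \<alpha> \<bar>K\<^sub>\<alpha>\<bar> \<rho> U r"
      using U \<rho>r holder_torus_bound unfolding multiscale_def holder_torus_def by blast
    interpret multiscale_setup \<alpha> "\<bar>K\<^sub>\<alpha>\<bar>" \<rho> U r using assms \<rho>2 ms by unfold_locales auto
    interpret V: potential "scaleR_k r n" "Vsum U r 0 n" by (rule potential_Vsum)
    have id: "x \<bullet> ((t *\<^sub>R mat 1) *v x) = t * (norm x)\<^sup>2" for t and x :: "real^'n"
      by (simp add: scaleR_matrix_vector_assoc[symmetric] power2_norm_eq_inner)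
    show "let \<epsilon> = C * (INF k\<in>{1..}. real (r k)) powr (-\<alpha>/2) in
           loewner_le ((exp (- real n * \<epsilon>) * (\<Prod>k=0..n. lam_min (eff_diff 1 (U k)))) *\<^sub>R mat 1)
                      (eff_diff (scaleR_k r n) (Vsum U r 0 n))
         \<and> loewner_le (eff_diff (scaleR_k r n) (Vsum U r 0 n))
                      ((exp (real n * \<epsilon>) * (\<Prod>k=0..n. lam_max (eff_diff 1 (U k)))) *\<^sub>R mat 1)"
      unfolding Let_def loewner_le_def id V.quad_form_eff_diff \<rho>_def[symmetric]
      using C[OF \<rho>2 ms] by blast
  qed
qed

end
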